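(* Let $0<\zeta<\pi$ and let $N$ be an arbitrary non-negative integer. Let $\lambda$ and $\nu$ be complex numbers satisfying $\left| \Re\lambda - \frac{1}{2} \right| < N + \frac{1}{2}$ and $\Re\nu > N - \Re\lambda$. Put $\gamma _{\lambda,\nu, n} = (\nu + \lambda - n)\zeta - (\lambda - n)\tfrac{\pi }{2}$. Then $$C_\nu ^{(\lambda )} (\cos \zeta ) = \frac{2}{\Gamma (\lambda )(2\sin\zeta)^\lambda }\left( \sum_{n = 0}^{N - 1}a_n \left( \lambda - \tfrac{1}{2} \right)\frac{\Gamma (\nu + \lambda - n)}{\Gamma (\nu + 1)}\frac{\cos (\gamma _{\lambda,\nu, n} )}{\sin ^n \zeta } + R_N^{(C)} (\zeta ,\lambda ,\nu ) \right),$$ where the remainder term satisfies the estimate $$\left| R_N^{(C)} (\zeta ,\lambda ,\nu ) \right| \le \left|\frac{\sin (\pi \lambda )}{\sin (\pi \Re\lambda )}\right| \left| a_N \left( \Re\lambda - \tfrac{1}{2} \right) \right|\frac{\Gamma (\Re\nu+\Re\lambda - N)}{\left| {\Gamma (\nu + 1)} \right|}\frac{\cosh (\Im (\gamma _{\lambda ,\nu ,N} ))}{\sin ^N \zeta}.$$ With the modified conditions $\left| \Re\lambda - \frac{1}{2} \right| < N + \frac{1}{2}$ and $\Re\nu > N - \Re\lambda +1$, one also has $$\begin{aligned}\left| R_N^{(C)} (\zeta ,\lambda ,\nu ) \right| \le \; & \left|\frac{\sin (\pi \lambda )}{\sin (\pi \Re\lambda )}\right|\left| a_N \left( \Re\lambda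 - \tfrac{1}{2} \right) \right|\frac{\Gamma (\Re\nu+\Re\lambda - N)}{\left| \Gamma (\nu + 1) \right|}\frac{\left| \cos (\gamma _{\lambda ,\nu ,N} )\right|}{\sin ^N \zeta } \\ & + \left|\frac{\sin (\pi \lambda )}{\sin (\pi \Re\lambda )}\right|\left| a_{N + 1} \left( \Re\lambda - \tfrac{1}{2} \right) \right|\frac{\Gamma (\Re\nu+\Re\lambda - N - 1)}{\left| \Gamma (\nu + 1) \right|}\frac{\left| \sin (\gamma _{\lambda ,\nu ,N} ) \right|}{\sin ^{N + 1} \zeta } .\end{aligned}$$ If $\Re\lambda $ is an integer, then the limiting values have to be taken in these bounds.
   Context: The Gegenbauer function is defined for $-1<x<1$ by $$C_\nu ^{(\lambda )} (x) = \frac{\sqrt\pi\, \Gamma (\nu + 2\lambda )}{\Gamma (\lambda )\Gamma (\nu + 1)\left(2\sqrt{1-x^2}\right)^{\lambda - \frac{1}{2}} }\mathsf{P}_{\nu + \lambda - \frac{1}{2}}^{\frac{1}{2} - \lambda } (x),$$ where $\mathsf{P}_\nu ^\mu (x) = \left( \frac{1 + x}{1 - x} \right)^{\mu /2} \mathbf{F}\left(\nu+1,-\nu;1-\mu;\tfrac{1-x}{2}\right)$ is the Ferrers function of the first kind and $\mathbf{F}(a,b;c;w)=\sum_{n\ge 0}\frac{(a)_n(b)_n}{\Gamma(c+n)\,n!}w^n$ ($|w|<1$) is the regularised hypergeometric function. $1/\Gamma$ is $0$ at the poles of $\Gamma$ (when $1/\Gamma(\lambda)=0$, the assertion is that the expansion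 holds with some remainder satisfying the bounds). $a_n (\mu ) = \frac{(4\mu ^2 - 1^2 )(4\mu ^2 - 3^2 ) \cdots (4\mu ^2 - (2n - 1)^2 )}{8^n n!}$. "Limiting value" means that $|a_k(\Re\lambda-\frac12)|/|\sin(\pi\Re\lambda)|$ is replaced by $\lim_{x\to\Re\lambda}|a_k(x-\frac12)|/|\sin(\pi x)|$. *)

theory Defs
  imports "HOL-Analysis.Analysis"
begin

definition hyp2f1_reg :: "complex \<Rightarrow> complex \<Rightarrow> complex \<Rightarrow> complex \<Rightarrow> complex" where
  "hyp2f1_reg a b c w =
     (\<Sum>n. pochhammer a n * pochhammer b n * rGamma (c + of_nat n) / fact n * w ^ n)"

definition ferrers_P :: "complex \<Rightarrow> complex \<Rightarrow> real \<Rightarrow> complex" where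
  "ferrers_P \<nu> \<mu> x =
     of_real ((1 + x) / (1 - x)) powr (\<mu> / 2) *
     hyp2f1_reg (\<nu> + 1) (- \<nu>) (1 - \<mu>) (of_real ((1 - x) / 2))"

text \<open>The reciprocals of the Gamma function are written with \<^const>\<open>rGamma\<close>, which is
  \<open>0\<close> at the poles.\<close>

definition gegenbauer_C :: "complex \<Rightarrow> complex \<Rightarrow> real \<Rightarrow> complex" where
  "gegenbauer_C \<nu> l x =
     of_real (sqrt pi) * Gamma (\<nu> + 2 * l) * rGamma l * rGamma (\<nu> + 1) /
     of_real (2 * sqrt (1 - x\<^sup>2)) powr (l - 1 / 2) *
     ferrers_P (\<nu> + l - 1 / 2) (1 / 2 - l) x"

definition acoef :: "nat \<Rightarrow> 'a::field_char_0 \<Rightarrow> 'a" where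
  "acoef n \<mu> = (\<Prod>k = 1..n. 4 * \<mu>\<^sup>2 - (2 * of_nat k - 1)\<^sup>2) / (8 ^ n * fact n)"

text \<open>The quotient \<open>|a\<^sub>k(x - 1/2)| / |sin (\<pi>x)|\<close>, with its limiting value at the integers.\<close>

definition acoef_sin_ratio :: "nat \<Rightarrow> real \<Rightarrow> real" where
  "acoef_sin_ratio k x =
     (if x \<in> \<int> then Lim (at x) (\<lambda>t. \<bar>acoef k (t - 1 / 2)\<bar> / \<bar>sin (pi * t)\<bar>)
      else \<bar>acoef k (x - 1 / 2)\<bar> / \<bar>sin (pi * x)\<bar>)"

definition gamma_phase :: "real \<Rightarrow> complex \<Rightarrow> complex \<Rightarrow> nat \<Rightarrow> complex" where
  "gamma_phase \<zeta> l \<nu> n =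
     (\<nu> + l - of_nat n) * of_real \<zeta> - (l - of_nat n) * of_real (pi / 2)"

end

theory Submission
  imports Defs "HOL-Complex_Analysis.Complex_Analysis"
begin

text \<open>
  Write \<open>s = \<nu> + \<lambda>\<close> and \<open>w\<^sub>\<plusminus> = (1 \<plusminus> i cot \<zeta>) / 2\<close>. For real \<open>1 < \<lambda> < 1 + Re s\<close> the Ferrers function is
  given by the Mehler--Dirichlet integral of \<open>e\<^sup>i\<^sup>s\<^sup>\<phi> (cos \<phi> - cos \<zeta>)\<^bsup>\<lambda>-1\<^esup>\<close> over \<open>[-\<zeta>, \<zeta>]\<close>. Moving the
  contour to the vertical half-lines \<open>\<plusminus>\<zeta> + i y\<close>, \<open>y > 0\<close>, turns it into the two integrals
  \<open>J\<^sub>\<plusminus> = \<integral> (1 - e\<^bsup>-y\<^esup>)\<^bsup>\<lambda>-1\<^esup> e\<^bsup>-sy\<^esup> (1 + w\<^sub>\<plusminus> (e\<^sup>y - 1))\<^bsup>\<lambda>-1\<^esup> dy\<close>, and the identity extends to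
  \<open>0 < Re \<lambda> < 1 + Re s\<close> by analytic continuation in \<open>\<lambda>\<close>.

  For \<open>0 < Re \<lambda> < 1\<close> the last factor of the integrand is \<open>\<integral> q\<^bsup>-\<lambda>\<^esup> e\<^bsup>-q\<^esup> exp (- w\<^sub>\<plusminus> (e\<^sup>y - 1) q) dq / \<Gamma>(1 - \<lambda>)\<close>.
  Subtracting from the inner exponential its Taylor polynomial of degree \<open>N - 1\<close> produces exactly
  the first \<open>N\<close> terms of the expansion, and leaves a double integral which converges for
  \<open>-N < Re \<lambda> < N + 1\<close> and is holomorphic there; so the formula holds in the whole strip.
  Since \<open>Re w\<^sub>\<plusminus> > 0\<close>, the Taylor remainder of \<open>e\<^bsup>-x\<^esup>\<close> is at most \<open>|x|\<^sup>N / N!\<close> and the double integral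
  of this majorant is a product of Gamma functions; this gives the first bound. The second one
  splits \<open>e\<^bsup>i\<gamma>\<^esup> B\<^sub>+ + e\<^bsup>-i\<gamma>\<^esup> B\<^sub>-\<close> as \<open>cos \<gamma> (B\<^sub>+ + B\<^sub>-) + i sin \<gamma> (B\<^sub>+ - B\<^sub>-)\<close> and uses a Lipschitz
  bound for the normalised Taylor remainder.
\<close>

section \<open>Parameter integrals and analytic continuation\<close>

lemma norm_difference_le_Cauchy:
  fixes f :: "complex \<Rightarrow> complex"
  assumes holo: "f holomorphic_on ball z r" and "0 < r"
    and bound: "\<And>w. w \<in> ball z r \<Longrightarrow> cmod (f w) \<le> B"
    and h: "cmod h < r / 3"
  shows "cmod (f (z + h) - f z) \<le> 3 * B / r * cmod h"
proof -
  have deriv_bound: "cmod (deriv f w) \<le> 3 * B / r" if w: "w \<in> ball z (r / 3)" for w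
  proof -
    have sub: "cball w (r / 3) \<subseteq> ball z r"
    proof
      fix u assume "u \<in> cball w (r / 3)"
      then have "dist w u \<le> r / 3" "dist z w < r / 3" using w by simp_all
      then show "u \<in> ball z r" using dist_triangle[of z u w] \<open>0 < r\<close> by simp
    qed
    have "cmod ((deriv ^^ 1) f w) \<le> fact 1 * B / (r / 3) ^ 1"
    proof (rule Cauchy_inequality)
      show "f holomorphic_on ball w (r / 3)"
        by (rule holomorphic_on_subset[OF holo order_trans[OF ball_subset_cball sub]])
      show "continuous_on (cball w (r / 3)) f"
        by (intro holomorphic_on_imp_continuous_on holomorphic_on_subset[OF holo sub])
      show "cmod (f u) \<le> B" if "cmod (w - u) = r / 3" for u
      proof (rule bound)
        have "u \<in> cball w (r / 3)" using that by (simp add: dist_norm)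
        then show "u \<in> ball z r" using sub by blast
      qed
    qed (use \<open>0 < r\<close> in simp)
    then show ?thesis by (simp add: field_simps)
  qed
  have "cmod (f (z + h) - f z) \<le> 3 * B / r * cmod (z + h - z)"
  proof (rule field_differentiable_bound[OF convex_ball _ deriv_bound])
    show "(f has_field_derivative deriv f w) (at w within ball z (r / 3))"
      if "w \<in> ball z (r / 3)" for w
    proof (rule holomorphic_derivI[OF holo open_ball])
      show "w \<in> ball z r" using that \<open>0 < r\<close> by simp
    qed
  qed (use h \<open>0 < r\<close> in \<open>simp_all add: dist_norm\<close>)
  then show ?thesis by simp
qed

lemma tendsto_integral_difference_quotient:
  fixes F :: "complex \<Rightarrow> 'a \<Rightarrow> complex"
  assumes "0 < r"
    and meas: "\<And>w. w \<in> ball z r \<Longrightarrow> F w \<in> borel_measurable M"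
    and holo: "\<And>x. x \<in> space M \<Longrightarrow> (\<lambda>w. F w x) holomorphic_on ball z r"
    and bound: "\<And>w x. w \<in> ball z r \<Longrightarrow> x \<in> space M \<Longrightarrow> cmod (F w x) \<le> D x"
    and D: "integrable M D"
    and X: "\<And>n. cmod (X n) < r / 3" "\<And>n. X n \<noteq> 0" "X \<longlonglongrightarrow> 0"
  shows "(\<lambda>n. \<integral>x. (F (z + X n) x - F z x) / X n \<partial>M) \<longlonglongrightarrow> (\<integral>x. deriv (\<lambda>w. F w x) z \<partial>M)"
proof -
  define Q where "Q n x = (F (z + X n) x - F z x) / X n" for n x
  have z_ball: "z \<in> ball z r" using \<open>0 < r\<close> by simp
  have X_ball: "z + X n \<in> ball z r" for n
    using X(1)[of n] \<open>0 < r\<close> by (simp add: dist_norm)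
  have Q_meas: "Q n \<in> borel_measurable M" for n
    unfolding Q_def using meas[OF X_ball] meas[OF z_ball] by measurable
  have Q_lim: "(\<lambda>n. Q n x) \<longlonglongrightarrow> deriv (\<lambda>w. F w x) z" if x: "x \<in> space M" for x
  proof -
    have "((\<lambda>h. (F (z + h) x - F z x) / h) \<longlongrightarrow> deriv (\<lambda>w. F w x) z) (at 0)"
      using holomorphic_derivI[OF holo[OF x] open_ball z_ball, of UNIV] by (simp add: DERIV_def)
    moreover have "filterlim X (at 0) sequentially"
      using X(2,3) by (simp add: filterlim_at)
    ultimately show ?thesis unfolding Q_def by (rule filterlim_compose)
  qed
  have Q_bound: "cmod (Q n x) \<le> 3 * D x / r" if x: "x \<in> space M" for n x
    using norm_difference_le_Cauchy[OF holo[OF x] \<open>0 < r\<close> bound[OF _ x] X(1)[of n]] X(2)[of n]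
    by (simp add: Q_def norm_divide divide_le_eq)
  have "(\<lambda>n. integral\<^sup>L M (Q n)) \<longlonglongrightarrow> (\<integral>x. deriv (\<lambda>w. F w x) z \<partial>M)"
  proof (rule integral_dominated_convergence[where w = "\<lambda>x. 3 * D x / r"])
    show "(\<lambda>x. deriv (\<lambda>w. F w x) z) \<in> borel_measurable M"
      by (rule borel_measurable_LIMSEQ_metric[OF Q_meas Q_lim])
    show "integrable M (\<lambda>x. 3 * D x / r)" using D by simp
  qed (use Q_meas Q_lim Q_bound in \<open>auto intro!: AE_I2\<close>)
  then show ?thesis unfolding Q_def .
qed

lemma field_differentiable_integral_dominated:
  fixes F :: "complex \<Rightarrow> 'a \<Rightarrow> complex"
  assumes "0 < r"
    and meas: "\<And>w. w \<in> ball z r \<Longrightarrow> F w \<in> borel_measurable M"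
    and holo: "\<And>x. x \<in> space M \<Longrightarrow> (\<lambda>w. F w x) holomorphic_on ball z r"
    and bound: "\<And>w x. w \<in> ball z r \<Longrightarrow> x \<in> space M \<Longrightarrow> cmod (F w x) \<le> D x"
    and D: "integrable M D"
  shows "(\<lambda>w. integral\<^sup>L M (F w)) field_differentiable at z"
proof -
  have integrable: "integrable M (F w)" if "w \<in> ball z r" for w
    using meas[OF that] bound[OF that]
    by (intro Bochner_Integration.integrable_bound[OF D] AE_I2)
       (auto intro: order_trans[OF _ abs_ge_self])
  have "((\<lambda>h. (integral\<^sup>L M (F (z + h)) - integral\<^sup>L M (F z)) / h) \<longlongrightarrow>
      (\<integral>x. deriv (\<lambda>w. F w x) z \<partial>M)) (at 0 within ball 0 (r / 3))"
    unfolding tendsto_at_iff_sequentially o_def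
  proof (intro allI impI)
    fix X :: "nat \<Rightarrow> complex"
    assume "\<forall>n. X n \<in> ball 0 (r / 3) - {0}" and lim: "X \<longlonglongrightarrow> 0"
    then have X: "cmod (X n) < r / 3" "X n \<noteq> 0" for n by auto
    have "z + X n \<in> ball z r" for n
      using X(1)[of n] \<open>0 < r\<close> by (simp add: dist_norm)
    then have "(\<integral>x. (F (z + X n) x - F z x) / X n \<partial>M) =
        (integral\<^sup>L M (F (z + X n)) - integral\<^sup>L M (F z)) / X n" for n
      using integrable \<open>0 < r\<close> by simp
    with tendsto_integral_difference_quotient[OF assms X lim]
    show "(\<lambda>n. (integral\<^sup>L M (F (z + X n)) - integral\<^sup>L M (F z)) / X n) \<longlonglongrightarrow>
        (\<integral>x. deriv (\<lambda>w. F w x) z \<partial>M)"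
      by (simp only:)
  qed
  moreover have "at (0 :: complex) within ball 0 (r / 3) = at 0"
    using \<open>0 < r\<close> by (intro at_within_open) auto
  ultimately show ?thesis
    unfolding field_differentiable_def DERIV_def by auto
qed

abbreviation diagonals :: "complex set" where
  "diagonals \<equiv> {Complex 1 1, Complex 1 (-1), Complex (-1) 1, Complex (-1) (-1)}"

lemma add_diagonal_in_ball:
  assumes "d \<in> diagonals" "0 < e"
  shows "z + of_real (e / 2) * d \<in> ball z e"
proof -
  have "cmod d = sqrt 2" using assms(1) by (auto simp: complex_norm)
  moreover have "sqrt 2 < 2" by (simp add: real_less_lsqrt)
  ultimately show ?thesis using \<open>0 < e\<close> by (simp add: dist_norm norm_mult)
qed

lemma norm_mult_exp_le_sum_diagonals:
  fixes c w z z' :: complex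
  assumes "0 \<le> r" and "cmod (z' - z) \<le> r"
  shows "cmod (c * exp (z' * w)) \<le> (\<Sum>d\<in>diagonals. cmod (c * exp ((z + of_real r * d) * w)))"
proof -
  have "Re ((z' - z) * w) \<le> r * cmod w"
    using complex_Re_le_cmod[of "(z' - z) * w"] mult_right_mono[OF assms(2) norm_ge_zero[of w]]
    unfolding norm_mult by linarith
  also have "\<dots> \<le> r * \<bar>Re w\<bar> + r * \<bar>Im w\<bar>"
    using mult_left_mono[OF cmod_le[of w] assms(1)] by (simp add: distrib_left)
  finally have "cmod (exp (z' * w)) \<le> exp (Re (z * w)) * exp (r * \<bar>Re w\<bar> + r * \<bar>Im w\<bar>)"
    by (simp flip: exp_add add: algebra_simps)
  also have "\<dots> \<le> exp (Re (z * w)) * (exp (r * Re w - r * Im w) + exp (r * Re w + r * Im w)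
      + exp (- (r * Re w) - r * Im w) + exp (- (r * Re w) + r * Im w))"
    by (intro mult_left_mono)
       (auto simp: abs_if intro: order_trans[OF _ add_increasing] add_increasing add_increasing2)
  also have "\<dots> = (\<Sum>d\<in>diagonals. cmod (exp ((z + of_real r * d) * w)))"
    by (simp add: distrib_left distrib_right exp_add[symmetric])
  finally show ?thesis
    unfolding norm_mult sum_distrib_left[symmetric] by (rule mult_left_mono) simp
qed

text \<open>No dominating function is needed: the integrand at \<open>z\<close> is bounded by its values at the four
  corners of a square around \<open>z\<close>.\<close>

lemma holomorphic_on_integral_exp:
  fixes f g :: "'a \<Rightarrow> complex"
  assumes "open S"
    and integrable: "\<And>z. z \<in> S \<Longrightarrow> integrable M (K z)"
    and K: "\<And>z x. z \<in> S \<Longrightarrow> x \<in> space M \<Longrightarrow> K z x = f x * exp (z * g x)"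
  shows "(\<lambda>z. integral\<^sup>L M (K z)) holomorphic_on S"
  unfolding holomorphic_on_def
proof
  fix z assume "z \<in> S"
  then obtain e where e: "0 < e" "ball z e \<subseteq> S"
    using openE[OF \<open>open S\<close>] by metis
  define r where "r = e / 2"
  have r: "0 < r" and ball_r: "ball z r \<subseteq> S" using e by (auto simp: r_def)
  have diagonal: "z + of_real r * d \<in> S" if "d \<in> diagonals" for d
    using add_diagonal_in_ball[OF that e(1)] e(2) by (auto simp: r_def)
  define D where "D x = (\<Sum>d\<in>diagonals. cmod (K (z + of_real r * d) x))" for x
  have "(\<lambda>w. integral\<^sup>L M (K w)) field_differentiable at z"
  proof (rule field_differentiable_integral_dominated[OF r])
    show "K w \<in> borel_measurable M" if "w \<in> ball z r" for w
      using integrable[of w] ball_r that by auto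
    show "(\<lambda>w. K w x) holomorphic_on ball z r" if x: "x \<in> space M" for x
    proof (rule holomorphic_transform)
      show "(\<lambda>w. f x * exp (w * g x)) holomorphic_on ball z r" by (intro holomorphic_intros)
      show "f x * exp (w * g x) = K w x" if "w \<in> ball z r" for w
        using K[OF _ x] ball_r that by auto
    qed
    show "integrable M D"
      unfolding D_def
      by (intro Bochner_Integration.integrable_sum integrable_norm integrable diagonal)
    show "cmod (K w x) \<le> D x" if w: "w \<in> ball z r" and x: "x \<in> space M" for w x
    proof -
      have "cmod (f x * exp (w * g x)) \<le>
          (\<Sum>d\<in>diagonals. cmod (f x * exp ((z + of_real r * d) * g x)))"
        using w r by (intro norm_mult_exp_le_sum_diagonals)
          (auto simp: dist_norm norm_minus_commute)
      also have "\<dots> = D x"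
        unfolding D_def by (intro sum.cong refl) (simp only: K[OF diagonal x])
      finally show ?thesis using K[OF _ x] ball_r w by auto
    qed
  qed
  then show "(\<lambda>z. integral\<^sup>L M (K z)) field_differentiable at z within S"
    by (rule field_differentiable_at_within)
qed

abbreviation vertical_strip :: "real \<Rightarrow> real \<Rightarrow> complex set" where
  "vertical_strip a b \<equiv> {z. a < Re z \<and> Re z < b}"

lemma open_vertical_strip: "open (vertical_strip a b)"
  by (intro open_Collect_conj open_halfspace_Re_gt open_halfspace_Re_lt)

lemma analytic_continuation_vertical_strip:
  assumes holo: "f holomorphic_on vertical_strip a b" "g holomorphic_on vertical_strip a b"
    and "a \<le> c" "c < d" "d \<le> b"
    and eq: "\<And>x. c < x \<Longrightarrow> x < d \<Longrightarrow> f (of_real x) = g (of_real x)"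
    and w: "a < Re w" "Re w < b"
  shows "f w = g w"
proof -
  define m where "m = (c + d) / 2"
  have m: "m \<in> {c<..<d}" using \<open>c < d\<close> by (simp add: m_def)
  have "of_real m islimpt (of_real ` {c<..<d} :: complex set)"
  proof (rule islimpt_isCont_image)
    show "m islimpt {c<..<d}" using m by (simp add: interior_limit_point)
    show "\<forall>\<^sub>F y in at m. complex_of_real y \<noteq> of_real m" by (simp add: eventually_at_filter)
  qed (intro continuous_intros)
  then have "f w - g w = 0"
  proof (rule analytic_continuation[of "\<lambda>z. f z - g z" "vertical_strip a b", rotated 5])
    have "vertical_strip a b = {z. a < Re z} \<inter> {z. Re z < b}" by auto
    then show "connected (vertical_strip a b)"
      by (simp add: convex_connected convex_Int convex_halfspace_Re_gt convex_halfspace_Re_lt)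
  qed (use assms m in \<open>auto intro!: holomorphic_intros open_vertical_strip\<close>)
  then show ?thesis by simp
qed

section \<open>Gamma and Beta integrals on the half-line\<close>

abbreviation lborel_pos :: "real measure" where
  "lborel_pos \<equiv> restrict_space lborel {0<..}"

lemma space_lborel_pos: "space lborel_pos = {0<..}"
  by (simp add: space_restrict_space)

lemma borel_measurable_lborel_pos: "f \<in> borel_measurable borel \<Longrightarrow> f \<in> borel_measurable lborel_pos"
  by (simp add: measurable_restrict_space1)

lemma integrable_lborel_pos_iff:
  fixes f :: "real \<Rightarrow> 'a::euclidean_space"
  assumes [measurable]: "f \<in> borel_measurable borel"
  shows "integrable lborel_pos f \<longleftrightarrow> f absolutely_integrable_on {0<..}"
  by (simp add: integrable_restrict_space set_integrable_def integrable_completion)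

lemma integral_lborel_pos:
  fixes f :: "real \<Rightarrow> 'a::euclidean_space"
  assumes [measurable]: "f \<in> borel_measurable borel" and "f absolutely_integrable_on {0<..}"
  shows "integral\<^sup>L lborel_pos f = integral {0<..} f"
proof -
  have "integral\<^sup>L lborel_pos f = set_lebesgue_integral lebesgue {0<..} f"
    by (simp add: integral_restrict_space set_lebesgue_integral_def integral_completion)
  then show ?thesis using assms(2) by (simp add: set_lebesgue_integral_eq_integral(2))
qed

lemma integral_lborel_pos_scale:
  fixes f :: "real \<Rightarrow> 'a::{banach, second_countable_topology}"
  assumes "0 < r"
  shows "(\<integral>x. f (r * x) \<partial>lborel_pos) = integral\<^sup>L lborel_pos f /\<^sub>R r"
proof -
  have "integral\<^sup>L lborel_pos f = r *\<^sub>R (\<integral>x. indicator {0<..} (r * x) *\<^sub>R f (r * x) \<partial>lborel)"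
    using assms lborel_integral_real_affine[of r "\<lambda>x. indicator {0<..} x *\<^sub>R f x" 0]
    by (simp add: integral_restrict_space)
  also have "(\<lambda>x. indicator {0<..} (r * x) *\<^sub>R f (r * x)) = (\<lambda>x. indicator {0<..} x *\<^sub>R f (r * x))"
    using assms by (auto simp: indicator_def zero_less_mult_iff)
  finally show ?thesis using assms by (simp add: integral_restrict_space)
qed

lemma powr_complex_of_real_eq_exp:
  "0 < x \<Longrightarrow> complex_of_real x powr a = exp (a * of_real (ln x))"
  by (simp add: powr_def Ln_of_real)

lemma norm_complex_of_real_powr:
  assumes "0 < x"
  shows "of_real (cmod (of_real x powr a)) = complex_of_real x powr of_real (Re a)"
  using assms powr_of_real[of x "Re a"] by (simp add: norm_powr_real_powr)

lemma Re_pos_imp_notin_nonpos_Ints: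
  fixes z :: complex
  shows "0 < Re z \<Longrightarrow> z \<notin> \<int>\<^sub>\<le>\<^sub>0"
  using nonpos_Ints_subset_nonpos_Reals by (auto simp: complex_nonpos_Reals_iff)

lemma Gamma_mult_rGamma_Re_pos:
  fixes z :: complex
  shows "0 < Re z \<Longrightarrow> Gamma z * rGamma z = 1"
  using Re_pos_imp_notin_nonpos_Ints[of z] by (simp add: rGamma_inverse_Gamma Gamma_eq_zero_iff)

definition Gamma_kernel :: "complex \<Rightarrow> complex \<Rightarrow> real \<Rightarrow> complex" where
  "Gamma_kernel a z q = of_real q powr (a - 1) * exp (- z * of_real q)"

lemma borel_measurable_Gamma_kernel [measurable]: "Gamma_kernel a z \<in> borel_measurable borel"
  unfolding Gamma_kernel_def by measurable

lemma norm_Gamma_kernel: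
  assumes "0 < q"
  shows "of_real (cmod (Gamma_kernel a z q)) = Gamma_kernel (of_real (Re a)) (of_real (Re z)) q"
  using norm_complex_of_real_powr[OF assms, of "a - 1"]
  by (simp add: Gamma_kernel_def norm_mult exp_of_real[symmetric])

lemma Gamma_kernel_mult_power:
  assumes "0 < q"
  shows "Gamma_kernel a z q * of_real q ^ n = Gamma_kernel (a + of_nat n) z q"
  using assms by (simp add: Gamma_kernel_def powr_add powr_diff powr_nat')

lemma integrable_Gamma_kernel:
  assumes "0 < Re a" "0 < Re z"
  shows "integrable lborel_pos (Gamma_kernel a z)"
proof -
  have "integrable lborel_pos (\<lambda>q. complex_of_real q powr (a - 1) / of_real (exp (Re z * q)))"
    using absolutely_integrable_Gamma_integral[OF assms]
    by (subst integrable_lborel_pos_iff) auto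
  then show ?thesis
    by (rule Bochner_Integration.integrable_bound)
       (auto intro!: borel_measurable_lborel_pos
          simp: Gamma_kernel_def norm_mult norm_divide exp_minus field_simps)
qed

lemma integral_Gamma_kernel_1:
  assumes "0 < Re a"
  shows "integral\<^sup>L lborel_pos (Gamma_kernel a 1) = Gamma a"
proof -
  have "integral\<^sup>L lborel_pos (Gamma_kernel a 1) =
      (\<integral>q. of_real q powr (a - 1) / of_real (exp q) \<partial>lborel_pos)"
    by (intro Bochner_Integration.integral_cong refl)
       (simp add: Gamma_kernel_def exp_minus divide_inverse exp_of_real)
  also have "\<dots> = integral {0<..} (\<lambda>q. of_real q powr (a - 1) / of_real (exp q))"
    using absolutely_integrable_Gamma_integral'[OF assms] by (intro integral_lborel_pos) auto
  also have "\<dots> = Gamma a"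
    using Gamma_integral_complex'[OF assms] by (rule integral_unique)
  finally show ?thesis .
qed

lemma integral_Gamma_kernel:
  assumes a: "0 < Re a" and z: "0 < Re z"
  shows "integral\<^sup>L lborel_pos (Gamma_kernel a z) = Gamma a * z powr (- a)"
proof (rule analytic_continuation_vertical_strip[where a = 0 and b = "Re z + 1" and c = 0 and d = 1
      and f = "\<lambda>z. integral\<^sup>L lborel_pos (Gamma_kernel a z)" and g = "\<lambda>z. Gamma a * z powr (- a)"])
  show "(\<lambda>z. integral\<^sup>L lborel_pos (Gamma_kernel a z)) holomorphic_on vertical_strip 0 (Re z + 1)"
    by (rule holomorphic_on_integral_exp[OF open_vertical_strip,
          where f = "\<lambda>q. of_real q powr (a - 1)" and g = "\<lambda>q. - of_real q"])
       (simp_all add: integrable_Gamma_kernel[OF a] Gamma_kernel_def)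
  show "(\<lambda>z. Gamma a * z powr (- a)) holomorphic_on vertical_strip 0 (Re z + 1)"
    by (intro holomorphic_intros) (auto simp: complex_nonpos_Reals_iff)
  show "integral\<^sup>L lborel_pos (Gamma_kernel a (of_real r)) = Gamma a * of_real r powr (- a)"
    if r: "0 < r" for r
  proof -
    have "Gamma_kernel a 1 (r * q) = of_real r powr (a - 1) * Gamma_kernel a (of_real r) q" for q
      using r powr_times_real_left[of "of_real r" "of_real q" "a - 1"]
      by (simp add: Gamma_kernel_def)
    then have "(\<integral>q. Gamma_kernel a 1 (r * q) \<partial>lborel_pos) =
        of_real r powr (a - 1) * integral\<^sup>L lborel_pos (Gamma_kernel a (of_real r))"
      by (simp only: integral_mult_right_zero)
    then show ?thesis
      unfolding integral_lborel_pos_scale[OF r] integral_Gamma_kernel_1[OF a]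
      using r by (simp add: powr_diff powr_minus scaleR_conv_of_real field_simps)
  qed
qed (use z in auto)

lemma norm_Gamma_le_Gamma_Re:
  assumes "0 < Re z"
  shows "cmod (Gamma z) \<le> Gamma (Re z)"
proof -
  have "complex_of_real (\<integral>q. cmod (Gamma_kernel z 1 q) \<partial>lborel_pos) =
      integral\<^sup>L lborel_pos (Gamma_kernel (of_real (Re z)) 1)"
    unfolding integral_complex_of_real[symmetric]
    by (intro Bochner_Integration.integral_cong refl)
       (simp add: space_lborel_pos norm_Gamma_kernel)
  then have "(\<integral>q. cmod (Gamma_kernel z 1 q) \<partial>lborel_pos) = Gamma (Re z)"
    using assms by (simp add: integral_Gamma_kernel_1 Gamma_complex_of_real)
  moreover have "cmod (Gamma z) \<le> (\<integral>q. cmod (Gamma_kernel z 1 q) \<partial>lborel_pos)"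
    unfolding integral_Gamma_kernel_1[OF assms, symmetric] by (rule integral_norm_bound)
  ultimately show ?thesis by simp
qed

lemma
  fixes g g' :: "real \<Rightarrow> real"
  assumes "0 < a" "0 < b" and "S \<in> sets lebesgue" and "inj_on g S" and img: "g ` S = {0<..<1}"
    and "\<And>x. x \<in> S \<Longrightarrow> (g has_field_derivative g' x) (at x within S)"
  shows absolutely_integrable_Beta_substitution:
      "(\<lambda>x. \<bar>g' x\<bar> * (g x powr (a - 1) * (1 - g x) powr (b - 1))) absolutely_integrable_on S"
    and integral_Beta_substitution:
      "integral S (\<lambda>x. \<bar>g' x\<bar> * (g x powr (a - 1) * (1 - g x) powr (b - 1))) = Beta a b"
proof -
  let ?f = "\<lambda>t. t powr (a - 1) * (1 - t) powr (b - 1)"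
  have "(?f has_integral Beta a b) {0<..<1}"
    using has_integral_Beta_real[OF assms(1,2)] by (simp add: has_integral_Icc_iff_Ioo)
  then have "?f absolutely_integrable_on {0<..<1} \<and> integral {0<..<1} ?f = Beta a b"
    by (auto intro!: nonnegative_absolutely_integrable_1
      simp: integral_unique has_integral_integrable)
  then have "(\<lambda>x. \<bar>g' x\<bar> *\<^sub>R ?f (g x)) absolutely_integrable_on S \<and>
      integral S (\<lambda>x. \<bar>g' x\<bar> *\<^sub>R ?f (g x)) = Beta a b"
    unfolding img[symmetric] using assms
    by (subst has_absolute_integral_change_of_variables_real) auto
  then show "(\<lambda>x. \<bar>g' x\<bar> * ?f (g x)) absolutely_integrable_on S"
    "integral S (\<lambda>x. \<bar>g' x\<bar> * ?f (g x)) = Beta a b" by simp_all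
qed

lemma
  fixes a b :: real
  assumes "0 < a" "0 < b"
  shows integrable_Beta_exp_real:
      "integrable lborel_pos (\<lambda>y. (1 - exp (- y)) powr (a - 1) * exp (- b * y))"
    and integral_Beta_exp_real:
      "(\<integral>y. (1 - exp (- y)) powr (a - 1) * exp (- b * y) \<partial>lborel_pos) = Beta a b"
proof -
  let ?g = "\<lambda>y::real. 1 - exp (- y)"
  have img: "?g ` {0<..} = {0<..<1}"
  proof safe
    fix t :: real assume "t \<in> {0<..<1}"
    then show "t \<in> ?g ` {0<..}"
      by (intro image_eqI[of _ _ "- ln (1 - t)"]) (auto simp: ln_less_zero_iff)
  qed auto
  have inj: "inj_on ?g {0<..}" by (auto intro!: inj_onI)
  have deriv: "(?g has_field_derivative exp (- y)) (at y within {0<..})" for y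
    by (auto intro!: derivative_eq_intros)
  have sets: "{0::real<..} \<in> sets lebesgue" by simp
  have integrand: "\<bar>exp (- y)\<bar> * (?g y powr (a - 1) * (1 - ?g y) powr (b - 1)) =
      ?g y powr (a - 1) * exp (- b * y)" for y
    by (simp add: powr_def algebra_simps flip: exp_add)
  have "(\<lambda>y. ?g y powr (a - 1) * exp (- b * y)) absolutely_integrable_on {0<..}"
    and "integral {0<..} (\<lambda>y. ?g y powr (a - 1) * exp (- b * y)) = Beta a b"
    using absolutely_integrable_Beta_substitution[OF assms sets inj img deriv]
      integral_Beta_substitution[OF assms sets inj img deriv] unfolding integrand .
  then show "integrable lborel_pos (\<lambda>y. ?g y powr (a - 1) * exp (- b * y))"
    and "(\<integral>y. ?g y powr (a - 1) * exp (- b * y) \<partial>lborel_pos) = Beta a b"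
    by (simp_all add: integrable_lborel_pos_iff integral_lborel_pos)
qed

definition Beta_kernel :: "complex \<Rightarrow> complex \<Rightarrow> real \<Rightarrow> complex" where
  "Beta_kernel a b y = of_real (1 - exp (- y)) powr (a - 1) * exp (- b * of_real y)"

lemma borel_measurable_Beta_kernel [measurable]: "Beta_kernel a b \<in> borel_measurable borel"
  unfolding Beta_kernel_def by measurable

lemma Beta_kernel_of_real:
  assumes "0 < y"
  shows "Beta_kernel (of_real a) (of_real b) y =
    of_real ((1 - exp (- y)) powr (a - 1) * exp (- b * y))"
  using assms powr_of_real[of "1 - exp (- y)" "a - 1"]
  by (simp add: Beta_kernel_def exp_of_real[symmetric])

lemma norm_Beta_kernel:
  assumes "0 < y"
  shows "of_real (cmod (Beta_kernel a b y)) = Beta_kernel (of_real (Re a)) (of_real (Re b)) y"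
proof -
  have "0 < 1 - exp (- y)" using assms by simp
  from norm_complex_of_real_powr[OF this, of "a - 1"] show ?thesis
    by (simp add: Beta_kernel_def norm_mult exp_of_real[symmetric])
qed

lemma Beta_kernel_eq_exp:
  assumes "0 < y"
  shows "Beta_kernel a b y = exp (- b * of_real y) / of_real (1 - exp (- y)) *
    exp (a * of_real (ln (1 - exp (- y))))"
  using assms powr_complex_of_real_eq_exp[of "1 - exp (- y)" a]
  by (simp add: Beta_kernel_def powr_diff del: of_real_diff)

lemma Beta_kernel_mult_power:
  assumes "0 < y"
  shows "Beta_kernel a b y * of_real (exp y - 1) ^ n = Beta_kernel (a + of_nat n) (b - of_nat n) y"
proof -
  define r where "r = 1 - exp (- y)"
  have r: "0 < r" using assms by (simp add: r_def)
  have "exp y - 1 = exp y * r" by (simp add: r_def right_diff_distrib exp_minus)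
  then have "of_real (exp y - 1) ^ n = exp (of_nat n * of_real y) * complex_of_real r ^ n"
    by (simp add: power_mult_distrib exp_of_nat_mult exp_of_real)
  moreover have "of_real r powr (a + of_nat n - 1) = of_real r powr (a - 1) * complex_of_real r ^ n"
    using r by (simp add: powr_add powr_diff powr_nat')
  moreover have "exp (- (b - of_nat n) * of_real y) =
      exp (- b * of_real y) * exp (of_nat n * of_real y)"
    unfolding exp_add[symmetric] by (simp add: algebra_simps)
  ultimately show ?thesis
    unfolding Beta_kernel_def r_def[symmetric] by (simp only: mult_ac)
qed

lemma integrable_Beta_kernel:
  assumes "0 < Re a" "0 < Re b"
  shows "integrable lborel_pos (Beta_kernel a b)"
  using integrable_Beta_exp_real[OF assms]
proof (rule Bochner_Integration.integrable_bound)
  have "cmod (Beta_kernel a b y) = (1 - exp (- y)) powr (Re a - 1) * exp (- Re b * y)"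
    if "0 < y" for y
    using norm_Beta_kernel[OF that, of a b] Beta_kernel_of_real[OF that]
    by (simp only: of_real_eq_iff)
  then show "AE y in lborel_pos. cmod (Beta_kernel a b y) \<le>
      norm ((1 - exp (- y)) powr (Re a - 1) * exp (- Re b * y))"
    by (intro AE_I2) (simp add: space_lborel_pos)
qed (intro borel_measurable_lborel_pos borel_measurable_Beta_kernel)

lemma holomorphic_on_Beta:
  assumes "f holomorphic_on A" "g holomorphic_on A"
    and "\<And>z. z \<in> A \<Longrightarrow> 0 < Re (f z)" "\<And>z. z \<in> A \<Longrightarrow> 0 < Re (g z)"
  shows "(\<lambda>z. Beta (f z) (g z)) holomorphic_on A"
  unfolding Beta_altdef
  by (intro holomorphic_on_mult holomorphic_Gamma' holomorphic_rGamma' holomorphic_on_add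
      Re_pos_imp_notin_nonpos_Ints assms)

lemma integral_Beta_kernel_of_real:
  assumes a: "0 < a" and b: "0 < Re b"
  shows "integral\<^sup>L lborel_pos (Beta_kernel (of_real a) b) = Beta (of_real a) b"
proof (rule analytic_continuation_vertical_strip[where a = 0 and b = "Re b + 1" and c = 0 and d = 1
      and f = "\<lambda>b. integral\<^sup>L lborel_pos (Beta_kernel (of_real a) b)" and g = "Beta (of_real a)"])
  show "(\<lambda>b. integral\<^sup>L lborel_pos (Beta_kernel (of_real a) b)) holomorphic_on
      vertical_strip 0 (Re b + 1)"
    by (rule holomorphic_on_integral_exp[OF open_vertical_strip,
          where f = "\<lambda>y. of_real (1 - exp (- y)) powr (of_real a - 1)" and g = "\<lambda>y. - of_real y"])
       (use a in \<open>simp_all add: integrable_Beta_kernel, simp add: Beta_kernel_def\<close>)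
  show "Beta (of_real a) holomorphic_on vertical_strip 0 (Re b + 1)"
    using a by (intro holomorphic_on_Beta holomorphic_on_const holomorphic_on_ident) auto
  show "integral\<^sup>L lborel_pos (Beta_kernel (of_real a) (of_real x)) = Beta (of_real a) (of_real x)"
    if "0 < x" for x
  proof -
    have "integral\<^sup>L lborel_pos (Beta_kernel (of_real a) (of_real x)) =
        (\<integral>y. complex_of_real ((1 - exp (- y)) powr (a - 1) * exp (- x * y)) \<partial>lborel_pos)"
      by (intro Bochner_Integration.integral_cong refl Beta_kernel_of_real)
        (simp add: space_lborel_pos)
    then show ?thesis
      unfolding integral_complex_of_real integral_Beta_exp_real[OF a that] Beta_complex_of_real .
  qed
qed (use b in auto)

lemma integral_Beta_kernel:
  assumes a: "0 < Re a" and b: "0 < Re b"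
  shows "integral\<^sup>L lborel_pos (Beta_kernel a b) = Beta a b"
proof (rule analytic_continuation_vertical_strip[where a = 0 and b = "Re a + 1" and c = 0 and d = 1
      and f = "\<lambda>a. integral\<^sup>L lborel_pos (Beta_kernel a b)" and g = "\<lambda>a. Beta a b"])
  show "(\<lambda>a. integral\<^sup>L lborel_pos (Beta_kernel a b)) holomorphic_on vertical_strip 0 (Re a + 1)"
    by (rule holomorphic_on_integral_exp[OF open_vertical_strip,
          where f = "\<lambda>y. exp (- b * of_real y) / of_real (1 - exp (- y))"
            and g = "\<lambda>y. of_real (ln (1 - exp (- y)))"])
       (use b in \<open>simp_all only: integrable_Beta_kernel Beta_kernel_eq_exp space_lborel_pos
          greaterThan_iff mem_Collect_eq\<close>)
  show "(\<lambda>a. Beta a b) holomorphic_on vertical_strip 0 (Re a + 1)"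
    using b by (intro holomorphic_on_Beta holomorphic_on_const holomorphic_on_ident) auto
qed (use a b in \<open>simp_all add: integral_Beta_kernel_of_real\<close>)

section \<open>Taylor remainders of the exponential\<close>

text \<open>The division by \<open>w ^ N\<close> makes \<open>exp_remainder (N + 1)\<close> an antiderivative of
  \<open>- exp_remainder N\<close> in \<open>r\<close>, so that both estimates below follow by integrating from \<open>0\<close>.\<close>

definition exp_remainder :: "nat \<Rightarrow> complex \<Rightarrow> real \<Rightarrow> complex" where
  "exp_remainder N w r = (exp (- w * of_real r) - (\<Sum>n<N. (- w * of_real r) ^ n / fact n)) / w ^ N"

lemma exp_remainder_0: "exp_remainder 0 w r = exp (- w * of_real r)"
  by (simp add: exp_remainder_def)

lemma exp_remainder_Suc_0_right: "exp_remainder (Suc N) w 0 = 0"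
  unfolding exp_remainder_def sum.lessThan_Suc_shift by simp

lemma exp_remainder_expansion:
  assumes "w \<noteq> 0"
  shows "exp (- w * of_real r) =
    (\<Sum>n<N. (- w) ^ n / fact n * of_real (r ^ n)) + w ^ N * exp_remainder N w r"
  using assms by (simp add: exp_remainder_def power_mult_distrib[of "- w" "of_real r", simplified])

lemma continuous_on_exp_remainder: "continuous_on A (exp_remainder N w)"
  unfolding exp_remainder_def[abs_def] divide_inverse by (intro continuous_intros)

lemma borel_measurable_exp_remainder [measurable]: "exp_remainder N w \<in> borel_measurable borel"
  by (intro borel_measurable_continuous_onI continuous_on_exp_remainder)

lemma has_field_derivative_power_divide_fact:
  fixes x :: "'a::real_normed_field"
  shows "((\<lambda>x. x ^ Suc n / fact (Suc n)) has_field_derivative x ^ n / fact n) (at x)"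
proof -
  have "((\<lambda>x. x ^ Suc n / fact (Suc n)) has_field_derivative
      of_nat (Suc n) * x ^ n / fact (Suc n)) (at x)"
    using DERIV_cdivide[OF DERIV_power[OF DERIV_ident, of "Suc n" x UNIV], of "fact (Suc n)"]
    by (simp del: power_Suc fact_Suc of_nat_Suc)
  also have "of_nat (Suc n) * x ^ n / fact (Suc n) = x ^ n / fact n"
    by (simp add: field_simps del: of_nat_Suc)
  finally show ?thesis .
qed

lemma has_field_derivative_exp_partial_sum:
  fixes x :: "'a::real_normed_field"
  shows "((\<lambda>x. \<Sum>n<Suc N. x ^ n / fact n) has_field_derivative (\<Sum>n<N. x ^ n / fact n)) (at x)"
proof -
  have "((\<lambda>x. x ^ 0 / fact 0 + (\<Sum>n<N. x ^ Suc n / fact (Suc n))) has_field_derivative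
      0 + (\<Sum>n<N. x ^ n / fact n)) (at x)"
    by (intro DERIV_add DERIV_sum has_field_derivative_power_divide_fact) simp
  then show ?thesis unfolding sum.lessThan_Suc_shift by simp
qed

lemma has_vector_derivative_exp_remainder:
  assumes "w \<noteq> 0"
  shows "(exp_remainder (Suc N) w has_vector_derivative - exp_remainder N w r) (at r)"
proof -
  have linear: "((*) (- w) has_field_derivative - w) (at (of_real r))"
    using DERIV_cmult_Id by blast
  have "((\<lambda>z. (exp (- w * z) - (\<Sum>n<Suc N. (- w * z) ^ n / fact n)) / w ^ Suc N) has_field_derivative
      (exp (- w * of_real r) * - w - (\<Sum>n<N. (- w * of_real r) ^ n / fact n) * - w) /
        w ^ Suc N) (at (of_real r))"
    by (intro DERIV_cdivide DERIV_diff DERIV_chain2[OF DERIV_exp linear]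
        DERIV_chain2[OF has_field_derivative_exp_partial_sum linear])
  moreover have "(exp (- w * of_real r) * - w - (\<Sum>n<N. (- w * of_real r) ^ n / fact n) * - w) /
      w ^ Suc N =
      - exp_remainder N w r"
    using assms by (simp add: exp_remainder_def field_simps)
  ultimately show ?thesis
    using has_vector_derivative_real_field unfolding exp_remainder_def[of "Suc N", abs_def]
    by fastforce
qed

lemma norm_le_power_Suc_divide_fact:
  fixes F :: "real \<Rightarrow> 'a::real_normed_vector"
  assumes "F 0 = 0"
    and deriv: "\<And>x. (F has_vector_derivative F' x) (at x)"
    and bound: "\<And>x. 0 \<le> x \<Longrightarrow> norm (F' x) \<le> c * (x ^ n / fact n)"
    and "0 \<le> r"
  shows "norm (F r) \<le> c * (r ^ Suc n / fact (Suc n))"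
proof (cases "r = 0")
  case False
  have "norm (F r - F 0) \<le> c * (r ^ Suc n / fact (Suc n)) - c * (0 ^ Suc n / fact (Suc n))"
  proof (rule differentiable_bound_general)
    show "((\<lambda>x. c * (x ^ Suc n / fact (Suc n))) has_vector_derivative
        c * (x ^ n / fact n)) (at x)" for x
      unfolding has_real_derivative_iff_has_vector_derivative[symmetric]
      by (intro DERIV_cmult has_field_derivative_power_divide_fact)
    show "continuous_on {0..r} F"
      using deriv by (meson continuous_at_imp_continuous_on has_vector_derivative_continuous)
  qed (use assms False in \<open>auto intro!: continuous_intros\<close>)
  then show ?thesis using \<open>F 0 = 0\<close> by simp
qed (use \<open>F 0 = 0\<close> in simp)

lemma norm_exp_remainder_le:
  assumes "0 < Re w" "0 \<le> r"
  shows "cmod (exp_remainder N w r) \<le> r ^ N / fact N"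
  using assms(2)
proof (induction N arbitrary: r)
  case 0
  then show ?case using assms(1) by (simp add: exp_remainder_0)
next
  case (Suc N)
  have "w \<noteq> 0" using assms(1) by auto
  then have "cmod (exp_remainder (Suc N) w r) \<le> 1 * (r ^ Suc N / fact (Suc N))"
    using Suc by (intro norm_le_power_Suc_divide_fact[where F' = "\<lambda>r. - exp_remainder N w r"]
        exp_remainder_Suc_0_right has_vector_derivative_exp_remainder) auto
  then show ?case by simp
qed

lemma norm_exp_remainder_diff_le:
  assumes "0 < Re w" "0 < Re w'" "0 \<le> r"
  shows "cmod (exp_remainder N w r - exp_remainder N w' r) \<le>
    cmod (w - w') * (r ^ Suc N / fact (Suc N))"
  using assms(3)
proof (induction N arbitrary: r)
  case 0
  have "cmod (exp (- w * of_real r) - exp (- w' * of_real r)) \<le>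
      1 * cmod (- w * of_real r - - w' * of_real r)"
  proof (rule field_differentiable_bound[of "{z. Re z \<le> 0}"])
    show "(exp has_field_derivative exp z) (at z within {z. Re z \<le> 0})" for z :: complex
      by (rule has_field_derivative_at_within[OF DERIV_exp])
  qed (use assms 0 in \<open>auto simp: convex_halfspace_Re_le mult_nonneg_nonneg\<close>)
  also have "\<dots> = cmod ((w' - w) * of_real r)" by (simp add: algebra_simps)
  finally show ?case using 0 by (simp add: exp_remainder_0 norm_mult norm_minus_commute)
next
  case (Suc N)
  have "w \<noteq> 0" "w' \<noteq> 0" using assms by auto
  then show ?case
  proof (intro norm_le_power_Suc_divide_fact[
        where F = "\<lambda>r. exp_remainder (Suc N) w r - exp_remainder (Suc N) w' r"
          and F' = "\<lambda>r. - exp_remainder N w r - - exp_remainder N w' r"]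
        has_vector_derivative_diff has_vector_derivative_exp_remainder)
    show "cmod (- exp_remainder N w x - - exp_remainder N w' x) \<le>
        cmod (w - w') * (x ^ Suc N / fact (Suc N))"
      if "0 \<le> x" for x
      using Suc.IH[OF that] by (simp add: norm_minus_commute)
  qed (use Suc.prems in \<open>simp_all add: exp_remainder_Suc_0_right\<close>)
qed

section \<open>The regularised hypergeometric function\<close>

definition hyp2f1_coeff :: "complex \<Rightarrow> complex \<Rightarrow> complex \<Rightarrow> nat \<Rightarrow> complex" where
  "hyp2f1_coeff a b c n = pochhammer a n * pochhammer b n * rGamma (c + of_nat n) / fact n"

lemma hyp2f1_reg_eq_suminf: "hyp2f1_reg a b c w = (\<Sum>n. hyp2f1_coeff a b c n * w ^ n)"
  by (simp add: hyp2f1_reg_def hyp2f1_coeff_def)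

lemma hyp2f1_coeff_0: "hyp2f1_coeff a b c 0 = rGamma c"
  by (simp add: hyp2f1_coeff_def)

lemma tendsto_add_nat_div_Suc: "(\<lambda>k. (A + real k) / (real k + 1)) \<longlonglongrightarrow> 1"
proof -
  have "(\<lambda>k. 1 + (A - 1) * inverse (real (Suc k))) \<longlonglongrightarrow> 1 + (A - 1) * 0"
    by (intro tendsto_intros LIMSEQ_inverse_real_of_nat)
  moreover have "1 + (A - 1) * inverse (real (Suc k)) = (A + real k) / (real k + 1)" for k
    by (simp add: field_simps)
  ultimately show ?thesis by simp
qed

lemma eventually_ratio_product_less:
  fixes x :: real
  assumes "x < 1"
  shows "\<forall>\<^sub>F k in sequentially.
    (A + real k) / (real k + 1) * ((B + real k) / (real k + 1)) * x < (1 + x) / 2"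
proof -
  have "(\<lambda>k. (A + real k) / (real k + 1) * ((B + real k) / (real k + 1)) * x) \<longlonglongrightarrow> 1 * 1 * x"
    by (intro tendsto_intros tendsto_add_nat_div_Suc)
  then show ?thesis using assms by (intro order_tendstoD(2)) auto
qed

lemma summable_pochhammer_mult_pochhammer:
  fixes a b :: complex and x :: real
  assumes x: "0 \<le> x" "x < 1"
  shows "summable (\<lambda>k. cmod (pochhammer a (k + m)) * cmod (pochhammer b (k + m)) /
      (fact k * fact (k + m)) * x ^ k)" (is "summable ?t")
proof -
  define q where "q k = (cmod (a + of_nat m) + real k) / (real k + 1) *
      ((cmod (b + of_nat m) + real k) / (real k + 1)) * x" for k
  obtain K where K: "\<And>k. k \<ge> K \<Longrightarrow> q k < (1 + x) / 2"
    using eventually_ratio_product_less[OF x(2)] unfolding q_def eventually_sequentially by blast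
  show ?thesis
  proof (rule summable_ratio_test[of "(1 + x) / 2" K])
    fix k assume k: "k \<ge> K"
    have norm_add: "cmod (c + of_nat (k + m)) \<le> cmod (c + of_nat m) + real k" for c
      using norm_triangle_ineq[of "c + of_nat m" "of_nat k"] by (simp add: algebra_simps)
    have pochhammer: "cmod (pochhammer c (Suc k + m)) =
        cmod (pochhammer c (k + m)) * cmod (c + of_nat (k + m))" for c
      by (simp add: pochhammer_Suc norm_mult)
    have facts: "fact (Suc k) = (real k + 1) * fact k"
      "fact (Suc k + m) = (real (k + m) + 1) * fact (k + m)"
      by (simp_all add: algebra_simps)
    have "?t (Suc k) = cmod (a + of_nat (k + m)) / (real k + 1) *
        (cmod (b + of_nat (k + m)) / (real (k + m) + 1)) * x * ?t k"
      unfolding pochhammer facts power_Suc times_divide_times_eq times_divide_eq_left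
        times_divide_eq_right
      by (simp only: mult_ac divide_divide_eq_left)
    also have "\<dots> \<le> q k * ?t k"
      unfolding q_def using x
      by (intro mult_right_mono mult_mono frac_le norm_add)
         (auto intro!: mult_nonneg_nonneg divide_nonneg_nonneg)
    also have "\<dots> \<le> (1 + x) / 2 * ?t k"
      using K[OF k] x by (intro mult_right_mono) auto
    finally have "?t (Suc k) \<le> (1 + x) / 2 * ?t k" .
    moreover have "0 \<le> ?t j" for j using x by simp
    ultimately show "norm (?t (Suc k)) \<le> (1 + x) / 2 * norm (?t k)"
      unfolding real_norm_def by (simp only: abs_of_nonneg)
  qed (use x in auto)
qed

lemma fact_le_norm_pochhammer:
  assumes "1 \<le> Re c"
  shows "fact k \<le> cmod (pochhammer c k)"
proof (induction k)
  case (Suc k)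
  have "real (Suc k) \<le> cmod (c + of_nat k)"
    using complex_Re_le_cmod[of "c + of_nat k"] assms by simp
  from mult_mono[OF Suc.IH this] show ?case
    by (simp add: pochhammer_Suc norm_mult mult.commute)
qed simp

lemma norm_rGamma_add_of_nat_le:
  assumes "1 \<le> Re c"
  shows "cmod (rGamma (c + of_nat k)) \<le> cmod (rGamma c) / fact k"
proof -
  have "fact k * cmod (rGamma (c + of_nat k)) \<le>
      cmod (pochhammer c k) * cmod (rGamma (c + of_nat k))"
    by (intro mult_right_mono fact_le_norm_pochhammer assms) simp
  also have "\<dots> = cmod (rGamma c)"
    by (simp add: pochhammer_rGamma[of c k] norm_mult)
  finally show ?thesis by (simp add: field_simps)
qed

lemma hyp2f1_reg_locally_dominated:
  assumes "cmod w < 1"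
  obtains M where "summable M"
    "\<forall>\<^sub>F n in sequentially. \<forall>z\<in>cball c 1. cmod (hyp2f1_coeff a b z n * w ^ n) \<le> M n"
proof -
  obtain m :: nat where m: "2 - Re c \<le> real m" using real_arch_simple by blast
  have "compact ((\<lambda>z. rGamma (z + of_nat m)) ` cball c 1)"
    by (intro compact_continuous_image holomorphic_on_imp_continuous_on holomorphic_intros
      compact_cball)
  then obtain B where B: "\<And>z. z \<in> cball c 1 \<Longrightarrow> cmod (rGamma (z + of_nat m)) \<le> B"
    using compact_imp_bounded bounded_iff by (metis imageI)
  define t where "t k = cmod (pochhammer a (k + m)) * cmod (pochhammer b (k + m)) /
      (fact k * fact (k + m)) * cmod w ^ k" for k
  define M where "M n = B * cmod w ^ m * t (n - m)" for n
  have "summable t"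
    unfolding t_def using assms by (intro summable_pochhammer_mult_pochhammer) auto
  then have "summable (\<lambda>k. M (k + m))" unfolding M_def by (simp add: summable_mult)
  then have "summable M" by (rule summable_iff_shift[THEN iffD1])
  moreover have "cmod (hyp2f1_coeff a b z n * w ^ n) \<le> M n"
    if "n \<ge> m" and z: "z \<in> cball c 1" for n z
  proof -
    obtain k where n: "n = k + m" using \<open>n \<ge> m\<close> by (metis le_Suc_ex add.commute)
    have "Re c - 1 \<le> Re z" using z abs_Re_le_cmod[of "c - z"] by (auto simp: dist_norm)
    then have "cmod (rGamma (z + of_nat m + of_nat k)) \<le> cmod (rGamma (z + of_nat m)) / fact k"
      using m by (intro norm_rGamma_add_of_nat_le) simp
    also have "\<dots> \<le> B / fact k" by (intro divide_right_mono B z) simp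
    finally have rGamma_le: "cmod (rGamma (z + of_nat n)) \<le> B / fact k"
      by (simp add: n algebra_simps)
    have "cmod (hyp2f1_coeff a b z n * w ^ n) =
        (cmod (pochhammer a n) * cmod (pochhammer b n) / fact n * cmod w ^ n) *
          cmod (rGamma (z + of_nat n))"
      by (simp add: hyp2f1_coeff_def norm_mult norm_divide norm_power)
    also have "\<dots> \<le> (cmod (pochhammer a n) * cmod (pochhammer b n) / fact n * cmod w ^ n) *
        (B / fact k)"
      by (intro mult_left_mono rGamma_le) simp
    also have "\<dots> = M n"
      unfolding M_def t_def by (simp add: n power_add field_simps)
    finally show ?thesis .
  qed
  ultimately show ?thesis
    by (intro that[of M] eventually_sequentiallyI[of m] ballI)
qed

lemma summable_norm_hyp2f1_reg:
  assumes "cmod w < 1"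
  shows "summable (\<lambda>n. cmod (hyp2f1_coeff a b c n * w ^ n))"
proof -
  obtain M where M: "summable M"
    "\<forall>\<^sub>F n in sequentially. \<forall>z\<in>cball c 1. cmod (hyp2f1_coeff a b z n * w ^ n) \<le> M n"
    by (rule hyp2f1_reg_locally_dominated[OF assms, where a = a and b = b and c = c])
  from M(2) have "\<forall>\<^sub>F n in sequentially. norm (cmod (hyp2f1_coeff a b c n * w ^ n)) \<le> M n"
    by (rule eventually_mono) simp
  then show ?thesis using M(1) by (rule summable_comparison_test_ev)
qed

lemma sums_hyp2f1_reg: "cmod w < 1 \<Longrightarrow> (\<lambda>n. hyp2f1_coeff a b c n * w ^ n) sums hyp2f1_reg a b c w"
  unfolding hyp2f1_reg_eq_suminf
  by (rule summable_sums[OF summable_norm_cancel[OF summable_norm_hyp2f1_reg]])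

lemma hyp2f1_reg_0: "hyp2f1_reg a b c 0 = rGamma c"
  by (simp add: hyp2f1_reg_eq_suminf hyp2f1_coeff_0)

lemma holomorphic_on_hyp2f1_reg [holomorphic_intros]:
  assumes "f holomorphic_on A" "cmod w < 1"
  shows "(\<lambda>z. hyp2f1_reg a b (f z) w) holomorphic_on A"
proof -
  let ?S = "\<lambda>n c. \<Sum>k<n. hyp2f1_coeff a b c k * w ^ k"
  have "(\<lambda>c. hyp2f1_reg a b c w) holomorphic_on UNIV"
  proof (rule holomorphic_uniform_sequence)
    show "?S n holomorphic_on UNIV" for n
      unfolding hyp2f1_coeff_def by (intro holomorphic_intros) auto
    fix c :: complex
    obtain M where "summable M"
      "\<forall>\<^sub>F n in sequentially. \<forall>z\<in>cball c 1. cmod (hyp2f1_coeff a b z n * w ^ n) \<le> M n"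
      by (rule hyp2f1_reg_locally_dominated[OF assms(2), where a = a and b = b and c = c])
    then have "uniform_limit (cball c 1) ?S (\<lambda>c. hyp2f1_reg a b c w) sequentially"
      unfolding hyp2f1_reg_eq_suminf by (intro Weierstrass_m_test_ev)
    then show "\<exists>d>0. cball c d \<subseteq> UNIV \<and>
        uniform_limit (cball c d) ?S (\<lambda>c. hyp2f1_reg a b c w) sequentially"
      by (intro exI[of _ 1]) simp
  qed auto
  from holomorphic_on_compose_gen[OF assms(1) this] show ?thesis by (simp add: o_def)
qed

lemma of_nat_mult_hyp2f1_coeff_Suc:
  "of_nat (Suc n) * hyp2f1_coeff a b c (Suc n) = a * b * hyp2f1_coeff (a + 1) (b + 1) (c + 1) n"
proof -
  have shift: "c + of_nat (Suc n) = c + 1 + of_nat n" by simp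
  show ?thesis
    unfolding hyp2f1_coeff_def shift by (simp add: pochhammer_rec del: of_nat_Suc)
qed

lemma has_field_derivative_hyp2f1_reg:
  assumes "cmod w < 1"
  shows "(hyp2f1_reg a b c has_field_derivative
    a * b * hyp2f1_reg (a + 1) (b + 1) (c + 1) w) (at w)"
proof -
  have "((\<lambda>w. \<Sum>n. hyp2f1_coeff a b c n * w ^ n) has_field_derivative
      (\<Sum>n. diffs (hyp2f1_coeff a b c) n * w ^ n)) (at w)"
    by (rule termdiffs_strong'[OF sums_summable[OF sums_hyp2f1_reg] assms])
  also have "(\<Sum>n. diffs (hyp2f1_coeff a b c) n * w ^ n) =
      a * b * hyp2f1_reg (a + 1) (b + 1) (c + 1) w"
    using sums_mult[OF sums_hyp2f1_reg[OF assms], of "a * b" "a + 1" "b + 1" "c + 1"]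
    by (simp add: diffs_def of_nat_mult_hyp2f1_coeff_Suc sums_iff mult.assoc del: of_nat_Suc)
  finally show ?thesis unfolding hyp2f1_reg_eq_suminf[abs_def] .
qed

lemma has_field_derivative_hyp2f1_reg_derivative:
  assumes "cmod w < 1"
  shows "((\<lambda>w. a * b * hyp2f1_reg (a + 1) (b + 1) (c + 1) w) has_field_derivative
    a * b * ((a + 1) * (b + 1) * hyp2f1_reg (a + 2) (b + 2) (c + 2) w)) (at w)"
  using DERIV_cmult[OF has_field_derivative_hyp2f1_reg[OF assms, of "a + 1" "b + 1" "c + 1"]]
  by (simp add: add.assoc)

lemma sums_of_nat_mult_hyp2f1_reg:
  assumes "cmod w < 1"
  shows "(\<lambda>n. of_nat n * hyp2f1_coeff a b c n * w ^ n) sums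
    (w * (a * b * hyp2f1_reg (a + 1) (b + 1) (c + 1) w))"
proof -
  have "of_nat (Suc n) * hyp2f1_coeff a b c (Suc n) * w ^ Suc n =
      w * (a * b * (hyp2f1_coeff (a + 1) (b + 1) (c + 1) n * w ^ n))" for n
    unfolding of_nat_mult_hyp2f1_coeff_Suc by simp
  then have "(\<lambda>n. of_nat (Suc n) * hyp2f1_coeff a b c (Suc n) * w ^ Suc n) sums
      (w * (a * b * hyp2f1_reg (a + 1) (b + 1) (c + 1) w))"
    using sums_hyp2f1_reg[OF assms] by (simp only: sums_mult)
  then show ?thesis
    using sums_Suc_iff[of "\<lambda>n. of_nat n * hyp2f1_coeff a b c n * w ^ n"] by simp
qed

lemma hyp2f1_coeff_contiguous:
  "(c + of_nat (Suc n)) * hyp2f1_coeff (a + 1) (b + 1) (c + 1) (Suc n) -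
     (of_nat n + (a + b + 1)) * hyp2f1_coeff (a + 1) (b + 1) (c + 1) n = hyp2f1_coeff a b c (Suc n)"
proof -
  define u where "u = pochhammer (a + 1) n * pochhammer (b + 1) n *
      rGamma (c + of_nat (Suc n)) / fact (Suc n)"
  have rGamma: "(c + of_nat (Suc n)) * rGamma (c + 1 + of_nat (Suc n)) =
      rGamma (c + of_nat (Suc n))"
    using rGamma_plus1[of "c + of_nat (Suc n)"] by (simp add: ac_simps)
  have "(c + of_nat (Suc n)) * hyp2f1_coeff (a + 1) (b + 1) (c + 1) (Suc n) =
      pochhammer (a + 1) (Suc n) * pochhammer (b + 1) (Suc n) *
      ((c + of_nat (Suc n)) * rGamma (c + 1 + of_nat (Suc n))) / fact (Suc n)"
    unfolding hyp2f1_coeff_def by (simp only: times_divide_eq_right mult_ac)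
  then have "(c + of_nat (Suc n)) * hyp2f1_coeff (a + 1) (b + 1) (c + 1) (Suc n) =
      (a + of_nat (Suc n)) * (b + of_nat (Suc n)) * u"
    unfolding rGamma u_def pochhammer_Suc[of _ n] by (simp add: ac_simps)
  moreover have "hyp2f1_coeff (a + 1) (b + 1) (c + 1) n = of_nat (Suc n) * u"
    by (simp add: hyp2f1_coeff_def u_def ac_simps del: of_nat_Suc) (simp add: field_simps)
  moreover have "hyp2f1_coeff a b c (Suc n) = a * b * u"
    by (simp add: hyp2f1_coeff_def u_def pochhammer_rec)
  ultimately show ?thesis by (simp add: algebra_simps)
qed

lemma hyp2f1_reg_contiguous:
  assumes "cmod w < 1"
  shows "w * (1 - w) * ((a + 1) * (b + 1) * hyp2f1_reg (a + 2) (b + 2) (c + 2) w) +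
      (c - (a + b + 1) * w) * hyp2f1_reg (a + 1) (b + 1) (c + 1) w = hyp2f1_reg a b c w"
proof -
  define h t where "h = hyp2f1_coeff a b c" and "t = hyp2f1_coeff (a + 1) (b + 1) (c + 1)"
  let ?F1 = "hyp2f1_reg (a + 1) (b + 1) (c + 1) w"
  let ?F2 = "(a + 1) * (b + 1) * hyp2f1_reg (a + 2) (b + 2) (c + 2) w"
  have t: "(\<lambda>n. t n * w ^ n) sums ?F1"
    unfolding t_def by (rule sums_hyp2f1_reg[OF assms])
  have nt: "(\<lambda>n. of_nat n * t n * w ^ n) sums (w * ?F2)"
    using sums_of_nat_mult_hyp2f1_reg[OF assms, of "a + 1" "b + 1" "c + 1"]
    by (simp add: t_def add.assoc)
  have "(\<lambda>n. (c + of_nat n) * t n * w ^ n) sums (w * ?F2 + c * ?F1)"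
    using sums_add[OF nt sums_mult[OF t, of c]] by (simp add: algebra_simps)
  then have "(\<lambda>n. (c + of_nat (Suc n)) * t (Suc n) * w ^ Suc n) sums (w * ?F2 + c * ?F1 - c * t 0)"
    using sums_Suc_iff[of "\<lambda>n. (c + of_nat n) * t n * w ^ n"] by simp
  moreover have "(\<lambda>n. (of_nat n + (a + b + 1)) * t n * w ^ Suc n) sums
      (w * (w * ?F2 + (a + b + 1) * ?F1))"
    using sums_mult[OF sums_add[OF nt sums_mult[OF t, of "a + b + 1"]], of w]
    by (simp add: algebra_simps)
  ultimately have "(\<lambda>n. (c + of_nat (Suc n)) * t (Suc n) * w ^ Suc n -
      (of_nat n + (a + b + 1)) * t n * w ^ Suc n) sums
      (w * ?F2 + c * ?F1 - c * t 0 - w * (w * ?F2 + (a + b + 1) * ?F1))"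
    by (rule sums_diff)
  then have "(\<lambda>n. h (Suc n) * w ^ Suc n) sums
      (w * ?F2 + c * ?F1 - c * t 0 - w * (w * ?F2 + (a + b + 1) * ?F1))"
    unfolding h_def t_def left_diff_distrib[symmetric] hyp2f1_coeff_contiguous .
  moreover have "(\<lambda>n. h (Suc n) * w ^ Suc n) sums (hyp2f1_reg a b c w - h 0)"
    using sums_hyp2f1_reg[OF assms, of a b c] sums_Suc_iff[of "\<lambda>n. h n * w ^ n"]
    by (simp add: h_def)
  moreover have "c * t 0 = h 0" by (simp add: t_def h_def hyp2f1_coeff_0 rGamma_plus1)
  ultimately show ?thesis
    using sums_unique2 by (fastforce simp: algebra_simps)
qed

lemma hyp2f1_reg_differential_equation:
  assumes "cmod w < 1"
  shows "w * (1 - w) * (a * b * ((a + 1) * (b + 1) * hyp2f1_reg (a + 2) (b + 2) (c + 2) w)) +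
      (c - (a + b + 1) * w) * (a * b * hyp2f1_reg (a + 1) (b + 1) (c + 1) w) =
    a * b * hyp2f1_reg a b c w"
  unfolding hyp2f1_reg_contiguous[OF assms, of a b c, symmetric] by (simp add: algebra_simps)

lemma eq_if_derivative_zero:
  fixes f :: "'a::real_normed_field \<Rightarrow> 'a"
  assumes "convex S" "\<And>z. z \<in> S \<Longrightarrow> (f has_field_derivative 0) (at z within S)" "x \<in> S" "y \<in> S"
  shows "f x = f y"
  using has_field_derivative_zero_constant[OF assms(1,2)] assms(3,4) by metis

lemma eq_cos_if_second_derivative:
  fixes H H' :: "complex \<Rightarrow> complex"
  assumes "convex S" "0 \<in> S"
    and H: "\<And>z. z \<in> S \<Longrightarrow> (H has_field_derivative H' z) (at z within S)"
    and H': "\<And>z. z \<in> S \<Longrightarrow> (H' has_field_derivative - s\<^sup>2 * H z) (at z within S)"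
    and "H' 0 = 0" and z: "z \<in> S"
  shows "H z = H 0 * cos (s * z)"
proof -
  define P where "P z = H' z * cos (s * z) + s * H z * sin (s * z)" for z
  define Q where "Q z = s * H z * cos (s * z) - H' z * sin (s * z)" for z
  have trig: "((\<lambda>z. cos (s * z)) has_field_derivative - sin (s * z) * s) (at z within S)"
    "((\<lambda>z. sin (s * z)) has_field_derivative cos (s * z) * s) (at z within S)" for z
    by (auto intro!: derivative_eq_intros)
  have "(P has_field_derivative 0) (at u within S)" if "u \<in> S" for u
    unfolding P_def by (rule derivative_eq_intros H H' trig that refl)+
      (simp add: algebra_simps power2_eq_square)
  then have "P z = P 0" by (rule eq_if_derivative_zero[OF \<open>convex S\<close> _ z \<open>0 \<in> S\<close>])
  moreover have "(Q has_field_derivative 0) (at u within S)" if "u \<in> S" for u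
    unfolding Q_def by (rule derivative_eq_intros H H' trig that refl)+
      (simp add: algebra_simps power2_eq_square)
  then have "Q z = Q 0" by (rule eq_if_derivative_zero[OF \<open>convex S\<close> _ z \<open>0 \<in> S\<close>])
  ultimately have first_integrals: "P z = 0" "Q z = s * H 0"
    using \<open>H' 0 = 0\<close> by (simp_all add: P_def Q_def)
  show ?thesis
  proof (cases "s = 0")
    case True
    have "H' u = 0" if "u \<in> S" for u
      using eq_if_derivative_zero[OF \<open>convex S\<close>, of H' u 0] H' \<open>0 \<in> S\<close> \<open>H' 0 = 0\<close> that True by simp
    then have "H z = H 0"
      using H by (intro eq_if_derivative_zero[OF \<open>convex S\<close> _ z \<open>0 \<in> S\<close>]) metis
    then show ?thesis using True by simp
  next
    case False
    have "s * H z * ((sin (s * z))\<^sup>2 + (cos (s * z))\<^sup>2) = P z * sin (s * z) + Q z * cos (s * z)"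
      unfolding P_def Q_def by algebra
    then show ?thesis using first_integrals False by simp
  qed
qed

lemma norm_sin_half_squared_lt_1:
  fixes t :: real
  assumes "\<bar>t\<bar> < pi"
  shows "cmod (of_real ((sin (t / 2))\<^sup>2)) < 1"
proof -
  have "0 < cos (t / 2)" using assms by (intro cos_gt_zero_pi) auto
  then have "(sin (t / 2))\<^sup>2 < 1" by (simp add: sin_squared_eq)
  then show ?thesis by (simp del: of_real_power)
qed

lemma norm_sin_half_squared_lt_1_segment:
  assumes "\<bar>\<phi>\<bar> < pi" "z \<in> closed_segment 0 (of_real \<phi>)"
  shows "cmod ((sin (z / 2))\<^sup>2) < 1"
proof -
  obtain t where t: "z = of_real t" "t \<in> closed_segment 0 \<phi>"
    using assms(2) closed_segment_of_real[of 0 \<phi>] by auto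
  then have "\<bar>t\<bar> < pi"
    using assms(1) by (auto simp: closed_segment_eq_real_ivl split: if_splits)
  moreover have "(sin (z / 2))\<^sup>2 = of_real ((sin (t / 2))\<^sup>2)"
    by (simp add: t(1) sin_of_real[symmetric] del: sin_of_real)
  ultimately show ?thesis using norm_sin_half_squared_lt_1 by simp
qed

lemma
  fixes T T' T'' :: "complex \<Rightarrow> complex" and z :: complex
  defines "y \<equiv> (sin (z / 2))\<^sup>2"
  assumes T: "(T has_field_derivative T' y) (at y)" and T': "(T' has_field_derivative T'' y) (at y)"
  shows has_field_derivative_half_angle:
      "((\<lambda>z. cos (z / 2) * T ((sin (z / 2))\<^sup>2)) has_field_derivative
        (cos (z / 2))\<^sup>2 * sin (z / 2) * T' y - sin (z / 2) * T y / 2) (at z within I)"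
    and has_field_derivative_half_angle_derivative:
      "((\<lambda>z. (cos (z / 2))\<^sup>2 * sin (z / 2) * T' ((sin (z / 2))\<^sup>2) -
          sin (z / 2) * T ((sin (z / 2))\<^sup>2) / 2)
        has_field_derivative
        cos (z / 2) * (y * (1 - y) * T'' y + (1 / 2 - 2 * y) * T' y - T y / 4)) (at z within I)"
proof -
  define S C where "S = sin (z / 2)" and "C = cos (z / 2)"
  have C2: "C\<^sup>2 = 1 - S\<^sup>2" and y: "y = S\<^sup>2" by (simp_all add: S_def C_def y_def cos_squared_eq)
  have dy: "((\<lambda>z. (sin (z / 2))\<^sup>2) has_field_derivative S * C) (at z within I)"
    unfolding S_def C_def by (rule derivative_eq_intros refl | simp)+
  have dT: "((\<lambda>z. T ((sin (z / 2))\<^sup>2)) has_field_derivative T' y * (S * C)) (at z within I)"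
    "((\<lambda>z. T' ((sin (z / 2))\<^sup>2)) has_field_derivative T'' y * (S * C)) (at z within I)"
    using DERIV_chain2[OF T[unfolded y_def] dy] DERIV_chain2[OF T'[unfolded y_def] dy]
    unfolding y_def by simp_all
  show "((\<lambda>z. cos (z / 2) * T ((sin (z / 2))\<^sup>2)) has_field_derivative
      (cos (z / 2))\<^sup>2 * sin (z / 2) * T' y - sin (z / 2) * T y / 2) (at z within I)"
    by (rule derivative_eq_intros dT refl | simp)+
       (simp add: S_def C_def y_def algebra_simps power2_eq_square)
  have "((\<lambda>z. (cos (z / 2))\<^sup>2 * sin (z / 2) * T' ((sin (z / 2))\<^sup>2) -
      sin (z / 2) * T ((sin (z / 2))\<^sup>2) / 2)
      has_field_derivative
        (2 * C * (- S / 2) * S + C\<^sup>2 * (C / 2)) * T' y + C\<^sup>2 * S * (T'' y * (S * C))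
        - (C / 2 * T y + S * (T' y * (S * C))) / 2) (at z within I)"
    by (rule derivative_eq_intros dT refl | simp)+ (simp add: S_def C_def y_def field_simps)
  also have "(2 * C * (- S / 2) * S + C\<^sup>2 * (C / 2)) * T' y + C\<^sup>2 * S * (T'' y * (S * C))
        - (C / 2 * T y + S * (T' y * (S * C))) / 2 =
      C * (y * (1 - y) * T'' y + (1 / 2 - 2 * y) * T' y - T y / 4)"
    unfolding C2 y by (simp add: field_simps power2_eq_square)
  finally show "((\<lambda>z. (cos (z / 2))\<^sup>2 * sin (z / 2) * T' ((sin (z / 2))\<^sup>2) -
      sin (z / 2) * T ((sin (z / 2))\<^sup>2) / 2)
      has_field_derivative
      cos (z / 2) * (y * (1 - y) * T'' y + (1 / 2 - 2 * y) * T' y - T y / 4)) (at z within I)"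
    unfolding C_def .
qed

definition hyp2f1_half_angle :: "complex \<Rightarrow> complex \<Rightarrow> complex" where
  "hyp2f1_half_angle s z =
     cos (z / 2) * hyp2f1_reg (s + 1 / 2) (1 / 2 - s) (1 / 2) ((sin (z / 2))\<^sup>2)"

definition hyp2f1_half_angle_deriv :: "complex \<Rightarrow> complex \<Rightarrow> complex" where
  "hyp2f1_half_angle_deriv s z = (cos (z / 2))\<^sup>2 * sin (z / 2) * ((s + 1 / 2) * (1 / 2 - s) *
     hyp2f1_reg (s + 1 / 2 + 1) (1 / 2 - s + 1) (1 / 2 + 1) ((sin (z / 2))\<^sup>2)) -
     sin (z / 2) * hyp2f1_reg (s + 1 / 2) (1 / 2 - s) (1 / 2) ((sin (z / 2))\<^sup>2) / 2"

lemma
  assumes y: "cmod ((sin (z / 2))\<^sup>2) < 1"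
  shows has_field_derivative_hyp2f1_half_angle:
      "(hyp2f1_half_angle s has_field_derivative hyp2f1_half_angle_deriv s z) (at z within I)"
    and has_field_derivative_hyp2f1_half_angle_deriv:
      "(hyp2f1_half_angle_deriv s has_field_derivative
          - s\<^sup>2 * hyp2f1_half_angle s z) (at z within I)"
proof -
  define a b where "a = s + 1 / 2" and "b = 1 / 2 - s"
  define y where "y = (sin (z / 2))\<^sup>2"
  define T T' T'' where "T = hyp2f1_reg a b (1 / 2)"
    and "T' = (\<lambda>y. a * b * hyp2f1_reg (a + 1) (b + 1) (1 / 2 + 1) y)"
    and "T'' = (\<lambda>y. a * b * ((a + 1) * (b + 1) * hyp2f1_reg (a + 2) (b + 2) (1 / 2 + 2) y))"
  have T: "(T has_field_derivative T' ((sin (z / 2))\<^sup>2)) (at ((sin (z / 2))\<^sup>2))"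
    unfolding T_def T'_def by (rule has_field_derivative_hyp2f1_reg[OF y])
  have T': "(T' has_field_derivative T'' ((sin (z / 2))\<^sup>2)) (at ((sin (z / 2))\<^sup>2))"
    unfolding T'_def T''_def by (rule has_field_derivative_hyp2f1_reg_derivative[OF y])
  note derivs = has_field_derivative_half_angle[where T = T and T' = T' and T'' = T'', OF T T']
    has_field_derivative_half_angle_derivative[where T = T and T' = T' and T'' = T'', OF T T']
  show "(hyp2f1_half_angle s has_field_derivative hyp2f1_half_angle_deriv s z) (at z within I)"
    using derivs(1) unfolding T_def T'_def a_def b_def hyp2f1_half_angle_def[abs_def]
      hyp2f1_half_angle_deriv_def .
  have "a + b + 1 = 2" by (simp add: a_def b_def)
  then have ode: "y * (1 - y) * T'' y + (1 / 2 - 2 * y) * T' y = a * b * T y"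
    using hyp2f1_reg_differential_equation[of y a b "1 / 2"] y
    by (simp add: T_def T'_def T''_def y_def)
  have "a * b = 1 / 4 - s\<^sup>2" by (simp add: a_def b_def power2_eq_square field_simps)
  then have "cos (z / 2) * (y * (1 - y) * T'' y + (1 / 2 - 2 * y) * T' y - T y / 4) =
      - s\<^sup>2 * hyp2f1_half_angle s z"
    unfolding ode by (simp add: hyp2f1_half_angle_def T_def a_def b_def y_def left_diff_distrib)
  with derivs(2)
  show "(hyp2f1_half_angle_deriv s has_field_derivative
      - s\<^sup>2 * hyp2f1_half_angle s z) (at z within I)"
    unfolding y_def by (simp only: T_def T'_def a_def b_def hyp2f1_half_angle_deriv_def[abs_def])
qed

lemma cos_eq_hyp2f1_reg:
  fixes s :: complex and \<phi> :: real
  assumes "\<bar>\<phi>\<bar> < pi"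
  shows "cos (s * of_real \<phi>) = of_real (sqrt pi) * of_real (cos (\<phi> / 2)) *
    hyp2f1_reg (s + 1 / 2) (1 / 2 - s) (1 / 2) (of_real ((sin (\<phi> / 2))\<^sup>2))"
proof -
  have "hyp2f1_half_angle s (of_real \<phi>) = hyp2f1_half_angle s 0 * cos (s * of_real \<phi>)"
  proof (rule eq_cos_if_second_derivative[of "closed_segment 0 (of_real \<phi>)"])
    fix z assume "z \<in> closed_segment 0 (complex_of_real \<phi>)"
    then have y: "cmod ((sin (z / 2))\<^sup>2) < 1"
      by (rule norm_sin_half_squared_lt_1_segment[OF assms])
    show "(hyp2f1_half_angle s has_field_derivative hyp2f1_half_angle_deriv s z)
        (at z within closed_segment 0 (of_real \<phi>))"
      using y by (rule has_field_derivative_hyp2f1_half_angle)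
    show "(hyp2f1_half_angle_deriv s has_field_derivative - s\<^sup>2 * hyp2f1_half_angle s z)
        (at z within closed_segment 0 (of_real \<phi>))"
      using y by (rule has_field_derivative_hyp2f1_half_angle_deriv)
  qed (auto simp: hyp2f1_half_angle_deriv_def)
  moreover have "of_real (sqrt pi) * hyp2f1_half_angle s 0 = 1"
    by (simp add: hyp2f1_half_angle_def hyp2f1_reg_0 rGamma_inverse_Gamma Gamma_one_half_complex)
  ultimately have "cos (s * of_real \<phi>) = of_real (sqrt pi) * hyp2f1_half_angle s (of_real \<phi>)"
    by (metis mult.assoc mult.left_neutral)
  also have "hyp2f1_half_angle s (of_real \<phi>) = of_real (cos (\<phi> / 2)) *
      hyp2f1_reg (s + 1 / 2) (1 / 2 - s) (1 / 2) (of_real ((sin (\<phi> / 2))\<^sup>2))"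
    by (simp add: hyp2f1_half_angle_def cos_of_real[symmetric] sin_of_real[symmetric]
      del: sin_of_real cos_of_real)
  finally show ?thesis by (simp only: mult.assoc)
qed

lemma holomorphic_on_ferrers_P:
  assumes "f holomorphic_on A" "- 1 < x" "x < 1"
  shows "(\<lambda>z. ferrers_P \<nu> (f z) x) holomorphic_on A"
proof -
  have "cmod (of_real ((1 - x) / 2)) < 1"
    using assms unfolding norm_of_real by (simp add: abs_less_iff)
  then show ?thesis
    unfolding ferrers_P_def by (intro holomorphic_intros assms) auto
qed

lemma holomorphic_on_ferrers_P_cos [holomorphic_intros]:
  assumes "f holomorphic_on A" "0 < \<zeta>" "\<zeta> < pi"
  shows "(\<lambda>z. ferrers_P \<nu> (f z) (cos \<zeta>)) holomorphic_on A"
  using assms cos_monotone_0_pi[of \<zeta> pi] cos_monotone_0_pi[of 0 \<zeta>]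
  by (intro holomorphic_on_ferrers_P) auto

lemma ferrers_P_cos:
  assumes "0 < \<zeta>" "\<zeta> < pi"
  shows "ferrers_P \<nu> \<mu> (cos \<zeta>) =
    of_real (cot (\<zeta> / 2)) powr \<mu> * hyp2f1_reg (\<nu> + 1) (- \<nu>) (1 - \<mu>) (of_real ((sin (\<zeta> / 2))\<^sup>2))"
proof -
  have "0 < cot (\<zeta> / 2)" using assms by (intro cot_gt_zero) auto
  have "(1 + cos \<zeta>) / (1 - cos \<zeta>) = (cot (\<zeta> / 2))\<^sup>2"
    using cos_double_sin[of "\<zeta> / 2"] cos_double_cos[of "\<zeta> / 2"] by (simp add: cot_def power_divide)
  moreover have "of_real ((cot (\<zeta> / 2))\<^sup>2) powr (\<mu> / 2) = complex_of_real (cot (\<zeta> / 2)) powr \<mu>"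
    using \<open>0 < cot (\<zeta> / 2)\<close> by (simp add: powr_complex_of_real_eq_exp ln_realpow del: of_real_power)
  moreover have "(1 - cos \<zeta>) / 2 = (sin (\<zeta> / 2))\<^sup>2"
    using cos_double_sin[of "\<zeta> / 2"] by simp
  ultimately show ?thesis by (simp add: ferrers_P_def)
qed

section \<open>The Mehler--Dirichlet integral\<close>

lemma
  fixes g :: "real \<Rightarrow> real"
  assumes "a < b" and cont: "continuous_on {a..b} g" and mono: "strict_mono_on {a..b} g"
  shows strict_mono_on_inj_on_open_interval: "inj_on g {a<..<b}"
    and strict_mono_on_image_open_interval: "g ` {a<..<b} = {g a<..<g b}"
proof -
  show "inj_on g {a<..<b}"
    using strict_mono_on_imp_inj_on[OF mono] by (rule inj_on_subset) auto
  show "g ` {a<..<b} = {g a<..<g b}"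
  proof
    show "g ` {a<..<b} \<subseteq> {g a<..<g b}"
      using strict_mono_onD[OF mono] by auto
    show "{g a<..<g b} \<subseteq> g ` {a<..<b}"
    proof
      fix t assume t: "t \<in> {g a<..<g b}"
      then obtain x where "a \<le> x" "x \<le> b" "g x = t"
        using IVT'[of g a t b] cont \<open>a < b\<close> by auto
      moreover from this have "x \<noteq> a" "x \<noteq> b" using t by auto
      ultimately show "t \<in> g ` {a<..<b}" by force
    qed
  qed
qed

lemma has_integral_Beta_half_angle:
  fixes \<zeta> a l :: real
  defines "S \<equiv> sin (\<zeta> / 2)"
  assumes \<zeta>: "0 < \<zeta>" "\<zeta> < pi" and "0 < a" "0 < l"
  shows "((\<lambda>x. sin (x / 2) * cos (x / 2) / S\<^sup>2 *
      (((sin (x / 2) / S)\<^sup>2) powr (a - 1) * (1 - (sin (x / 2) / S)\<^sup>2) powr (l - 1)))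
      has_integral Beta a l) {0<..<\<zeta>}"
proof -
  define g where "g x = (sin (x / 2) / S)\<^sup>2" for x
  define g' where "g' x = sin (x / 2) * cos (x / 2) / S\<^sup>2" for x
  have sin_nonneg: "0 \<le> sin (x / 2)" if "0 \<le> x" "x \<le> \<zeta>" for x
    using that \<zeta> by (intro sin_ge_zero) auto
  have S: "0 < S" unfolding S_def using \<zeta> by (intro sin_gt_zero) auto
  have "strict_mono_on {0..\<zeta>} g"
    unfolding g_def power_divide using S sin_nonneg \<zeta>
    by (intro strict_mono_onI divide_strict_right_mono power_strict_mono sin_monotone_2pi) auto
  moreover have "continuous_on {0..\<zeta>} g"
    unfolding g_def using S by (intro continuous_intros) auto
  ultimately have "inj_on g {0<..<\<zeta>}" "g ` {0<..<\<zeta>} = {0<..<1}"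
    using strict_mono_on_inj_on_open_interval[of 0 \<zeta> g]
      strict_mono_on_image_open_interval[of 0 \<zeta> g] \<zeta> S
    by (auto simp: g_def S_def)
  moreover have "(g has_field_derivative g' x) (at x within {0<..<\<zeta>})" for x
    unfolding g_def g'_def using S
    by (auto intro!: derivative_eq_intros simp: power2_eq_square)
  ultimately have
      "(\<lambda>x. \<bar>g' x\<bar> * (g x powr (a - 1) * (1 - g x) powr (l - 1))) absolutely_integrable_on {0<..<\<zeta>}"
      "integral {0<..<\<zeta>} (\<lambda>x. \<bar>g' x\<bar> * (g x powr (a - 1) * (1 - g x) powr (l - 1))) = Beta a l"
    using absolutely_integrable_Beta_substitution[of a l "{0<..<\<zeta>}" g g']
      integral_Beta_substitution[of a l "{0<..<\<zeta>}" g g'] assms by auto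
  then have "((\<lambda>x. \<bar>g' x\<bar> * (g x powr (a - 1) * (1 - g x) powr (l - 1))) has_integral
      Beta a l) {0<..<\<zeta>}"
    using set_lebesgue_integral_eq_integral(1) integrable_integral by fastforce
  moreover have "0 \<le> g' x" if "x \<in> {0<..<\<zeta>}" for x
    unfolding g'_def using that \<zeta> sin_nonneg[of x] cos_ge_zero[of "x / 2"]
    by (intro divide_nonneg_nonneg mult_nonneg_nonneg) auto
  then have "\<bar>g' x\<bar> * (g x powr (a - 1) * (1 - g x) powr (l - 1)) =
      g' x * (g x powr (a - 1) * (1 - g x) powr (l - 1))" if "x \<in> {0<..<\<zeta>}" for x
    using that by simp
  ultimately show ?thesis
    unfolding g_def g'_def by (rule has_integral_eq[rotated])
qed

lemma Beta_half_angle_integrand: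
  fixes S u C :: real
  assumes "0 < u" "u < S"
  shows "2 powr (l - 1) * S powr (2 * a + 2 * l - 2) *
      (u * C / S\<^sup>2 * (((u / S)\<^sup>2) powr (a - 1) * (1 - (u / S)\<^sup>2) powr (l - 1))) =
    C * u powr (2 * a - 1) * (2 * (S\<^sup>2 - u\<^sup>2)) powr (l - 1)"
proof -
  have S: "0 < S" using assms by simp
  have square_powr: "(v\<^sup>2) powr p = v powr (2 * p)" if "0 < v" for v p :: real
    using that powr_powr[of v 2 p] by simp
  have square_quotient: "((u / S)\<^sup>2) powr (a - 1) = u powr (2 * a - 2) / S powr (2 * a - 2)"
    using assms S by (simp add: square_powr powr_divide right_diff_distrib)
  have "u\<^sup>2 < S\<^sup>2" using assms by (intro power_strict_mono) auto
  moreover have "1 - (u / S)\<^sup>2 = (S\<^sup>2 - u\<^sup>2) / S\<^sup>2"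
    using S by (simp add: diff_divide_distrib power_divide)
  ultimately have one_minus:
      "(1 - (u / S)\<^sup>2) powr (l - 1) = (S\<^sup>2 - u\<^sup>2) powr (l - 1) / S powr (2 * l - 2)"
    using S by (simp add: powr_divide square_powr right_diff_distrib)
  have S_powr: "S powr (2 * a + 2 * l - 2) = S powr (2 * a - 2) * S powr (2 * l - 2) * S\<^sup>2"
    using S powr_add[of S "2 * a - 2 + (2 * l - 2)" 2] powr_add[of S "2 * a - 2" "2 * l - 2"]
    by (simp add: algebra_simps)
  have u_powr: "u powr (2 * a - 1) = u powr (2 * a - 2) * u"
    using assms powr_add[of u "2 * a - 2" 1] by simp
  show ?thesis
    unfolding square_quotient one_minus S_powr u_powr powr_mult using S by (simp add: field_simps)
qed

lemma has_integral_cos_half_Beta: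
  fixes \<zeta> a l :: real
  assumes \<zeta>: "0 < \<zeta>" "\<zeta> < pi" and "0 < a" "0 < l"
  shows "((\<lambda>\<phi>. cos (\<phi> / 2) * sin (\<phi> / 2) powr (2 * a - 1) *
    (cos \<phi> - cos \<zeta>) powr (l - 1)) has_integral
     2 powr (l - 1) * sin (\<zeta> / 2) powr (2 * a + 2 * l - 2) * Beta a l) {0<..<\<zeta>}"
proof (rule has_integral_eq[OF _
    has_integral_mult_right[OF has_integral_Beta_half_angle[OF assms]]])
  fix x assume x: "x \<in> {0<..<\<zeta>}"
  have "cos x - cos \<zeta> = 2 * ((sin (\<zeta> / 2))\<^sup>2 - (sin (x / 2))\<^sup>2)"
    using cos_double_sin[of "x / 2"] cos_double_sin[of "\<zeta> / 2"] by simp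
  moreover have "0 < sin (x / 2)" "sin (x / 2) < sin (\<zeta> / 2)"
    using x \<zeta> by (auto intro!: sin_gt_zero sin_monotone_2pi)
  ultimately show "2 powr (l - 1) * sin (\<zeta> / 2) powr (2 * a + 2 * l - 2) *
      (sin (x / 2) * cos (x / 2) / (sin (\<zeta> / 2))\<^sup>2 * (((sin (x / 2) / sin (\<zeta> / 2))\<^sup>2) powr (a - 1) *
        (1 - (sin (x / 2) / sin (\<zeta> / 2))\<^sup>2) powr (l - 1))) =
      cos (x / 2) * sin (x / 2) powr (2 * a - 1) * (cos x - cos \<zeta>) powr (l - 1)"
    using Beta_half_angle_integrand by simp
qed

lemma has_integral_half_angle_moment:
  fixes \<zeta> l :: real
  assumes \<zeta>: "0 < \<zeta>" "\<zeta> < pi" and l: "0 < l"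
  shows "((\<lambda>\<phi>. cos (\<phi> / 2) * (cos \<phi> - cos \<zeta>) powr (l - 1) * (sin (\<phi> / 2))\<^sup>2 ^ n) has_integral
     2 powr (l - 1) * sin (\<zeta> / 2) powr (2 * l - 1) * (sin (\<zeta> / 2))\<^sup>2 ^ n *
       Beta (real n + 1 / 2) l) {0..\<zeta>}"
proof -
  have exponents: "2 * (real n + 1 / 2) - 1 = real (2 * n)"
    "2 * (real n + 1 / 2) + 2 * l - 2 = 2 * l - 1 + real (2 * n)" by simp_all
  have "0 < sin (\<phi> / 2)" if "0 < \<phi>" "\<phi> \<le> \<zeta>" for \<phi>
    using that \<zeta> by (intro sin_gt_zero) auto
  then have even_powr: "sin (\<phi> / 2) powr real (2 * n) = (sin (\<phi> / 2))\<^sup>2 ^ n" if "0 < \<phi>" "\<phi> \<le> \<zeta>"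
    for \<phi>
    using that by (simp only: powr_realpow power_mult)
  have "0 < real n + 1 / 2" by simp
  from has_integral_cos_half_Beta[OF \<zeta> this l]
  have "((\<lambda>\<phi>. cos (\<phi> / 2) * sin (\<phi> / 2) powr real (2 * n) *
      (cos \<phi> - cos \<zeta>) powr (l - 1)) has_integral
      2 powr (l - 1) * (sin (\<zeta> / 2) powr (2 * l - 1) * (sin (\<zeta> / 2))\<^sup>2 ^ n) *
        Beta (real n + 1 / 2) l) {0<..<\<zeta>}"
    unfolding exponents powr_add even_powr[OF \<zeta>(1) order_refl] .
  moreover have "cos (\<phi> / 2) * sin (\<phi> / 2) powr real (2 * n) * (cos \<phi> - cos \<zeta>) powr (l - 1) =
      cos (\<phi> / 2) * (cos \<phi> - cos \<zeta>) powr (l - 1) * (sin (\<phi> / 2))\<^sup>2 ^ n" if "\<phi> \<in> {0<..<\<zeta>}" for \<phi>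
    using that by (subst even_powr) auto
  ultimately show ?thesis
    unfolding has_integral_Icc_iff_Ioo mult.assoc[of "2 powr (l - 1)"]
    by (rule has_integral_eq[rotated])
qed

lemma has_integral_power_series_mult:
  fixes K u :: "real \<Rightarrow> real" and c :: "nat \<Rightarrow> complex"
  assumes K: "continuous_on {a..b} K" and u: "continuous_on {a..b} u"
    and u_le: "\<And>x. x \<in> {a..b} \<Longrightarrow> \<bar>u x\<bar> \<le> R"
    and summable_R: "summable (\<lambda>n. cmod (c n) * R ^ n)"
    and moment: "\<And>n. ((\<lambda>x. K x * u x ^ n) has_integral m n) {a..b}"
    and sums: "(\<lambda>n. c n * of_real (m n)) sums J"
  shows "((\<lambda>x. of_real (K x) * (\<Sum>n. c n * of_real (u x) ^ n)) has_integral J) {a..b}"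
proof -
  define f where "f n x = c n * of_real (K x * u x ^ n)" for n x
  obtain B where B: "\<And>x. x \<in> {a..b} \<Longrightarrow> \<bar>K x\<bar> \<le> B"
    using continuous_on_compact_bound[OF compact_Icc K] by (metis real_norm_def)
  have norm_power: "cmod (c n * of_real (u x) ^ n) \<le> cmod (c n) * R ^ n" if "x \<in> {a..b}" for n x
    using u_le[OF that] by (simp add: norm_mult norm_power mult_left_mono power_mono)
  have lim: "uniform_limit {a..b} (\<lambda>n x. \<Sum>i<n. f i x) (\<lambda>x. \<Sum>i. f i x) sequentially"
  proof (rule Weierstrass_m_test)
    show "summable (\<lambda>n. B * (cmod (c n) * R ^ n))" using summable_R by (rule summable_mult)
    show "cmod (f n x) \<le> B * (cmod (c n) * R ^ n)" if x: "x \<in> {a..b}" for n x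
      using mult_mono[OF B[OF x] norm_power[OF x, of n]] B[OF x]
      by (simp add: f_def norm_mult norm_power mult_ac)
  qed
  have cont: "continuous_on {a..b} (\<lambda>x. \<Sum>i<n. f i x)" for n
    unfolding f_def by (intro continuous_intros K u)
  obtain I J' where I: "\<And>n. ((\<lambda>x. \<Sum>i<n. f i x) has_integral I n) {a..b}"
    and J': "((\<lambda>x. \<Sum>i. f i x) has_integral J') {a..b}" and lim_I: "I \<longlonglongrightarrow> J'"
    using uniform_limit_integral[OF lim cont] by auto
  have "(f n has_integral c n * of_real (m n)) {a..b}" for n
    unfolding f_def by (intro has_integral_mult_right has_integral_of_real moment)
  then have "I = (\<lambda>n. \<Sum>i<n. c i * of_real (m i))"
    by (intro ext has_integral_unique[OF I] has_integral_sum) auto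
  then have "J' = J"
    using lim_I sums unfolding sums_def by (simp add: LIMSEQ_unique)
  moreover have "(\<Sum>i. f i x) = of_real (K x) * (\<Sum>n. c n * of_real (u x) ^ n)"
    if x: "x \<in> {a..b}" for x
  proof -
    have "summable (\<lambda>n. c n * of_real (u x) ^ n)"
      using norm_power[OF x] summable_R by (rule summable_comparison_test'[rotated, where N = 0])
    from suminf_mult[OF this, of "of_real (K x)"] show ?thesis
      by (simp add: f_def mult_ac)
  qed
  ultimately show ?thesis using has_integral_eq[OF _ J'] by simp
qed

lemma rGamma_mult_Beta:
  assumes "a \<notin> \<int>\<^sub>\<le>\<^sub>0"
  shows "rGamma a * Beta a b = Gamma b * rGamma (a + b)"
  using assms by (simp add: Beta_altdef rGamma_inverse_Gamma Gamma_eq_zero_iff)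

lemma hyp2f1_coeff_half_mult_Beta:
  "hyp2f1_coeff a b (1 / 2) n * of_real (Beta (real n + 1 / 2) l) =
    of_real (Gamma l) * hyp2f1_coeff a b (1 / 2 + of_real l) n"
proof -
  have "complex_of_real (real n + 1 / 2) \<notin> \<int>\<^sub>\<le>\<^sub>0" by (intro Re_pos_imp_notin_nonpos_Ints) simp
  then have "rGamma (1 / 2 + of_nat n) * complex_of_real (Beta (real n + 1 / 2) l) =
      of_real (Gamma l) * rGamma (1 / 2 + of_real l + of_nat n)"
    using rGamma_mult_Beta[of "complex_of_real (real n + 1 / 2)" "of_real l"]
    by (simp add: Beta_complex_of_real[symmetric] Gamma_complex_of_real[symmetric] ac_simps)
  then show ?thesis by (simp add: hyp2f1_coeff_def)
qed

lemma has_integral_hyp2f1_reg_half_angle: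
  assumes \<zeta>: "0 < \<zeta>" "\<zeta> < pi" and l: "1 < l"
  shows "((\<lambda>\<phi>. of_real (cos (\<phi> / 2) * (cos \<phi> - cos \<zeta>) powr (l - 1)) *
        hyp2f1_reg a b (1 / 2) (of_real ((sin (\<phi> / 2))\<^sup>2))) has_integral
      of_real (2 powr (l - 1) * Gamma l * sin (\<zeta> / 2) powr (2 * l - 1)) *
        hyp2f1_reg a b (1 / 2 + of_real l) (of_real ((sin (\<zeta> / 2))\<^sup>2))) {0..\<zeta>}"
proof -
  define S where "S = sin (\<zeta> / 2)"
  have S2: "cmod (of_real (S\<^sup>2)) < 1"
    unfolding S_def using \<zeta> by (intro norm_sin_half_squared_lt_1) auto
  show ?thesis
    unfolding hyp2f1_reg_eq_suminf[of a b "1 / 2"] S_def[symmetric]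
  proof (rule has_integral_power_series_mult[where R = "S\<^sup>2"])
    show "continuous_on {0..\<zeta>} (\<lambda>\<phi>. cos (\<phi> / 2) * (cos \<phi> - cos \<zeta>) powr (l - 1))"
      using l \<zeta> by (intro continuous_intros continuous_on_powr') (auto simp: cos_mono_le_eq)
    show "continuous_on {0..\<zeta>} (\<lambda>\<phi>. (sin (\<phi> / 2))\<^sup>2)" by (intro continuous_intros) auto
    show "\<bar>(sin (\<phi> / 2))\<^sup>2\<bar> \<le> S\<^sup>2" if "\<phi> \<in> {0..\<zeta>}" for \<phi>
      unfolding S_def using that \<zeta>
      by (auto intro!: power_mono sin_monotone_2pi_le sin_ge_zero)
    show "summable (\<lambda>n. cmod (hyp2f1_coeff a b (1 / 2) n) * S\<^sup>2 ^ n)"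
      using summable_norm_hyp2f1_reg[OF S2] by (simp add: norm_mult norm_power)
    show "((\<lambda>\<phi>. cos (\<phi> / 2) * (cos \<phi> - cos \<zeta>) powr (l - 1) * (sin (\<phi> / 2))\<^sup>2 ^ n) has_integral
        2 powr (l - 1) * S powr (2 * l - 1) * S\<^sup>2 ^ n * Beta (real n + 1 / 2) l) {0..\<zeta>}" for n
      unfolding S_def using \<zeta> l by (intro has_integral_half_angle_moment) auto
    have "hyp2f1_coeff a b (1 / 2) n *
          of_real (2 powr (l - 1) * S powr (2 * l - 1) * S\<^sup>2 ^ n * Beta (real n + 1 / 2) l) =
        of_real (2 powr (l - 1) * Gamma l * S powr (2 * l - 1)) *
          (hyp2f1_coeff a b (1 / 2 + of_real l) n * of_real (S\<^sup>2) ^ n)" for n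
      using hyp2f1_coeff_half_mult_Beta[of a b n l] by (simp add: mult_ac)
    then show "(\<lambda>n. hyp2f1_coeff a b (1 / 2) n *
          of_real (2 powr (l - 1) * S powr (2 * l - 1) * S\<^sup>2 ^ n * Beta (real n + 1 / 2) l)) sums
        (of_real (2 powr (l - 1) * Gamma l * S powr (2 * l - 1)) *
          hyp2f1_reg a b (1 / 2 + of_real l) (of_real (S\<^sup>2)))"
      using sums_mult[OF sums_hyp2f1_reg[OF S2]] by (simp only:)
  qed
qed

lemma sin_powr_mult_cot_half_powr:
  assumes "0 < \<zeta>" "\<zeta> < pi"
  shows "sin \<zeta> powr p * cot (\<zeta> / 2) powr (- p) = 2 powr p * sin (\<zeta> / 2) powr (2 * p)"
proof -
  have S: "0 < sin (\<zeta> / 2)" and C: "0 < cos (\<zeta> / 2)"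
    using assms by (auto intro!: sin_gt_zero cos_gt_zero)
  have "sin \<zeta> = 2 * sin (\<zeta> / 2) * cos (\<zeta> / 2)" using sin_double[of "\<zeta> / 2"] by simp
  then have "ln (sin \<zeta>) = ln 2 + ln (sin (\<zeta> / 2)) + ln (cos (\<zeta> / 2))"
    using S C by (simp add: ln_mult)
  moreover have "ln (cot (\<zeta> / 2)) = ln (cos (\<zeta> / 2)) - ln (sin (\<zeta> / 2))"
    using S C by (simp add: cot_def ln_div)
  moreover have "0 < cot (\<zeta> / 2)" "0 < sin \<zeta>"
    using S C assms by (auto simp: cot_def intro: sin_gt_zero)
  ultimately show ?thesis
    using S by (simp add: powr_def exp_add[symmetric]) (simp add: algebra_simps)
qed

lemma Mehler_Dirichlet:
  assumes \<zeta>: "0 < \<zeta>" "\<zeta> < pi" and l: "1 < l"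
  shows "((\<lambda>\<phi>. cos (s * of_real \<phi>) * of_real ((cos \<phi> - cos \<zeta>) powr (l - 1))) has_integral
     of_real (sqrt (pi / 2) * Gamma l * sin \<zeta> powr (l - 1 / 2)) *
       ferrers_P (s - 1 / 2) (1 / 2 - of_real l) (cos \<zeta>)) {0..\<zeta>}"
proof -
  let ?F = "\<lambda>c \<phi>. hyp2f1_reg (s + 1 / 2) (1 / 2 - s) c (of_real ((sin (\<phi> / 2))\<^sup>2))"
  let ?\<kappa> = "2 powr (l - 1) * Gamma l * sin (\<zeta> / 2) powr (2 * l - 1)"
  have sqrt_pi: "sqrt pi * 2 powr (l - 1) = sqrt (pi / 2) * 2 powr (l - 1 / 2)"
    using powr_add[of 2 "l - 1" "1 / 2"] by (simp add: real_sqrt_divide powr_half_sqrt)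
  have "((\<lambda>\<phi>. of_real (sqrt pi) *
      (of_real (cos (\<phi> / 2) * (cos \<phi> - cos \<zeta>) powr (l - 1)) * ?F (1 / 2) \<phi>))
      has_integral of_real (sqrt pi) * (of_real ?\<kappa> * ?F (1 / 2 + of_real l) \<zeta>)) {0..\<zeta>}"
    by (intro has_integral_mult_right has_integral_hyp2f1_reg_half_angle \<zeta> l)
  moreover have "of_real (sqrt pi) *
      (of_real (cos (\<phi> / 2) * (cos \<phi> - cos \<zeta>) powr (l - 1)) * ?F (1 / 2) \<phi>) =
      cos (s * of_real \<phi>) * of_real ((cos \<phi> - cos \<zeta>) powr (l - 1))" if "\<phi> \<in> {0..\<zeta>}" for \<phi>
  proof -
    have "\<bar>\<phi>\<bar> < pi" using that \<zeta> by auto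
    then show ?thesis unfolding cos_eq_hyp2f1_reg[OF \<open>\<bar>\<phi>\<bar> < pi\<close>] of_real_mult
      by (simp only: mult_ac)
  qed
  ultimately have "((\<lambda>\<phi>. cos (s * of_real \<phi>) * of_real ((cos \<phi> - cos \<zeta>) powr (l - 1))) has_integral
      of_real (sqrt pi) * (of_real ?\<kappa> * ?F (1 / 2 + of_real l) \<zeta>)) {0..\<zeta>}"
    by (rule has_integral_eq[rotated])
  also have "of_real (sqrt pi) * (of_real ?\<kappa> * ?F (1 / 2 + of_real l) \<zeta>) =
      of_real (sqrt pi * ?\<kappa>) * ?F (1 / 2 + of_real l) \<zeta>"
    by simp
  also have "sqrt pi * ?\<kappa> =
      sqrt (pi / 2) * Gamma l * sin \<zeta> powr (l - 1 / 2) * cot (\<zeta> / 2) powr (1 / 2 - l)"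
    using sqrt_pi sin_powr_mult_cot_half_powr[OF \<zeta>, of "l - 1 / 2"] by (simp add: algebra_simps)
  also have "of_real \<dots> * ?F (1 / 2 + of_real l) \<zeta> =
      of_real (sqrt (pi / 2) * Gamma l * sin \<zeta> powr (l - 1 / 2)) *
      (of_real (cot (\<zeta> / 2) powr (1 / 2 - l)) * ?F (1 / 2 + of_real l) \<zeta>)"
    by simp
  also have "of_real (cot (\<zeta> / 2) powr (1 / 2 - l)) * ?F (1 / 2 + of_real l) \<zeta> =
      ferrers_P (s - 1 / 2) (1 / 2 - of_real l) (cos \<zeta>)"
    using cot_gt_zero[of "\<zeta> / 2"] powr_of_real[of "cot (\<zeta> / 2)" "1 / 2 - l"] \<zeta>
    by (simp add: ferrers_P_cos add.commute)
  finally show ?thesis .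
qed

lemma has_integral_symmetric_interval:
  fixes f :: "real \<Rightarrow> 'a::banach"
  assumes "0 \<le> a" and f: "f integrable_on {- a..a}"
    and sum: "((\<lambda>x. f x + f (- x)) has_integral I) {0..a}"
  shows "(f has_integral I) {- a..a}"
proof -
  have "f integrable_on {- a..0}" and f_pos: "f integrable_on {0..a}"
    using f \<open>0 \<le> a\<close> by (auto intro: integrable_on_subinterval)
  then have f_neg: "(\<lambda>x. f (- x)) integrable_on {0..a}"
    using Henstock_Kurzweil_Integration.integrable_reflect_real[of f 0 "- a"] by simp
  have "integral {- a..a} f = integral {- a..0} f + integral {0..a} f"
    using \<open>0 \<le> a\<close> f by (intro Henstock_Kurzweil_Integration.integral_combine[symmetric]) auto
  also have "integral {- a..0} f = integral {0..a} (\<lambda>x. f (- x))"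
    using Henstock_Kurzweil_Integration.integral_reflect_real[of a 0 "\<lambda>x. f (- x)"] by simp
  also have "\<dots> + integral {0..a} f = I"
    using integral_unique[OF sum] integral_add[OF f_pos f_neg] by (simp add: add.commute)
  finally show ?thesis using f by (simp add: has_integral_iff)
qed

lemma cos_le_cos_of_abs_le:
  assumes "\<bar>\<phi>\<bar> \<le> \<zeta>" "\<zeta> \<le> pi"
  shows "cos \<zeta> \<le> cos \<phi>"
  using cos_monotone_0_pi_le[of "\<bar>\<phi>\<bar>" \<zeta>] assms by simp

lemma has_integral_exp_Mehler_Dirichlet:
  assumes \<zeta>: "0 < \<zeta>" "\<zeta> < pi" and l: "1 < l"
  shows "((\<lambda>\<phi>. exp (\<i> * s * of_real \<phi>) * of_real ((cos \<phi> - cos \<zeta>) powr (l - 1))) has_integral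
     of_real (2 * sqrt (pi / 2) * Gamma l * sin \<zeta> powr (l - 1 / 2)) *
       ferrers_P (s - 1 / 2) (1 / 2 - of_real l) (cos \<zeta>)) {- \<zeta>..\<zeta>}"
    (is "(?f has_integral _) _")
proof (rule has_integral_symmetric_interval)
  have "cos \<zeta> \<le> cos \<phi>" if "\<phi> \<in> {- \<zeta>..\<zeta>}" for \<phi>
    using that \<zeta> by (intro cos_le_cos_of_abs_le) auto
  then have "continuous_on {- \<zeta>..\<zeta>} ?f"
    using l by (intro continuous_intros continuous_on_powr') auto
  then show "?f integrable_on {- \<zeta>..\<zeta>}" by (rule integrable_continuous_interval)
  have "?f \<phi> + ?f (- \<phi>) = 2 * (cos (s * of_real \<phi>) * of_real ((cos \<phi> - cos \<zeta>) powr (l - 1)))" for \<phi>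
    by (simp add: cos_exp_eq algebra_simps)
  moreover have "((\<lambda>\<phi>. 2 * (cos (s * of_real \<phi>) *
      of_real ((cos \<phi> - cos \<zeta>) powr (l - 1)))) has_integral
      2 * (of_real (sqrt (pi / 2) * Gamma l * sin \<zeta> powr (l - 1 / 2)) *
        ferrers_P (s - 1 / 2) (1 / 2 - of_real l) (cos \<zeta>))) {0..\<zeta>}"
    by (intro has_integral_mult_right Mehler_Dirichlet assms)
  ultimately show "((\<lambda>\<phi>. ?f \<phi> + ?f (- \<phi>)) has_integral
      of_real (2 * sqrt (pi / 2) * Gamma l * sin \<zeta> powr (l - 1 / 2)) *
        ferrers_P (s - 1 / 2) (1 / 2 - of_real l) (cos \<zeta>)) {0..\<zeta>}"
    by (simp add: mult.assoc)
qed (use \<zeta> in simp)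

section \<open>Deformation to the vertical half-lines\<close>

lemma Cauchy_theorem_rectpath:
  assumes "Re u \<le> Re v" "Im u \<le> Im v"
    and cont: "continuous_on (cbox u v) H" and holo: "H holomorphic_on box u v"
  shows "(H has_contour_integral 0) (rectpath u v)"
proof (rule Cauchy_theorem_convex[where K = "{}", OF cont convex_box(1)])
  show "H field_differentiable at z" if "z \<in> interior (cbox u v) - {}" for z
    using that by (intro holomorphic_on_imp_differentiable_at[OF holo open_box])
      (simp add: interior_cbox)
  show "path_image (rectpath u v) \<subseteq> cbox u v"
    using assms(1,2) by (rule path_image_rectpath_subset_cbox)
qed auto

lemma integral_rectangle_three_sides:
  fixes H :: "complex \<Rightarrow> complex"
  assumes "a < b" "0 < T"
    and cont: "continuous_on (cbox (of_real a) (Complex b T)) H"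
    and holo: "H holomorphic_on box (of_real a) (Complex b T)"
  shows "integral {a..b} (\<lambda>x. H (of_real x)) + \<i> * integral {0..T} (\<lambda>y. H (Complex b y))
      - \<i> * integral {0..T} (\<lambda>y. H (Complex a y)) =
    contour_integral (linepath (Complex a T) (Complex b T)) H"
proof -
  let ?R = "cbox (of_real a) (Complex b T)"
  have continuous: "continuous_on (closed_segment u v) H" if "u \<in> ?R" "v \<in> ?R" for u v
    using cont closed_segment_subset[OF that convex_box(1)] by (rule continuous_on_subset)
  then have integrable: "H contour_integrable_on linepath u v" if "u \<in> ?R" "v \<in> ?R" for u v
    using that by (intro contour_integrable_continuous_linepath)
  have corners: "of_real a \<in> ?R" "of_real b \<in> ?R" "Complex b T \<in> ?R" "Complex a T \<in> ?R"
    using assms(1,2) by (auto simp: in_cbox_complex_iff)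
  have "(H has_contour_integral 0) (rectpath (of_real a) (Complex b T))"
    using assms(1,2) by (intro Cauchy_theorem_rectpath cont holo) auto
  then have "contour_integral (rectpath (of_real a) (Complex b T)) H = 0"
    by (rule contour_integral_unique)
  then have "contour_integral (linepath (of_real a) (of_real b)) H +
      (contour_integral (linepath (of_real b) (Complex b T)) H +
       (contour_integral (linepath (Complex b T) (Complex a T)) H +
        contour_integral (linepath (Complex a T) (of_real a)) H)) = 0"
    using integrable corners
    by (simp add: rectpath_def Let_def contour_integral_join flip: complex_of_real_def)
  moreover have "contour_integral (linepath (of_real a) (of_real b)) H =
      integral {a..b} (\<lambda>x. H (of_real x))"
    using \<open>a < b\<close> by (subst contour_integral_linepath_Reals_eq) auto
  moreover have "contour_integral (linepath (of_real c) (Complex c T)) H =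
      \<i> * integral {0..T} (\<lambda>y. H (Complex c y))" for c
    using \<open>0 < T\<close> by (intro contour_integral_linepath_same_Re) auto
  moreover have
    "contour_integral (linepath (Complex a T) (of_real a)) H =
        - contour_integral (linepath (of_real a) (Complex a T)) H"
    "contour_integral (linepath (Complex b T) (Complex a T)) H =
        - contour_integral (linepath (Complex a T) (Complex b T)) H"
    by (intro contour_integral_reverse_linepath continuous corners)+
  ultimately show ?thesis
    by (simp add: algebra_simps eq_neg_iff_add_eq_0)
qed

lemma norm_rectangle_integral_le:
  fixes H :: "complex \<Rightarrow> complex"
  assumes "a < b" "0 < T"
    and cont: "continuous_on (cbox (of_real a) (Complex b T)) H"
    and holo: "H holomorphic_on box (of_real a) (Complex b T)"
    and bound: "\<And>x. a \<le> x \<Longrightarrow> x \<le> b \<Longrightarrow> cmod (H (Complex x T)) \<le> B"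
  shows "cmod (integral {a..b} (\<lambda>x. H (of_real x)) + \<i> * integral {0..T} (\<lambda>y. H (Complex b y))
      - \<i> * integral {0..T} (\<lambda>y. H (Complex a y))) \<le> B * (b - a)"
proof -
  let ?R = "cbox (of_real a) (Complex b T)" and ?L = "closed_segment (Complex a T) (Complex b T)"
  have top: "?L \<subseteq> ?R"
    using assms(1,2) by (intro closed_segment_subset convex_box) (auto simp: in_cbox_complex_iff)
  have "cmod (contour_integral (linepath (Complex a T) (Complex b T)) H) \<le>
      B * cmod (Complex b T - Complex a T)"
  proof (rule contour_integral_bound_linepath)
    show "H contour_integrable_on linepath (Complex a T) (Complex b T)"
      using continuous_on_subset[OF cont top] by (rule contour_integrable_continuous_linepath)
    show "0 \<le> B" using norm_ge_zero bound[of a] \<open>a < b\<close>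
      by (meson less_imp_le order_refl order_trans)
    show "cmod (H w) \<le> B" if "w \<in> ?L" for w
    proof -
      have "Im w = T" using that by (auto simp: closed_segment_def left_diff_distrib)
      moreover have "w \<in> ?R" using top that by blast
      ultimately show ?thesis using bound[of "Re w"] by (auto simp: in_cbox_complex_iff)
    qed
  qed
  also have "cmod (Complex b T - Complex a T) = b - a"
    using \<open>a < b\<close> by (simp add: cmod_def)
  finally show ?thesis
    unfolding integral_rectangle_three_sides[OF assms(1-4)] .
qed

lemma tendsto_integral_lborel_pos:
  fixes f :: "real \<Rightarrow> 'a::euclidean_space"
  assumes "integrable lborel_pos f"
  shows "((\<lambda>T. integral {0..T} f) \<longlongrightarrow> integral\<^sup>L lborel_pos f) at_top"
proof -
  define g where "g x = indicator {0<..} x *\<^sub>R f x" for x :: real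
  have indicator_g: "(\<lambda>x. indicator {0..} x *\<^sub>R g x) = g"
    by (auto simp: g_def indicator_def)
  have g: "set_integrable lborel {0..} g"
    using assms unfolding set_integrable_def indicator_g
    by (simp add: integrable_restrict_space g_def[abs_def])
  have integral_g: "set_lebesgue_integral lborel {0..} g = integral\<^sup>L lborel_pos f"
    unfolding set_lebesgue_integral_def indicator_g
    by (simp add: integral_restrict_space g_def[abs_def])
  have "set_lebesgue_integral lborel {0..T} g = integral {0..T} f" for T
  proof -
    have "set_integrable lborel {0..T} g" by (rule set_integrable_subset[OF g]) auto
    then have "set_lebesgue_integral lborel {0..T} g = integral {0..T} g"
      by (rule set_borel_integral_eq_integral)
    also have "\<dots> = integral {0..T} f"
      by (rule integral_spike[of "{0}"]) (auto simp: g_def)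
    finally show ?thesis .
  qed
  then show ?thesis
    using tendsto_set_lebesgue_integral_at_top[OF _ g] integral_g by simp
qed

lemma integral_half_strip:
  fixes H :: "complex \<Rightarrow> complex"
  assumes "a < b"
    and cont: "continuous_on {z. a \<le> Re z \<and> Re z \<le> b \<and> 0 \<le> Im z} H"
    and holo: "H holomorphic_on {z. a < Re z \<and> Re z < b \<and> 0 < Im z}"
    and bound: "\<And>x y. a \<le> x \<Longrightarrow> x \<le> b \<Longrightarrow> 0 \<le> y \<Longrightarrow> cmod (H (Complex x y)) \<le> B y"
    and B: "(B \<longlongrightarrow> 0) at_top"
    and left: "integrable lborel_pos (\<lambda>y. H (Complex a y))"
    and right: "integrable lborel_pos (\<lambda>y. H (Complex b y))"
  shows "integral {a..b} (\<lambda>x. H (of_real x)) =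
    \<i> * (\<integral>y. H (Complex a y) \<partial>lborel_pos) - \<i> * (\<integral>y. H (Complex b y) \<partial>lborel_pos)"
proof -
  define D where "D T = integral {a..b} (\<lambda>x. H (of_real x)) +
      \<i> * integral {0..T} (\<lambda>y. H (Complex b y))
      - \<i> * integral {0..T} (\<lambda>y. H (Complex a y))" for T
  have "cmod (D T) \<le> B T * (b - a)" if "0 < T" for T
    unfolding D_def
  proof (rule norm_rectangle_integral_le[OF \<open>a < b\<close> that])
    show "continuous_on (cbox (of_real a) (Complex b T)) H"
      by (rule continuous_on_subset[OF cont]) (auto simp: in_cbox_complex_iff)
    show "H holomorphic_on box (of_real a) (Complex b T)"
      by (rule holomorphic_on_subset[OF holo]) (auto simp: in_box_complex_iff)
  qed (use bound that in auto)
  then have "\<forall>\<^sub>F T in at_top. cmod (D T) \<le> B T * (b - a)"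
    using eventually_gt_at_top[of 0] by (rule eventually_mono[rotated])
  moreover have "((\<lambda>T. B T * (b - a)) \<longlongrightarrow> 0) at_top"
    using tendsto_mult_right[OF B, of "b - a"] by simp
  ultimately have "(D \<longlongrightarrow> 0) at_top" by (rule Lim_null_comparison)
  moreover have "(D \<longlongrightarrow> integral {a..b} (\<lambda>x. H (of_real x)) + \<i> * (\<integral>y. H (Complex b y) \<partial>lborel_pos)
      - \<i> * (\<integral>y. H (Complex a y) \<partial>lborel_pos)) at_top"
    unfolding D_def by (intro tendsto_intros tendsto_integral_lborel_pos left right)
  ultimately have "integral {a..b} (\<lambda>x. H (of_real x)) + \<i> * (\<integral>y. H (Complex b y) \<partial>lborel_pos)
      - \<i> * (\<integral>y. H (Complex a y) \<partial>lborel_pos) = 0"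
    by (intro tendsto_unique[OF trivial_limit_at_top_linorder])
  then show ?thesis by (simp add: algebra_simps add_eq_0_iff2)
qed

definition edge_kernel :: "complex \<Rightarrow> complex \<Rightarrow> complex \<Rightarrow> real \<Rightarrow> complex" where
  "edge_kernel s l w y = Beta_kernel l s y * (1 + w * of_real (exp y - 1)) powr (l - 1)"

definition edge_integral :: "complex \<Rightarrow> complex \<Rightarrow> complex \<Rightarrow> complex" where
  "edge_integral s l w = integral\<^sup>L lborel_pos (edge_kernel s l w)"

lemma Re_edge_base_ge:
  assumes "0 < Re w" "0 < y"
  shows "min 1 (Re w) * exp y \<le> Re (1 + w * of_real (exp y - 1))"
proof -
  have "min 1 (Re w) * exp y \<le> min 1 (Re w) + Re w * (exp y - 1)"
    using mult_right_mono[of "min 1 (Re w)" "Re w" "exp y - 1"] assms by (simp add: algebra_simps)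
  then show ?thesis by simp
qed

lemma Re_edge_base_pos: "0 < Re w \<Longrightarrow> 0 < y \<Longrightarrow> 0 < Re (1 + w * of_real (exp y - 1))"
  by (rule less_le_trans[OF _ Re_edge_base_ge]) auto

lemma edge_base_neq_0: "0 < Re w \<Longrightarrow> 0 < y \<Longrightarrow> 1 + w * of_real (exp y - 1) \<noteq> 0"
  by (metis Re_edge_base_pos less_irrefl zero_complex.sel(1))

lemma norm_powr_le:
  fixes v p :: complex
  assumes "v \<noteq> 0"
  shows "cmod (v powr p) \<le> cmod v powr Re p * exp (pi * \<bar>Im p\<bar>)"
proof -
  have "- (Im p * Arg v) \<le> \<bar>Im p * Arg v\<bar>" by simp
  also have "\<dots> \<le> \<bar>Im p\<bar> * pi"
    using Arg_bounded[of v] unfolding abs_mult by (intro mult_left_mono) auto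
  finally show ?thesis
    unfolding norm_powr_complex by (intro mult_left_mono) (simp_all add: mult.commute)
qed

lemma powr_le_powr_add_powr:
  fixes x :: real
  assumes "0 < c" "0 < x" "c * x \<le> v" "v \<le> C * x"
  shows "v powr q \<le> (c powr q + C powr q) * x powr q"
proof (cases "0 \<le> q")
  case True
  have "v powr q \<le> (C * x) powr q"
    using assms True by (intro powr_mono2) (auto intro: order_trans[OF _ assms(3)])
  also have "\<dots> = C powr q * x powr q" by (rule powr_mult)
  finally show ?thesis by (simp add: distrib_right add_increasing)
next
  case False
  then have "v powr q \<le> (c * x) powr q"
    using assms by (intro powr_mono2') auto
  also have "\<dots> = c powr q * x powr q" by (rule powr_mult)
  finally show ?thesis by (simp add: distrib_right add_increasing2)
qed

lemma norm_edge_base_powr_le: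
  assumes w: "0 < Re w" and y: "0 < y"
  shows "cmod ((1 + w * of_real (exp y - 1)) powr p) \<le>
    (min 1 (Re w) powr Re p + (1 + cmod w) powr Re p) * exp (Re p * y) * exp (pi * \<bar>Im p\<bar>)"
proof -
  define v where "v = 1 + w * of_real (exp y - 1)"
  have "min 1 (Re w) * exp y \<le> Re v" unfolding v_def by (rule Re_edge_base_ge[OF assms])
  also have "\<dots> \<le> cmod v" by (rule complex_Re_le_cmod)
  finally have lower: "min 1 (Re w) * exp y \<le> cmod v" .
  have "cmod v \<le> 1 + cmod w * (exp y - 1)"
    using norm_triangle_ineq[of 1 "w * of_real (exp y - 1)"] y
    by (simp add: v_def norm_mult del: of_real_diff)
  also have "\<dots> \<le> (1 + cmod w) * exp y"
    using y one_le_exp_iff[of y] by (simp add: algebra_simps add_increasing)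
  finally have upper: "cmod v \<le> (1 + cmod w) * exp y" .
  have "v \<noteq> 0" unfolding v_def by (rule edge_base_neq_0[OF assms])
  then have "cmod (v powr p) \<le> cmod v powr Re p * exp (pi * \<bar>Im p\<bar>)" by (rule norm_powr_le)
  also have "\<dots> \<le> (min 1 (Re w) powr Re p + (1 + cmod w) powr Re p) * exp y powr Re p *
      exp (pi * \<bar>Im p\<bar>)"
    using lower upper w by (intro mult_right_mono powr_le_powr_add_powr) auto
  also have "exp y powr Re p = exp (Re p * y)" by (simp add: powr_def)
  finally show ?thesis unfolding v_def .
qed

lemma borel_measurable_edge_kernel: "edge_kernel s l w \<in> borel_measurable lborel_pos"
  unfolding edge_kernel_def by (rule borel_measurable_lborel_pos) measurable

lemma integrable_edge_kernel:
  assumes w: "0 < Re w" and l: "0 < Re l" "Re l < 1 + Re s"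
  shows "integrable lborel_pos (edge_kernel s l w)"
proof -
  define c where "c = (min 1 (Re w) powr Re (l - 1) + (1 + cmod w) powr Re (l - 1)) *
      exp (pi * \<bar>Im (l - 1)\<bar>)"
  have "integrable lborel_pos (\<lambda>y. of_real c * Beta_kernel l (s - l + 1) y)"
    using l by (intro integrable_mult_right integrable_Beta_kernel) auto
  then show ?thesis
  proof (rule Bochner_Integration.integrable_bound)
    show "AE y in lborel_pos. cmod (edge_kernel s l w y) \<le>
        cmod (of_real c * Beta_kernel l (s - l + 1) y)"
    proof (rule AE_I2)
      fix y assume "y \<in> space lborel_pos"
      then have y: "0 < y" by (simp add: space_lborel_pos)
      have shift: "Beta_kernel l (s - l + 1) y = Beta_kernel l s y * exp ((l - 1) * of_real y)"
        by (simp add: Beta_kernel_def mult.assoc exp_add[symmetric] algebra_simps)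
      have "cmod (edge_kernel s l w y) \<le> cmod (Beta_kernel l s y) * (c * exp (Re (l - 1) * y))"
        using norm_edge_base_powr_le[OF w y, of "l - 1"] unfolding edge_kernel_def norm_mult
        by (intro mult_left_mono) (simp_all add: c_def mult_ac)
      also have "\<dots> = c * cmod (Beta_kernel l (s - l + 1) y)"
        unfolding shift norm_mult by simp
      also have "\<dots> \<le> cmod (of_real c * Beta_kernel l (s - l + 1) y)"
        unfolding norm_mult norm_of_real by (intro mult_right_mono) auto
      finally show "cmod (edge_kernel s l w y) \<le> cmod (of_real c * Beta_kernel l (s - l + 1) y)" .
    qed
  qed (rule borel_measurable_edge_kernel)
qed

lemma holomorphic_on_edge_integral:
  assumes w: "0 < Re w"
  shows "(\<lambda>l. edge_integral s l w) holomorphic_on vertical_strip 0 (1 + Re s)"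
  unfolding edge_integral_def
proof (rule holomorphic_on_integral_exp[OF open_vertical_strip])
  let ?v = "\<lambda>y. 1 + w * of_real (exp y - 1)"
  show "integrable lborel_pos (edge_kernel s l w)" if "l \<in> vertical_strip 0 (1 + Re s)" for l
    using that w by (intro integrable_edge_kernel) auto
  show "edge_kernel s l w y = exp (- s * of_real y) / of_real (1 - exp (- y)) / ?v y *
      exp (l * (of_real (ln (1 - exp (- y))) + Ln (?v y)))" if "y \<in> space lborel_pos" for l y
  proof -
    have y: "0 < y" using that by (simp add: space_lborel_pos)
    have "?v y powr (l - 1) = exp (l * Ln (?v y)) / ?v y"
      using edge_base_neq_0[OF w y] unfolding powr_diff by (simp add: powr_def)
    then show ?thesis
      unfolding edge_kernel_def Beta_kernel_eq_exp[OF y] distrib_left exp_add by simp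
  qed
qed

text \<open>\<open>half_cot \<zeta> = i exp (- i \<zeta>) / (2 sin \<zeta>)\<close>.\<close>

definition half_cot :: "real \<Rightarrow> complex" where
  "half_cot \<zeta> = Complex (1 / 2) (cot \<zeta> / 2)"

lemma Re_half_cot [simp]: "Re (half_cot \<zeta>) = 1 / 2"
  by (simp add: half_cot_def)

lemma cos_Complex_diff_cos:
  assumes "sin \<zeta> \<noteq> 0"
  shows "cos (Complex \<zeta> y) - of_real (cos \<zeta>) =
    - \<i> * of_real (sin \<zeta> * (1 - exp (- y))) * (1 + half_cot \<zeta> * of_real (exp y - 1))"
proof (rule complex_eqI)
  have inverse: "exp (- y) * exp y = 1" by (simp add: exp_minus)
  have "cos \<zeta> * (exp y + exp (- y)) / 2 - cos \<zeta> = cos \<zeta> * ((1 - exp (- y)) * (exp y - 1)) / 2"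
    using inverse by (simp add: algebra_simps)
  then show "Re (cos (Complex \<zeta> y) - of_real (cos \<zeta>)) =
    Re (- \<i> * of_real (sin \<zeta> * (1 - exp (- y))) * (1 + half_cot \<zeta> * of_real (exp y - 1)))"
    using assms by (simp add: Re_cos half_cot_def cot_def del: of_real_mult of_real_diff)
  have "(1 - exp (- y)) * (1 + exp y) = exp y - exp (- y)"
    using inverse by (simp add: algebra_simps)
  moreover have "sin \<zeta> * (1 - exp (- y)) * (1 + (exp y - 1) / 2) =
      sin \<zeta> * ((1 - exp (- y)) * (1 + exp y)) / 2" by (simp add: field_simps)
  ultimately have "sin \<zeta> * (exp (- y) - exp y) / 2 =
      - (sin \<zeta> * (1 - exp (- y)) * (1 + (exp y - 1) / 2))"
    by (simp add: right_diff_distrib diff_divide_distrib)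
  then show "Im (cos (Complex \<zeta> y) - of_real (cos \<zeta>)) =
    Im (- \<i> * of_real (sin \<zeta> * (1 - exp (- y))) * (1 + half_cot \<zeta> * of_real (exp y - 1)))"
    by (simp add: Im_cos half_cot_def del: of_real_mult of_real_diff)
qed

lemma powr_mult_Re_nonneg:
  fixes u v :: complex
  assumes "u \<noteq> 0" "0 \<le> Re u" "0 < Re v"
  shows "(u * v) powr p = u powr p * v powr p"
proof -
  have v: "v \<noteq> 0" using assms by auto
  have "\<bar>Im (Ln u)\<bar> \<le> pi / 2" "\<bar>Im (Ln v)\<bar> < pi / 2"
    using Re_Ln_pos_le[OF assms(1)] Re_Ln_pos_lt[OF v] assms by auto
  then have "Ln (u * v) = Ln u + Ln v"
    using assms v by (intro Ln_times_simple) (auto simp: abs_le_iff abs_less_iff)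
  then show ?thesis using assms v by (simp add: powr_def distrib_left exp_add)
qed

lemma powr_minus_ii_mult_sign:
  assumes "\<sigma> = 1 \<or> \<sigma> = - 1"
  shows "(- \<i> * of_real \<sigma>) powr p = exp (- (\<i> * of_real \<sigma> * (p * of_real (pi / 2))))"
  using assms by (auto simp: powr_def mult_ac)

definition strip_integrand :: "real \<Rightarrow> complex \<Rightarrow> complex \<Rightarrow> complex \<Rightarrow> complex" where
  "strip_integrand \<zeta> s l z = exp (\<i> * s * z) * (cos z - of_real (cos \<zeta>)) powr (l - 1)"

lemma cos_diff_cos_powr_edge:
  assumes \<zeta>: "0 < \<zeta>" "\<zeta> < pi" and y: "0 < y" and \<sigma>: "\<sigma> = 1 \<or> \<sigma> = - 1"
  shows "(cos (Complex (\<sigma> * \<zeta>) y) - of_real (cos \<zeta>)) powr p =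
    of_real (sin \<zeta>) powr p * of_real (1 - exp (- y)) powr p * (- \<i> * of_real \<sigma>) powr p *
    (1 + half_cot (\<sigma> * \<zeta>) * of_real (exp y - 1)) powr p"
proof -
  define r where "r = 1 - exp (- y)"
  define v where "v = 1 + half_cot (\<sigma> * \<zeta>) * of_real (exp y - 1)"
  have S: "0 < sin \<zeta>" using \<zeta> by (intro sin_gt_zero)
  have r: "0 < r" using y by (simp add: r_def)
  have v: "0 < Re v" unfolding v_def using y by (intro Re_edge_base_pos) simp_all
  have "\<i> * of_real \<sigma> \<noteq> 0" "Re (- \<i> * of_real \<sigma>) = 0" using \<sigma> by auto
  then have "(- \<i> * of_real \<sigma> * v) powr p = (- \<i> * of_real \<sigma>) powr p * v powr p"
    using v by (intro powr_mult_Re_nonneg) auto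
  moreover have "cos (Complex (\<sigma> * \<zeta>) y) - of_real (cos \<zeta>) =
      of_real (sin \<zeta>) * (of_real r * (- \<i> * of_real \<sigma> * v))"
    using cos_Complex_diff_cos[of "\<sigma> * \<zeta>" y] S \<sigma> by (auto simp: v_def r_def)
  ultimately show ?thesis
    unfolding v_def[symmetric] r_def[symmetric]
    by (simp only: powr_times_real_left Reals_of_real Re_complex_of_real less_imp_le[OF S]
        less_imp_le[OF r] mult.assoc)
qed

lemma gamma_phase_0: "gamma_phase \<zeta> l (s - l) 0 = s * of_real \<zeta> - l * of_real (pi / 2)"
  by (simp add: gamma_phase_def)

lemma strip_integrand_edge:
  assumes \<zeta>: "0 < \<zeta>" "\<zeta> < pi" and y: "0 < y" and \<sigma>: "\<sigma> = 1 \<or> \<sigma> = - 1"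
  shows "strip_integrand \<zeta> s l (Complex (\<sigma> * \<zeta>) y) =
    \<i> * of_real \<sigma> * of_real (sin \<zeta>) powr (l - 1) * exp (\<i> * of_real \<sigma> * gamma_phase \<zeta> l (s - l) 0) *
    edge_kernel s l (half_cot (\<sigma> * \<zeta>)) y"
proof -
  have "(- \<i> * of_real \<sigma>) powr (l - 1) = \<i> * of_real \<sigma> * (- \<i> * of_real \<sigma>) powr l"
    using \<sigma> by (auto simp: powr_diff)
  moreover have "exp (\<i> * s * Complex (\<sigma> * \<zeta>) y) * (- \<i> * of_real \<sigma>) powr l =
      exp (\<i> * of_real \<sigma> * gamma_phase \<zeta> l (s - l) 0) * exp (- s * of_real y)"
    unfolding powr_minus_ii_mult_sign[OF \<sigma>] exp_add[symmetric] gamma_phase_0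
    by (simp add: Complex_eq algebra_simps del: of_real_divide)
  ultimately have phase: "exp (\<i> * s * Complex (\<sigma> * \<zeta>) y) * (- \<i> * of_real \<sigma>) powr (l - 1) =
      \<i> * of_real \<sigma> * (exp (\<i> * of_real \<sigma> * gamma_phase \<zeta> l (s - l) 0) * exp (- s * of_real y))"
    by (simp only: mult.left_commute)
  have "strip_integrand \<zeta> s l (Complex (\<sigma> * \<zeta>) y) = of_real (sin \<zeta>) powr (l - 1) *
      (exp (\<i> * s * Complex (\<sigma> * \<zeta>) y) * (- \<i> * of_real \<sigma>) powr (l - 1)) *
      (of_real (1 - exp (- y)) powr (l - 1) *
        (1 + half_cot (\<sigma> * \<zeta>) * of_real (exp y - 1)) powr (l - 1))"
    unfolding strip_integrand_def cos_diff_cos_powr_edge[OF assms] by (simp only: mult_ac)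
  then show ?thesis
    unfolding phase edge_kernel_def Beta_kernel_def by (simp only: mult_ac)
qed

lemma cos_diff_cos_notin_nonpos_Reals:
  assumes \<zeta>: "0 < \<zeta>" "\<zeta> < pi" and z: "\<bar>Re z\<bar> \<le> \<zeta>" "0 \<le> Im z" "\<bar>Re z\<bar> < \<zeta> \<or> 0 < Im z"
  shows "cos z - of_real (cos \<zeta>) \<notin> \<real>\<^sub>\<le>\<^sub>0"
proof -
  have "0 < Re (cos z - of_real (cos \<zeta>))" if "Im (cos z - of_real (cos \<zeta>)) = 0"
  proof (cases "Im z = 0")
    case True
    then have "cos \<zeta> < cos \<bar>Re z\<bar>" using \<zeta> z by (intro cos_monotone_0_pi) auto
    then show ?thesis using True by (simp add: Re_cos)
  next
    case False
    then have "0 < Im z" using z by simp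
    have "sin (Re z) = 0" using that \<open>0 < Im z\<close> by (simp add: Im_cos)
    then have "Re z = 0"
      using sin_gt_zero[of "\<bar>Re z\<bar>"] \<zeta> z by (cases "Re z = 0") (auto simp: abs_if split: if_splits)
    moreover have "cos \<zeta> < cos 0" using \<zeta> by (intro cos_monotone_0_pi) auto
    moreover have "1 \<le> (exp (Im z) + exp (- Im z)) / 2"
      using cosh_real_ge_1[of "Im z"] by (simp add: cosh_def)
    ultimately show ?thesis by (simp add: Re_cos)
  qed
  then show ?thesis by (auto simp: complex_nonpos_Reals_iff)
qed

lemma continuous_on_strip_integrand:
  assumes \<zeta>: "0 < \<zeta>" "\<zeta> < pi" and l: "1 < Re l"
  shows "continuous_on {z. - \<zeta> \<le> Re z \<and> Re z \<le> \<zeta> \<and> 0 \<le> Im z} (strip_integrand \<zeta> s l)"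
  unfolding strip_integrand_def
proof (intro continuous_on_mult continuous_on_powr_complex continuous_intros subsetI)
  fix z assume "z \<in> {z. - \<zeta> \<le> Re z \<and> Re z \<le> \<zeta> \<and> 0 \<le> Im z}"
  then have z: "\<bar>Re z\<bar> \<le> \<zeta>" "0 \<le> Im z" by auto
  show "z \<in> {z. 0 \<le> Re (cos z - of_real (cos \<zeta>)) \<or> Im (cos z - of_real (cos \<zeta>)) \<noteq> 0}"
  proof (cases "\<bar>Re z\<bar> < \<zeta> \<or> 0 < Im z")
    case True
    then show ?thesis
      using cos_diff_cos_notin_nonpos_Reals[OF \<zeta> z] by (auto simp: complex_nonpos_Reals_iff)
  next
    case False
    then have "Im z = 0" "\<bar>Re z\<bar> = \<zeta>" using z by auto
    then have "cos z = of_real (cos \<zeta>)"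
      by (auto simp: complex_eq_iff Re_cos Im_cos abs_if split: if_splits)
    then show ?thesis by simp
  qed
qed (use l in auto)

lemma holomorphic_on_strip_integrand:
  assumes "0 < \<zeta>" "\<zeta> < pi"
  shows "strip_integrand \<zeta> s l holomorphic_on {z. - \<zeta> < Re z \<and> Re z < \<zeta> \<and> 0 < Im z}"
  unfolding strip_integrand_def[abs_def]
  by (intro holomorphic_intros cos_diff_cos_notin_nonpos_Reals assms) auto

lemma norm_strip_integrand_le:
  assumes x: "- \<zeta> \<le> x" "x \<le> \<zeta>" and y: "0 \<le> y" and l: "1 < Re l"
  shows "cmod (strip_integrand \<zeta> s l (Complex x y)) \<le>
    exp (\<bar>Im s\<bar> * \<zeta>) * 2 powr (Re l - 1) * exp (pi * \<bar>Im l\<bar>) * exp (- (1 + Re s - Re l) * y)"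
proof -
  have "cmod (cos (Complex x y)) \<le> exp y"
    using cmod_cos_le_exp[of 1 "Complex x y"] y by simp
  moreover have "cmod (complex_of_real (cos \<zeta>)) \<le> exp y"
    using abs_cos_le_one[of \<zeta>] one_le_exp_iff[of y] y unfolding norm_of_real by linarith
  ultimately have base: "cmod (cos (Complex x y) - of_real (cos \<zeta>)) \<le> 2 * exp y"
    using norm_triangle_ineq4[of "cos (Complex x y)" "of_real (cos \<zeta>)"] by linarith
  have power: "cmod ((cos (Complex x y) - of_real (cos \<zeta>)) powr (l - 1)) \<le>
      2 powr (Re l - 1) * exp ((Re l - 1) * y) * exp (pi * \<bar>Im l\<bar>)"
  proof (cases "cos (Complex x y) - of_real (cos \<zeta>) = 0")
    case False
    have "cmod ((cos (Complex x y) - of_real (cos \<zeta>)) powr (l - 1)) \<le>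
        cmod (cos (Complex x y) - of_real (cos \<zeta>)) powr (Re l - 1) * exp (pi * \<bar>Im l\<bar>)"
      using norm_powr_le[OF False, of "l - 1"] by simp
    also have "\<dots> \<le> (2 * exp y) powr (Re l - 1) * exp (pi * \<bar>Im l\<bar>)"
      using base l by (intro mult_right_mono powr_mono2) auto
    also have "(2 * exp y) powr (Re l - 1) = 2 powr (Re l - 1) * exp ((Re l - 1) * y)"
      unfolding powr_mult by (simp add: powr_def)
    finally show ?thesis .
  qed simp
  have "- (Im s * x) \<le> \<bar>Im s\<bar> * \<bar>x\<bar>" unfolding abs_mult[symmetric] by (rule abs_ge_minus_self)
  also have "\<dots> \<le> \<bar>Im s\<bar> * \<zeta>" using x by (intro mult_left_mono) auto
  finally have "cmod (exp (\<i> * s * Complex x y)) \<le> exp (\<bar>Im s\<bar> * \<zeta>) * exp (- Re s * y)"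
    by (simp add: exp_add[symmetric])
  then have "cmod (strip_integrand \<zeta> s l (Complex x y)) \<le> exp (\<bar>Im s\<bar> * \<zeta>) * exp (- Re s * y) *
      (2 powr (Re l - 1) * exp ((Re l - 1) * y) * exp (pi * \<bar>Im l\<bar>))"
    unfolding strip_integrand_def norm_mult using power by (intro mult_mono) auto
  also have "\<dots> = exp (\<bar>Im s\<bar> * \<zeta>) * 2 powr (Re l - 1) * exp (pi * \<bar>Im l\<bar>) *
      (exp (- Re s * y) * exp ((Re l - 1) * y))"
    by (simp only: mult_ac)
  also have "exp (- Re s * y) * exp ((Re l - 1) * y) = exp (- (1 + Re s - Re l) * y)"
    unfolding exp_add[symmetric] by (simp add: algebra_simps)
  finally show ?thesis .
qed

lemma
  assumes \<zeta>: "0 < \<zeta>" "\<zeta> < pi" and l: "0 < Re l" "Re l < 1 + Re s" and \<sigma>: "\<sigma> = 1 \<or> \<sigma> = - 1"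
  shows integrable_strip_integrand_edge:
      "integrable lborel_pos (\<lambda>y. strip_integrand \<zeta> s l (Complex (\<sigma> * \<zeta>) y))"
    and integral_strip_integrand_edge:
      "(\<integral>y. strip_integrand \<zeta> s l (Complex (\<sigma> * \<zeta>) y) \<partial>lborel_pos) =
        \<i> * of_real \<sigma> * of_real (sin \<zeta>) powr (l - 1) *
          exp (\<i> * of_real \<sigma> * gamma_phase \<zeta> l (s - l) 0) *
        edge_integral s l (half_cot (\<sigma> * \<zeta>))"
proof -
  let ?c = "\<i> * of_real \<sigma> * of_real (sin \<zeta>) powr (l - 1) *
      exp (\<i> * of_real \<sigma> * gamma_phase \<zeta> l (s - l) 0)"
  have edge: "strip_integrand \<zeta> s l (Complex (\<sigma> * \<zeta>) y) = ?c * edge_kernel s l (half_cot (\<sigma> * \<zeta>)) y"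
    if "y \<in> space lborel_pos" for y
    using that by (intro strip_integrand_edge \<zeta> \<sigma>) (simp add: space_lborel_pos)
  have "integrable lborel_pos (\<lambda>y. ?c * edge_kernel s l (half_cot (\<sigma> * \<zeta>)) y)"
    using l by (intro integrable_mult_right integrable_edge_kernel) auto
  then show "integrable lborel_pos (\<lambda>y. strip_integrand \<zeta> s l (Complex (\<sigma> * \<zeta>) y))"
    by (subst Bochner_Integration.integrable_cong[OF refl edge])
  have "(\<integral>y. strip_integrand \<zeta> s l (Complex (\<sigma> * \<zeta>) y) \<partial>lborel_pos) =
      (\<integral>y. ?c * edge_kernel s l (half_cot (\<sigma> * \<zeta>)) y \<partial>lborel_pos)"
    by (intro Bochner_Integration.integral_cong refl edge)
  then show "(\<integral>y. strip_integrand \<zeta> s l (Complex (\<sigma> * \<zeta>) y) \<partial>lborel_pos) =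
      ?c * edge_integral s l (half_cot (\<sigma> * \<zeta>))"
    unfolding edge_integral_def by (simp only: integral_mult_right_zero)
qed

text \<open>The strip integrand is continuous up to its zeros at \<open>\<plusminus>\<zeta>\<close> because \<open>Re l > 1\<close>; this is
  why smaller \<open>l\<close> is only reached by continuation.\<close>

lemma integral_strip_integrand:
  assumes \<zeta>: "0 < \<zeta>" "\<zeta> < pi" and l: "1 < Re l" "Re l < 1 + Re s"
  shows "integral {- \<zeta>..\<zeta>} (\<lambda>x. strip_integrand \<zeta> s l (of_real x)) = of_real (sin \<zeta>) powr (l - 1) *
    (exp (\<i> * gamma_phase \<zeta> l (s - l) 0) * edge_integral s l (half_cot \<zeta>) +
     exp (- (\<i> * gamma_phase \<zeta> l (s - l) 0)) * edge_integral s l (half_cot (- \<zeta>)))"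
proof -
  have l_pos: "0 < Re l" using l by simp
  note edge_integrable = integrable_strip_integrand_edge[OF \<zeta> l_pos l(2)]
    and edge_integral = integral_strip_integrand_edge[OF \<zeta> l_pos l(2)]
  define B where "B y = exp (\<bar>Im s\<bar> * \<zeta>) * 2 powr (Re l - 1) * exp (pi * \<bar>Im l\<bar>) *
      exp (- (1 + Re s - Re l) * y)" for y
  have "((\<lambda>y. exp (- (1 + Re s - Re l) * y)) \<longlongrightarrow> 0) at_top"
    by (rule filterlim_compose[OF exp_at_bot
      filterlim_tendsto_neg_mult_at_bot[OF tendsto_const _ filterlim_ident]])
       (use l in simp)
  then have "(B \<longlongrightarrow> 0) at_top"
    unfolding B_def by (rule tendsto_mult_right_zero)
  then have "integral {- \<zeta>..\<zeta>} (\<lambda>x. strip_integrand \<zeta> s l (of_real x)) =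
      \<i> * (\<integral>y. strip_integrand \<zeta> s l (Complex (- \<zeta>) y) \<partial>lborel_pos) -
      \<i> * (\<integral>y. strip_integrand \<zeta> s l (Complex \<zeta> y) \<partial>lborel_pos)"
    using edge_integrable[of 1] edge_integrable[of "- 1"] \<zeta> l norm_strip_integrand_le
    by (intro integral_half_strip continuous_on_strip_integrand holomorphic_on_strip_integrand)
       (auto simp: B_def)
  then show ?thesis
    using edge_integral[of 1] edge_integral[of "- 1"] by (simp add: algebra_simps)
qed

lemma integral_strip_integrand_of_real:
  assumes \<zeta>: "0 < \<zeta>" "\<zeta> < pi" and x: "1 < x"
  shows "integral {- \<zeta>..\<zeta>} (\<lambda>\<phi>. strip_integrand \<zeta> s (of_real x) (of_real \<phi>)) =
    of_real (sin \<zeta> powr (x - 1)) *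
    (2 * Gamma (of_real x) * (of_real (sqrt (pi * sin \<zeta> / 2)) *
      ferrers_P (s - 1 / 2) (1 / 2 - of_real x) (cos \<zeta>)))"
proof -
  have S: "0 < sin \<zeta>" using \<zeta> by (intro sin_gt_zero)
  have "strip_integrand \<zeta> s (of_real x) (of_real \<phi>) =
      exp (\<i> * s * of_real \<phi>) * of_real ((cos \<phi> - cos \<zeta>) powr (x - 1))" if "\<phi> \<in> {- \<zeta>..\<zeta>}" for \<phi>
  proof -
    have "cos \<zeta> \<le> cos \<phi>" using that \<zeta> by (intro cos_le_cos_of_abs_le) auto
    then show ?thesis
      using powr_of_real[of "cos \<phi> - cos \<zeta>" "x - 1"] by (simp add: strip_integrand_def cos_of_real)
  qed
  then have "integral {- \<zeta>..\<zeta>} (\<lambda>\<phi>. strip_integrand \<zeta> s (of_real x) (of_real \<phi>)) =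
      of_real (2 * sqrt (pi / 2) * Gamma x * sin \<zeta> powr (x - 1 / 2)) *
      ferrers_P (s - 1 / 2) (1 / 2 - of_real x) (cos \<zeta>)"
    using integral_unique[OF has_integral_exp_Mehler_Dirichlet[OF \<zeta> x]]
    by (subst Henstock_Kurzweil_Integration.integral_cong) auto
  also have "2 * sqrt (pi / 2) * Gamma x * sin \<zeta> powr (x - 1 / 2) =
      sin \<zeta> powr (x - 1) * (2 * Gamma x * sqrt (pi * sin \<zeta> / 2))"
    using S powr_add[of "sin \<zeta>" "x - 1" "1 / 2"]
    by (simp add: powr_half_sqrt real_sqrt_mult real_sqrt_divide)
  finally show ?thesis
    by (simp add: Gamma_complex_of_real mult.assoc)
qed

lemma ferrers_P_eq_edge_integrals:
  fixes s l :: complex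
  assumes \<zeta>: "0 < \<zeta>" "\<zeta> < pi" and l: "0 < Re l" "Re l < 1 + Re s" and s: "0 < Re s"
  shows "of_real (sqrt (pi * sin \<zeta> / 2)) * ferrers_P (s - 1 / 2) (1 / 2 - l) (cos \<zeta>) =
    rGamma l / 2 * (exp (\<i> * gamma_phase \<zeta> l (s - l) 0) * edge_integral s l (half_cot \<zeta>) +
      exp (- (\<i> * gamma_phase \<zeta> l (s - l) 0)) * edge_integral s l (half_cot (- \<zeta>)))"
    (is "?L l = rGamma l / 2 * ?E l")
proof (rule analytic_continuation_vertical_strip[where f = ?L and g = "\<lambda>l. rGamma l / 2 * ?E l"
      and a = 0 and b = "1 + Re s" and c = 1 and d = "1 + Re s"])
  show "?L holomorphic_on vertical_strip 0 (1 + Re s)"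
    by (intro holomorphic_intros \<zeta>)
  show "(\<lambda>l. rGamma l / 2 * ?E l) holomorphic_on vertical_strip 0 (1 + Re s)"
    unfolding gamma_phase_0 by (intro holomorphic_intros holomorphic_on_edge_integral) auto
  fix x assume x: "1 < x" "x < 1 + Re s"
  have S: "0 < sin \<zeta>" using \<zeta> by (intro sin_gt_zero)
  then have "of_real (sin \<zeta>) powr (complex_of_real x - 1) = of_real (sin \<zeta> powr (x - 1))"
    using powr_of_real[of "sin \<zeta>" "x - 1"] by simp
  then have "of_real (sin \<zeta> powr (x - 1)) * ?E (of_real x) =
      of_real (sin \<zeta> powr (x - 1)) * (2 * Gamma (of_real x) * ?L (of_real x))"
    using integral_strip_integrand[OF \<zeta>, of "of_real x" s]
      integral_strip_integrand_of_real[OF \<zeta> x(1), of s] x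
    by (simp only: Re_complex_of_real)
  then have E_eq: "?E (of_real x) = 2 * Gamma (of_real x) * ?L (of_real x)" using S by simp
  show "?L (of_real x) = rGamma (of_real x) / 2 * ?E (of_real x)"
    unfolding E_eq using Gamma_mult_rGamma_Re_pos[of "of_real x"] x by (simp add: mult.commute)
qed (use l s in auto)

section \<open>The coefficients of the expansion\<close>

lemma acoef_eq_pochhammer:
  fixes x :: "'a::field_char_0"
  shows "acoef n (x - 1 / 2) =
    (- 1) ^ n * (pochhammer x n * pochhammer (1 - x) n) / (2 ^ n * fact n)"
proof -
  have "(\<Prod>k = 1..n. 4 * (x - 1 / 2)\<^sup>2 - (2 * of_nat k - 1)\<^sup>2) =
      (- 4) ^ n * (pochhammer x n * pochhammer (1 - x) n)"
  proof (induction n)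
    case (Suc n)
    have "4 * (x - 1 / 2)\<^sup>2 - (2 * of_nat (Suc n) - 1)\<^sup>2 =
        - 4 * ((x + of_nat n) * (1 - x + of_nat n))"
      by (simp add: power2_eq_square field_simps)
    moreover have "(\<Prod>k = 1..Suc n. 4 * (x - 1 / 2)\<^sup>2 - (2 * of_nat k - 1)\<^sup>2) =
        (4 * (x - 1 / 2)\<^sup>2 - (2 * of_nat (Suc n) - 1)\<^sup>2) *
          (\<Prod>k = 1..n. 4 * (x - 1 / 2)\<^sup>2 - (2 * of_nat k - 1)\<^sup>2)"
      by (subst prod.nat_ivl_Suc') simp_all
    moreover have "(- 4 * (u * v)) * (c * (p * q)) = (- 4 * c) * ((p * u) * (q * v))"
      for u v c p q :: 'a
      by (simp add: mult_ac)
    ultimately show ?case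
      by (simp only: Suc.IH pochhammer_Suc power_Suc)
  qed simp
  moreover have "(- 4 :: 'a) ^ n = (- 1) ^ n * 2 ^ n * 2 ^ n"
      "(8 :: 'a) ^ n = 2 ^ n * 2 ^ n * 2 ^ n"
    by (simp_all flip: power_mult_distrib)
  ultimately show ?thesis unfolding acoef_def by simp
qed

lemma pochhammer_reflection:
  fixes z :: complex
  assumes "- real n < Re z" "Re z < real n + 1"
  shows "pochhammer z n * pochhammer (1 - z) n =
    sin (of_real pi * z) / of_real pi * Gamma (z + of_nat n) * Gamma (1 - z + of_nat n)"
proof -
  have pochhammer_eq: "pochhammer u n = rGamma u * Gamma (u + of_nat n)"
    if "0 < Re (u + of_nat n)" for u :: complex
    using pochhammer_rGamma[of u n] Gamma_mult_rGamma_Re_pos[OF that] by (simp add: mult_ac)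
  have "pochhammer z n * pochhammer (1 - z) n =
      (rGamma z * rGamma (1 - z)) * Gamma (z + of_nat n) * Gamma (1 - z + of_nat n)"
    using pochhammer_eq[of z] pochhammer_eq[of "1 - z"] assms by simp
  then show ?thesis unfolding rGamma_reflection_complex .
qed

lemma pochhammer_reflection_real:
  fixes x :: real
  assumes "- real n < x" "x < real n + 1"
  shows "pochhammer x n * pochhammer (1 - x) n =
    sin (pi * x) / pi * Gamma (x + real n) * Gamma (1 - x + real n)"
proof -
  have "complex_of_real (pochhammer x n * pochhammer (1 - x) n) =
      pochhammer (of_real x) n * pochhammer (1 - of_real x) n"
    by (simp add: pochhammer_of_real[symmetric])
  also have "\<dots> = sin (of_real pi * of_real x) / of_real pi * Gamma (of_real x + of_nat n) *
      Gamma (1 - of_real x + of_nat n)"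
    using assms by (intro pochhammer_reflection) auto
  also have "\<dots> = complex_of_real (sin (pi * x) / pi * Gamma (x + real n) * Gamma (1 - x + real n))"
    by (simp add: Gamma_complex_of_real[symmetric] sin_of_real[symmetric] algebra_simps
      del: sin_of_real)
  finally show ?thesis by (simp only: of_real_eq_iff)
qed

lemma abs_acoef_divide_abs_sin:
  assumes "- real k < x" "x < real k + 1" "x \<notin> \<int>"
  shows "\<bar>acoef k (x - 1 / 2)\<bar> / \<bar>sin (pi * x)\<bar> =
    Gamma (x + real k) * Gamma (1 - x + real k) / (pi * 2 ^ k * fact k)"
proof -
  have "0 < Gamma (x + real k)" "0 < Gamma (1 - x + real k)"
    using assms by (auto intro!: Gamma_real_pos)
  moreover have "sin (pi * x) \<noteq> 0"
    using assms(3) by (auto simp: sin_zero_iff_int2)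
  ultimately show ?thesis
    unfolding acoef_eq_pochhammer pochhammer_reflection_real[OF assms(1,2)]
    by (simp add: abs_mult power_abs)
qed

lemma eventually_notin_Ints:
  fixes x :: real
  assumes "x \<in> \<int>"
  shows "\<forall>\<^sub>F t in at x. t \<notin> \<int>"
proof -
  have "\<forall>\<^sub>F t in at x. t \<in> {x - 1<..<x + 1} - {x}"
    by (intro eventually_at_in_open) auto
  then show ?thesis
  proof eventually_elim
    case (elim t)
    show "t \<notin> \<int>"
    proof
      assume "t \<in> \<int>"
      with assms obtain i j :: int where "t = of_int i" "x = of_int j" by (auto elim!: Ints_cases)
      with elim show False by auto
    qed
  qed
qed

lemma acoef_sin_ratio_eq:
  assumes "- real k < x" "x < real k + 1"
  shows "acoef_sin_ratio k x = Gamma (x + real k) * Gamma (1 - x + real k) / (pi * 2 ^ k * fact k)"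
proof (cases "x \<in> \<int>")
  case False
  then show ?thesis using abs_acoef_divide_abs_sin[OF assms] by (simp add: acoef_sin_ratio_def)
next
  case True
  define h where "h t = Gamma (t + real k) * Gamma (1 - t + real k) / (pi * 2 ^ k * fact k)" for t
  have "isCont h x"
    unfolding h_def using assms
    by (intro continuous_intros isCont_Gamma) (auto dest: nonpos_Ints_nonpos)
  then have "(h \<longlongrightarrow> h x) (at x)" by (simp add: isCont_def)
  moreover have "\<forall>\<^sub>F t in at x. t \<in> {- real k<..<real k + 1} - {x}"
    using assms by (intro eventually_at_in_open) auto
  then have "\<forall>\<^sub>F t in at x. \<bar>acoef k (t - 1 / 2)\<bar> / \<bar>sin (pi * t)\<bar> = h t"
    using eventually_notin_Ints[OF True]
    by eventually_elim (auto simp: h_def abs_acoef_divide_abs_sin)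
  ultimately have "((\<lambda>t. \<bar>acoef k (t - 1 / 2)\<bar> / \<bar>sin (pi * t)\<bar>) \<longlongrightarrow> h x) (at x)"
    by (simp add: tendsto_cong)
  then have "Lim (at x) (\<lambda>t. \<bar>acoef k (t - 1 / 2)\<bar> / \<bar>sin (pi * t)\<bar>) = h x"
    by (intro tendsto_Lim) auto
  then show ?thesis using True by (simp add: acoef_sin_ratio_def h_def)
qed

lemma acoef_sin_ratio_nonneg:
  assumes "- real k < x" "x < real k + 1"
  shows "0 \<le> acoef_sin_ratio k x"
  unfolding acoef_sin_ratio_eq[OF assms] using assms
  by (intro divide_nonneg_nonneg mult_nonneg_nonneg less_imp_le[OF Gamma_real_pos]) auto

section \<open>The remainder as a double integral\<close>

lemma
  fixes f :: "'a \<Rightarrow> 'c::{banach, real_normed_field, second_countable_topology}" and g :: "'b \<Rightarrow> 'c"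
  assumes "sigma_finite_measure M" "sigma_finite_measure N"
    and f: "integrable M f" and g: "integrable N g"
  shows integrable_pair_mult: "integrable (M \<Otimes>\<^sub>M N) (\<lambda>(x, y). f x * g y)"
    and integral_pair_mult: "(\<integral>(x, y). f x * g y \<partial>(M \<Otimes>\<^sub>M N)) = integral\<^sup>L M f * integral\<^sup>L N g"
proof -
  interpret M: sigma_finite_measure M by fact
  interpret N: sigma_finite_measure N by fact
  interpret MN: pair_sigma_finite M N ..
  have [measurable]: "f \<in> borel_measurable M" "g \<in> borel_measurable N"
    using f g by auto
  show integrable: "integrable (M \<Otimes>\<^sub>M N) (\<lambda>(x, y). f x * g y)"
  proof (rule MN.Fubini_integrable)
    show "(\<lambda>(x, y). f x * g y) \<in> borel_measurable (M \<Otimes>\<^sub>M N)" by measurable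
    show "integrable M (\<lambda>x. \<integral>y. norm (case (x, y) of (x, y) \<Rightarrow> f x * g y) \<partial>N)"
      using f by (simp add: norm_mult)
    show "AE x in M. integrable N (\<lambda>y. case (x, y) of (x, y) \<Rightarrow> f x * g y)"
      using g by (intro AE_I2) simp
  qed
  show "(\<integral>(x, y). f x * g y \<partial>(M \<Otimes>\<^sub>M N)) = integral\<^sup>L M f * integral\<^sup>L N g"
    using MN.integral_fst'[OF integrable] by simp
qed

lemma sigma_finite_lborel_pos: "sigma_finite_measure lborel_pos"
  by (intro sigma_finite_measure_restrict_space sigma_finite_lborel) auto

abbreviation lborel_quadrant :: "(real \<times> real) measure" where
  "lborel_quadrant \<equiv> lborel_pos \<Otimes>\<^sub>M lborel_pos"

lemma space_lborel_quadrant: "space lborel_quadrant = {0<..} \<times> {0<..}"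
  by (simp add: space_pair_measure space_lborel_pos)

lemma borel_measurable_lborel_quadrant:
  assumes "f \<in> borel_measurable (borel \<Otimes>\<^sub>M borel)"
  shows "f \<in> borel_measurable lborel_quadrant"
proof -
  have "(\<lambda>p. p) \<in> lborel_quadrant \<rightarrow>\<^sub>M borel \<Otimes>\<^sub>M borel"
    by (intro measurable_pair)
       (auto simp: o_def intro!: measurable_compose[OF measurable_fst]
          measurable_compose[OF measurable_snd] measurable_restrict_space1)
  from measurable_compose[OF this assms] show ?thesis .
qed

definition stretch :: "real \<times> real \<Rightarrow> real" where
  "stretch = (\<lambda>(y, q). (exp y - 1) * q)"

definition quadrant_kernel :: "complex \<Rightarrow> complex \<Rightarrow> real \<times> real \<Rightarrow> complex" where
  "quadrant_kernel s l = (\<lambda>(y, q). Beta_kernel l s y * Gamma_kernel (1 - l) 1 q)"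

lemma stretch_nonneg: "p \<in> space lborel_quadrant \<Longrightarrow> 0 \<le> stretch p"
  by (auto simp: stretch_def space_lborel_quadrant)

lemma borel_measurable_stretch: "stretch \<in> borel_measurable lborel_quadrant"
  unfolding stretch_def by (rule borel_measurable_lborel_quadrant) measurable

lemma borel_measurable_quadrant_kernel: "quadrant_kernel s l \<in> borel_measurable lborel_quadrant"
  unfolding quadrant_kernel_def by (rule borel_measurable_lborel_quadrant) measurable

lemma norm_quadrant_kernel:
  assumes "p \<in> space lborel_quadrant"
  shows "of_real (cmod (quadrant_kernel s l p)) =
    quadrant_kernel (of_real (Re s)) (of_real (Re l)) p"
  using assms norm_Gamma_kernel[of _ "1 - l" 1]
  by (auto simp: quadrant_kernel_def space_lborel_quadrant norm_mult norm_Beta_kernel)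

lemma quadrant_kernel_mult_stretch_power:
  assumes "p \<in> space lborel_quadrant"
  shows "quadrant_kernel s l p * of_real (stretch p ^ n) =
    (case p of (y, q) \<Rightarrow> Beta_kernel (l + of_nat n) (s - of_nat n) y *
      Gamma_kernel (1 - l + of_nat n) 1 q)"
proof -
  obtain y q where p: "p = (y, q)" "0 < y" "0 < q"
    using assms by (auto simp: space_lborel_quadrant)
  have "of_real (stretch p ^ n) = of_real (exp y - 1) ^ n * complex_of_real q ^ n"
    by (simp add: stretch_def p(1) power_mult_distrib)
  then show ?thesis
    unfolding Beta_kernel_mult_power[OF p(2), symmetric] Gamma_kernel_mult_power[OF p(3), symmetric]
      quadrant_kernel_def p(1) prod.case by (simp only: mult_ac)
qed

lemma
  assumes l: "- real n < Re l" "Re l < real n + 1" and s: "real n < Re s"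
  shows integrable_quadrant_moment:
      "integrable lborel_quadrant (\<lambda>p. quadrant_kernel s l p * of_real (stretch p ^ n))"
    and integral_quadrant_moment:
      "(\<integral>p. quadrant_kernel s l p * of_real (stretch p ^ n) \<partial>lborel_quadrant) =
      Beta (l + of_nat n) (s - of_nat n) * Gamma (1 - l + of_nat n)"
proof -
  let ?f = "Beta_kernel (l + of_nat n) (s - of_nat n)" and ?g = "Gamma_kernel (1 - l + of_nat n) 1"
  have Re_pos: "0 < Re (l + of_nat n)" "0 < Re (s - of_nat n)" "0 < Re (1 - l + of_nat n)"
    using l s by auto
  have f: "integrable lborel_pos ?f" by (rule integrable_Beta_kernel[OF Re_pos(1,2)])
  have g: "integrable lborel_pos ?g" by (rule integrable_Gamma_kernel[OF Re_pos(3)]) simp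
  have "integrable lborel_quadrant (\<lambda>p. quadrant_kernel s l p * of_real (stretch p ^ n)) \<longleftrightarrow>
      integrable lborel_quadrant (\<lambda>(y, q). ?f y * ?g q)"
    by (intro Bochner_Integration.integrable_cong refl quadrant_kernel_mult_stretch_power)
  then show "integrable lborel_quadrant (\<lambda>p. quadrant_kernel s l p * of_real (stretch p ^ n))"
    using integrable_pair_mult[OF sigma_finite_lborel_pos sigma_finite_lborel_pos f g] by blast
  have "(\<integral>p. quadrant_kernel s l p * of_real (stretch p ^ n) \<partial>lborel_quadrant) =
      (\<integral>(y, q). ?f y * ?g q \<partial>lborel_quadrant)"
    by (intro Bochner_Integration.integral_cong refl quadrant_kernel_mult_stretch_power)
  then show "(\<integral>p. quadrant_kernel s l p * of_real (stretch p ^ n) \<partial>lborel_quadrant) =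
      Beta (l + of_nat n) (s - of_nat n) * Gamma (1 - l + of_nat n)"
    unfolding integral_pair_mult[OF sigma_finite_lborel_pos sigma_finite_lborel_pos f g]
      integral_Beta_kernel[OF Re_pos(1,2)] integral_Gamma_kernel_1[OF Re_pos(3)] .
qed

lemma
  assumes l: "- real n < Re l" "Re l < real n + 1" and s: "real n < Re s"
  shows integrable_norm_quadrant_moment:
      "integrable lborel_quadrant (\<lambda>p. cmod (quadrant_kernel s l p) * stretch p ^ n)"
    and integral_norm_quadrant_moment:
      "(\<integral>p. cmod (quadrant_kernel s l p) * stretch p ^ n \<partial>lborel_quadrant) =
        Beta (Re l + real n) (Re s - real n) * Gamma (1 - Re l + real n)"
proof -
  define K where "K p = quadrant_kernel (of_real (Re s)) (of_real (Re l)) p *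
      of_real (stretch p ^ n)" for p
  have K: "integrable lborel_quadrant K"
    "integral\<^sup>L lborel_quadrant K =
        of_real (Beta (Re l + real n) (Re s - real n) * Gamma (1 - Re l + real n))"
    using integrable_quadrant_moment[of n "of_real (Re l)" "of_real (Re s)"]
      integral_quadrant_moment[of n "of_real (Re l)" "of_real (Re s)"] l s
    by (simp_all add: K_def[abs_def] Beta_complex_of_real[symmetric]
      Gamma_complex_of_real[symmetric])
  have norm_eq: "of_real (cmod (quadrant_kernel s l p) * stretch p ^ n) = K p"
    if "p \<in> space lborel_quadrant" for p
    using norm_quadrant_kernel[OF that, of s l] by (simp add: K_def)
  have "complex_integrable lborel_quadrant
      (\<lambda>p. of_real (cmod (quadrant_kernel s l p) * stretch p ^ n))"
    using K(1) by (subst Bochner_Integration.integrable_cong[OF refl norm_eq]) auto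
  then show "integrable lborel_quadrant (\<lambda>p. cmod (quadrant_kernel s l p) * stretch p ^ n)"
    by (simp only: complex_of_real_integrable_eq)
  have "complex_of_real (\<integral>p. cmod (quadrant_kernel s l p) * stretch p ^ n \<partial>lborel_quadrant) =
      integral\<^sup>L lborel_quadrant K"
    unfolding integral_complex_of_real[symmetric]
    by (intro Bochner_Integration.integral_cong refl norm_eq)
  then show "(\<integral>p. cmod (quadrant_kernel s l p) * stretch p ^ n \<partial>lborel_quadrant) =
      Beta (Re l + real n) (Re s - real n) * Gamma (1 - Re l + real n)"
    unfolding K(2) by (simp only: of_real_eq_iff)
qed

lemma
  assumes l: "- real k < Re l" "Re l < real k + 1" and s: "real k < Re s"
    and \<phi>: "\<phi> \<in> borel_measurable lborel_quadrant"
    and bound: "\<And>p. p \<in> space lborel_quadrant \<Longrightarrow> cmod (\<phi> p) \<le> c * (stretch p ^ k / fact k)"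
  shows integrable_quadrant_kernel_mult:
      "integrable lborel_quadrant (\<lambda>p. quadrant_kernel s l p * \<phi> p)"
    and norm_integral_quadrant_kernel_mult_le:
      "cmod (\<integral>p. quadrant_kernel s l p * \<phi> p \<partial>lborel_quadrant) \<le>
        c / fact k * (Beta (Re l + real k) (Re s - real k) * Gamma (1 - Re l + real k))"
proof -
  define m where "m p = cmod (quadrant_kernel s l p) * stretch p ^ k" for p
  have le: "cmod (quadrant_kernel s l p * \<phi> p) \<le> c / fact k * m p"
    if "p \<in> space lborel_quadrant" for p
    using mult_left_mono[OF bound[OF that] norm_ge_zero[of "quadrant_kernel s l p"]]
    by (simp add: m_def norm_mult mult_ac)
  have m: "integrable lborel_quadrant (\<lambda>p. c / fact k * m p)"
    unfolding m_def by (intro integrable_mult_right integrable_norm_quadrant_moment l s)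
  then show integrable: "integrable lborel_quadrant (\<lambda>p. quadrant_kernel s l p * \<phi> p)"
  proof (rule Bochner_Integration.integrable_bound)
    show "(\<lambda>p. quadrant_kernel s l p * \<phi> p) \<in> borel_measurable lborel_quadrant"
      by (intro borel_measurable_times borel_measurable_quadrant_kernel \<phi>)
    show "AE p in lborel_quadrant. cmod (quadrant_kernel s l p * \<phi> p) \<le> norm (c / fact k * m p)"
      unfolding real_norm_def by (intro AE_I2 order_trans[OF le abs_ge_self])
  qed
  have "cmod (\<integral>p. quadrant_kernel s l p * \<phi> p \<partial>lborel_quadrant) \<le>
      (\<integral>p. c / fact k * m p \<partial>lborel_quadrant)"
    by (rule order_trans[OF integral_norm_bound])
      (intro integral_mono integrable_norm integrable m le)
  also have "\<dots> = c / fact k * integral\<^sup>L lborel_quadrant m" by (rule integral_mult_right_zero)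
  also have "integral\<^sup>L lborel_quadrant m =
      Beta (Re l + real k) (Re s - real k) * Gamma (1 - Re l + real k)"
    unfolding m_def by (rule integral_norm_quadrant_moment[OF l s])
  finally show "cmod (\<integral>p. quadrant_kernel s l p * \<phi> p \<partial>lborel_quadrant) \<le>
      c / fact k * (Beta (Re l + real k) (Re s - real k) * Gamma (1 - Re l + real k))" .
qed

lemma norm_Gamma_mult_integral_quadrant_kernel_le:
  assumes l: "- real k < Re l" "Re l < real k + 1" and s: "real k < Re s"
    and \<phi>: "\<phi> \<in> borel_measurable lborel_quadrant"
    and bound: "\<And>p. p \<in> space lborel_quadrant \<Longrightarrow> cmod (\<phi> p) \<le> c * (stretch p ^ k / fact k)"
  shows "cmod (Gamma (s + l) * (\<integral>p. quadrant_kernel s l p * \<phi> p \<partial>lborel_quadrant)) \<le>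
    c * (pi * 2 ^ k * acoef_sin_ratio k (Re l) * Gamma (Re s - real k))"
proof -
  have Re_pos: "0 < Re (s + l)" using l s by simp
  have "cmod (Gamma (s + l) * (\<integral>p. quadrant_kernel s l p * \<phi> p \<partial>lborel_quadrant)) \<le>
      Gamma (Re (s + l)) * (c / fact k *
        (Beta (Re l + real k) (Re s - real k) * Gamma (1 - Re l + real k)))"
    unfolding norm_mult using Gamma_real_pos[OF Re_pos]
    by (intro mult_mono norm_Gamma_le_Gamma_Re[OF Re_pos]
        norm_integral_quadrant_kernel_mult_le[OF l s \<phi> bound]) auto
  also have "\<dots> = c / fact k * (Gamma (Re l + real k) * Gamma (Re s - real k)) *
      Gamma (1 - Re l + real k)"
    using Gamma_real_pos[OF Re_pos] by (simp add: Beta_def add.commute)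
  also have "\<dots> = c * (pi * 2 ^ k * acoef_sin_ratio k (Re l) * Gamma (Re s - real k))"
    unfolding acoef_sin_ratio_eq[OF l] by (simp add: field_simps)
  finally show ?thesis .
qed

definition remainder_integral :: "nat \<Rightarrow> complex \<Rightarrow> complex \<Rightarrow> complex \<Rightarrow> complex" where
  "remainder_integral N s l w =
      (\<integral>p. quadrant_kernel s l p * exp_remainder N w (stretch p) \<partial>lborel_quadrant)"

lemma borel_measurable_exp_remainder_stretch:
  "(\<lambda>p. exp_remainder N w (stretch p)) \<in> borel_measurable lborel_quadrant"
  by (rule measurable_compose[OF borel_measurable_stretch borel_measurable_exp_remainder])

lemma
  assumes w: "0 < Re w" and l: "- real N < Re l" "Re l < real N + 1" and s: "real N < Re s"
  shows integrable_remainder_integral: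
      "integrable lborel_quadrant (\<lambda>p. quadrant_kernel s l p * exp_remainder N w (stretch p))"
    and norm_remainder_integral_le: "cmod (Gamma (s + l) * remainder_integral N s l w) \<le>
      pi * 2 ^ N * acoef_sin_ratio N (Re l) * Gamma (Re s - real N)"
proof -
  have bound: "cmod (exp_remainder N w (stretch p)) \<le> 1 * (stretch p ^ N / fact N)"
    if "p \<in> space lborel_quadrant" for p
    using norm_exp_remainder_le[OF w stretch_nonneg[OF that]] by simp
  show "integrable lborel_quadrant (\<lambda>p. quadrant_kernel s l p * exp_remainder N w (stretch p))"
    by (rule integrable_quadrant_kernel_mult[OF l s borel_measurable_exp_remainder_stretch bound])
  show "cmod (Gamma (s + l) * remainder_integral N s l w) \<le>
      pi * 2 ^ N * acoef_sin_ratio N (Re l) * Gamma (Re s - real N)"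
    using norm_Gamma_mult_integral_quadrant_kernel_le[OF l s
      borel_measurable_exp_remainder_stretch bound]
    by (simp add: remainder_integral_def)
qed

lemma norm_remainder_integral_diff_le:
  assumes w: "0 < Re w" "0 < Re w'" and l: "- real N < Re l" "Re l < real N + 1"
    and s: "real N + 1 < Re s"
  shows "cmod (Gamma (s + l) * (remainder_integral N s l w - remainder_integral N s l w')) \<le>
    cmod (w - w') * (pi * 2 ^ Suc N * acoef_sin_ratio (Suc N) (Re l) * Gamma (Re s - real N - 1))"
proof -
  have "remainder_integral N s l w - remainder_integral N s l w' =
      (\<integral>p. quadrant_kernel s l p *
        (exp_remainder N w (stretch p) - exp_remainder N w' (stretch p)) \<partial>lborel_quadrant)"
    unfolding remainder_integral_def right_diff_distrib using w l s
    by (intro Bochner_Integration.integral_diff[symmetric] integrable_remainder_integral) auto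
  moreover have "cmod (Gamma (s + l) *
      (\<integral>p. quadrant_kernel s l p *
        (exp_remainder N w (stretch p) - exp_remainder N w' (stretch p)) \<partial>lborel_quadrant)) \<le>
    cmod (w - w') * (pi * 2 ^ Suc N * acoef_sin_ratio (Suc N) (Re l) * Gamma (Re s - real (Suc N)))"
    using l s
    by (intro norm_Gamma_mult_integral_quadrant_kernel_le borel_measurable_diff
        borel_measurable_exp_remainder_stretch norm_exp_remainder_diff_le w stretch_nonneg) auto
  ultimately show ?thesis by (simp add: diff_diff_eq add.commute)
qed

lemma holomorphic_on_remainder_integral:
  assumes w: "0 < Re w" and s: "real N < Re s"
  shows "(\<lambda>l. remainder_integral N s l w) holomorphic_on vertical_strip (- real N) (real N + 1)"
  unfolding remainder_integral_def
proof (rule holomorphic_on_integral_exp[OF open_vertical_strip])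
  show "integrable lborel_quadrant (\<lambda>p. quadrant_kernel s l p * exp_remainder N w (stretch p))"
    if "l \<in> vertical_strip (- real N) (real N + 1)" for l
    using that w s by (intro integrable_remainder_integral) auto
  let ?f = "\<lambda>(y, q). exp (- s * of_real y) / of_real (1 - exp (- y)) * exp (- of_real q) *
      exp_remainder N w (stretch (y, q))"
  let ?g = "\<lambda>(y, q). of_real (ln (1 - exp (- y))) - of_real (ln q)"
  fix l :: complex and p assume "p \<in> space lborel_quadrant"
  then obtain y q where p: "p = (y, q)" "0 < y" "0 < q" by (auto simp: space_lborel_quadrant)
  have Gamma_kernel_eq: "Gamma_kernel (1 - l) 1 q = exp (- of_real q) / exp (l * of_real (ln q))"
    by (simp add: Gamma_kernel_def powr_complex_of_real_eq_exp[OF p(3)] exp_minus divide_inverse)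
  show "quadrant_kernel s l p * exp_remainder N w (stretch p) = ?f p * exp (l * ?g p)"
    unfolding quadrant_kernel_def p(1) prod.case Beta_kernel_eq_exp[OF p(2)] Gamma_kernel_eq
      right_diff_distrib exp_diff
    by (simp only: times_divide_eq_left times_divide_eq_right mult_ac)
qed

lemma remainder_integral_0:
  assumes w: "0 < Re w" and l: "0 < Re l" "Re l < 1" and s: "0 < Re s"
  shows "remainder_integral 0 s l w = Gamma (1 - l) * edge_integral s l w"
proof -
  interpret sigma_finite_measure lborel_pos by (rule sigma_finite_lborel_pos)
  interpret pair_sigma_finite lborel_pos lborel_pos ..
  have "integrable lborel_quadrant (\<lambda>p. quadrant_kernel s l p * exp_remainder 0 w (stretch p))"
    using assms by (intro integrable_remainder_integral) auto
  then have "remainder_integral 0 s l w =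
      (\<integral>y. \<integral>q. quadrant_kernel s l (y, q) * exp_remainder 0 w (stretch (y, q))
        \<partial>lborel_pos \<partial>lborel_pos)"
    unfolding remainder_integral_def by (rule integral_fst'[symmetric])
  also have "\<dots> = (\<integral>y. Gamma (1 - l) * edge_kernel s l w y \<partial>lborel_pos)"
  proof (intro Bochner_Integration.integral_cong refl)
    fix y assume "y \<in> space lborel_pos"
    then have y: "0 < y" by (simp add: space_lborel_pos)
    define v where "v = 1 + w * of_real (exp y - 1)"
    have v: "0 < Re v" unfolding v_def by (rule Re_edge_base_pos[OF w y])
    have "Gamma_kernel (1 - l) 1 q * exp_remainder 0 w (stretch (y, q)) =
        Gamma_kernel (1 - l) v q" for q
      unfolding exp_remainder_0 Gamma_kernel_def mult.assoc exp_add[symmetric]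
      by (simp add: v_def stretch_def algebra_simps)
    then have "(\<integral>q. quadrant_kernel s l (y, q) * exp_remainder 0 w (stretch (y, q)) \<partial>lborel_pos) =
        Beta_kernel l s y * integral\<^sup>L lborel_pos (Gamma_kernel (1 - l) v)"
      by (simp only: quadrant_kernel_def prod.case mult.assoc integral_mult_right_zero)
    also have "integral\<^sup>L lborel_pos (Gamma_kernel (1 - l) v) = Gamma (1 - l) * v powr (l - 1)"
      using integral_Gamma_kernel[of "1 - l" v] l v by simp
    finally show
        "(\<integral>q. quadrant_kernel s l (y, q) * exp_remainder 0 w (stretch (y, q)) \<partial>lborel_pos) =
        Gamma (1 - l) * edge_kernel s l w y"
      unfolding edge_kernel_def v_def by (simp only: mult_ac)
  qed
  finally show ?thesis unfolding edge_integral_def by (simp only: integral_mult_right_zero)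
qed

lemma remainder_integral_0_expansion:
  assumes w: "0 < Re w" and l: "0 < Re l" "Re l < 1" and s: "real N < Re s"
  shows "remainder_integral 0 s l w =
    (\<Sum>n<N. (- w) ^ n / fact n * (Beta (l + of_nat n) (s - of_nat n) * Gamma (1 - l + of_nat n))) +
    w ^ N * remainder_integral N s l w"
proof -
  define m where "m n p = quadrant_kernel s l p * of_real (stretch p ^ n)" for n p
  have m: "integrable lborel_quadrant (m n)"
    "integral\<^sup>L lborel_quadrant (m n) =
        Beta (l + of_nat n) (s - of_nat n) * Gamma (1 - l + of_nat n)" if "n < N" for n
    unfolding m_def using that l s
    by (intro integrable_quadrant_moment integral_quadrant_moment; simp)+
  have remainder:
      "integrable lborel_quadrant (\<lambda>p. quadrant_kernel s l p * exp_remainder N w (stretch p))"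
    using l s w by (intro integrable_remainder_integral) auto
  have "w \<noteq> 0" using w by auto
  then have "quadrant_kernel s l p * exp_remainder 0 w (stretch p) =
      (\<Sum>n<N. (- w) ^ n / fact n * m n p) +
        w ^ N * (quadrant_kernel s l p * exp_remainder N w (stretch p))" for p
    unfolding exp_remainder_0 exp_remainder_expansion[OF \<open>w \<noteq> 0\<close>, of _ N] m_def
    by (simp add: distrib_left sum_distrib_left mult_ac)
  then have "remainder_integral 0 s l w = (\<integral>p. (\<Sum>n<N. (- w) ^ n / fact n * m n p) +
      w ^ N * (quadrant_kernel s l p * exp_remainder N w (stretch p)) \<partial>lborel_quadrant)"
    unfolding remainder_integral_def by (simp only:)
  also have "\<dots> = (\<Sum>n<N. (- w) ^ n / fact n * integral\<^sup>L lborel_quadrant (m n)) +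
      w ^ N * remainder_integral N s l w"
    unfolding remainder_integral_def using m(1) remainder
    by (subst Bochner_Integration.integral_add) (auto simp: Bochner_Integration.integral_sum)
  finally show ?thesis using m(2) by simp
qed

lemma quadrant_moment_eq_acoef:
  assumes l: "- real n < Re l" "Re l < real n + 1" and s: "0 < Re (s + l)"
  shows "sin (of_real pi * l) / of_real pi * Gamma (s + l) *
      ((- w) ^ n / fact n * (Beta (l + of_nat n) (s - of_nat n) * Gamma (1 - l + of_nat n))) =
    acoef n (l - 1 / 2) * Gamma (s - of_nat n) * (2 * w) ^ n"
proof -
  define c where "c = sin (of_real pi * l) / of_real pi"
  have pochhammer: "pochhammer l n * pochhammer (1 - l) n =
      c * Gamma (l + of_nat n) * Gamma (1 - l + of_nat n)"
    unfolding c_def using l by (intro pochhammer_reflection) auto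
  have Gamma_Beta: "Gamma (s + l) * Beta (l + of_nat n) (s - of_nat n) =
      Gamma (l + of_nat n) * Gamma (s - of_nat n)"
    using Gamma_mult_rGamma_Re_pos[OF s] by (simp add: Beta_altdef add.commute)
  have "c * Gamma (s + l) *
      ((- w) ^ n / fact n * (Beta (l + of_nat n) (s - of_nat n) * Gamma (1 - l + of_nat n))) =
      c * (Gamma (s + l) * Beta (l + of_nat n) (s - of_nat n)) * Gamma (1 - l + of_nat n) *
        ((- w) ^ n / fact n)"
    by (simp only: mult_ac)
  also have "\<dots> = pochhammer l n * pochhammer (1 - l) n * Gamma (s - of_nat n) *
      ((- w) ^ n / fact n)"
    unfolding Gamma_Beta pochhammer by (simp only: mult_ac)
  also have "\<dots> = acoef n (l - 1 / 2) * Gamma (s - of_nat n) * (2 * w) ^ n"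
    unfolding acoef_eq_pochhammer power_minus[of w] power_mult_distrib[of 2] by simp
  finally show ?thesis unfolding c_def .
qed

lemma edge_integral_expansion:
  assumes w: "0 < Re w" and l: "0 < Re l" "Re l < 1" and s: "real N < Re s"
  shows "rGamma l * Gamma (s + l) * edge_integral s l w =
    (\<Sum>n<N. acoef n (l - 1 / 2) * Gamma (s - of_nat n) * (2 * w) ^ n) +
    sin (of_real pi * l) / of_real pi * w ^ N * (Gamma (s + l) * remainder_integral N s l w)"
proof -
  define c where "c = sin (of_real pi * l) / of_real pi"
  have "c * Gamma (1 - l) = rGamma l"
    unfolding c_def rGamma_reflection_complex[symmetric]
    using Gamma_mult_rGamma_Re_pos[of "1 - l"] l
    by (simp add: mult_ac)
  moreover have "remainder_integral 0 s l w = Gamma (1 - l) * edge_integral s l w"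
    using w l s by (intro remainder_integral_0) auto
  ultimately have "rGamma l * Gamma (s + l) * edge_integral s l w =
      c * Gamma (s + l) * remainder_integral 0 s l w"
    by (simp add: mult_ac)
  also have "\<dots> = (\<Sum>n<N. c * Gamma (s + l) * ((- w) ^ n / fact n *
        (Beta (l + of_nat n) (s - of_nat n) * Gamma (1 - l + of_nat n)))) +
      c * w ^ N * (Gamma (s + l) * remainder_integral N s l w)"
    unfolding remainder_integral_0_expansion[OF w l s]
    by (simp add: distrib_left sum_distrib_left mult_ac)
  also have "(\<Sum>n<N. c * Gamma (s + l) * ((- w) ^ n / fact n *
        (Beta (l + of_nat n) (s - of_nat n) * Gamma (1 - l + of_nat n)))) =
      (\<Sum>n<N. acoef n (l - 1 / 2) * Gamma (s - of_nat n) * (2 * w) ^ n)"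
    unfolding c_def using l s by (intro sum.cong refl quadrant_moment_eq_acoef) auto
  finally show ?thesis unfolding c_def .
qed

section \<open>The expansion in the full strip\<close>

lemma exp_gamma_phase:
  assumes "sin \<zeta> \<noteq> 0" and "\<sigma> = 1 \<or> \<sigma> = - 1"
  shows "exp (\<i> * of_real \<sigma> * gamma_phase \<zeta> l (s - l) n) =
    exp (\<i> * of_real \<sigma> * gamma_phase \<zeta> l (s - l) 0) * (2 * half_cot (\<sigma> * \<zeta>)) ^ n *
      of_real (sin \<zeta>) ^ n"
proof -
  have "exp (\<i> * of_real \<sigma> * of_real (pi / 2 - \<zeta>)) = cis (\<sigma> * (pi / 2 - \<zeta>))"
    by (simp add: cis_conv_exp mult.assoc)
  also have "\<dots> = 2 * half_cot (\<sigma> * \<zeta>) * of_real (sin \<zeta>)"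
    using assms by (auto simp: complex_eq_iff half_cot_def cot_def cos_diff sin_diff)
  finally have "exp (of_nat n * (\<i> * of_real \<sigma> * of_real (pi / 2 - \<zeta>))) =
      (2 * half_cot (\<sigma> * \<zeta>)) ^ n * of_real (sin \<zeta>) ^ n"
    by (simp only: exp_of_nat_mult power_mult_distrib)
  moreover have "\<i> * of_real \<sigma> * gamma_phase \<zeta> l (s - l) n =
      \<i> * of_real \<sigma> * gamma_phase \<zeta> l (s - l) 0 + of_nat n * (\<i> * of_real \<sigma> * of_real (pi / 2 - \<zeta>))"
    by (simp add: gamma_phase_def field_simps)
  ultimately show ?thesis by (simp only: exp_add mult.assoc)
qed

lemma exp_gamma_phase_mult_edge_integral:
  assumes S: "sin \<zeta> \<noteq> 0" and \<sigma>: "\<sigma> = 1 \<or> \<sigma> = - 1"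
    and l: "0 < Re l" "Re l < 1" and s: "real N < Re s"
  shows "exp (\<i> * of_real \<sigma> * gamma_phase \<zeta> l (s - l) 0) *
      (rGamma l * Gamma (s + l) * edge_integral s l (half_cot (\<sigma> * \<zeta>))) =
    (\<Sum>n<N. acoef n (l - 1 / 2) * Gamma (s - of_nat n) *
      (exp (\<i> * of_real \<sigma> * gamma_phase \<zeta> l (s - l) n) / of_real (sin \<zeta>) ^ n)) +
    sin (of_real pi * l) / (of_real pi * (2 * of_real (sin \<zeta>)) ^ N) *
      (exp (\<i> * of_real \<sigma> * gamma_phase \<zeta> l (s - l) N) *
       (Gamma (s + l) * remainder_integral N s l (half_cot (\<sigma> * \<zeta>))))"
proof -
  define w where "w = half_cot (\<sigma> * \<zeta>)"
  define e where "e n = exp (\<i> * of_real \<sigma> * gamma_phase \<zeta> l (s - l) n)" for n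
  have phase: "e 0 * (2 * w) ^ n = e n / of_real (sin \<zeta>) ^ n" for n
    unfolding e_def w_def exp_gamma_phase[OF S \<sigma>, of _ _ n] using S by simp
  then have phase_N: "e 0 * w ^ N = e N / (2 * of_real (sin \<zeta>)) ^ N"
    using S by (simp add: power_mult_distrib nonzero_eq_divide_eq mult_ac)
  have "e 0 * (rGamma l * Gamma (s + l) * edge_integral s l w) =
      e 0 * ((\<Sum>n<N. acoef n (l - 1 / 2) * Gamma (s - of_nat n) * (2 * w) ^ n) +
        sin (of_real pi * l) / of_real pi * w ^ N * (Gamma (s + l) * remainder_integral N s l w))"
    using l s by (subst edge_integral_expansion) (auto simp: w_def)
  also have "\<dots> = (\<Sum>n<N. acoef n (l - 1 / 2) * Gamma (s - of_nat n) * (e 0 * (2 * w) ^ n)) +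
      sin (of_real pi * l) / of_real pi * (e 0 * w ^ N) *
        (Gamma (s + l) * remainder_integral N s l w)"
    by (simp only: distrib_left sum_distrib_left mult_ac)
  finally show ?thesis
    unfolding phase phase_N unfolding e_def w_def by simp
qed

definition ferrers_remainder :: "nat \<Rightarrow> real \<Rightarrow> complex \<Rightarrow> complex \<Rightarrow> complex" where
  "ferrers_remainder N \<zeta> s l = sin (of_real pi * l) / (2 * of_real pi * (2 * of_real (sin \<zeta>)) ^ N) *
     (exp (\<i> * gamma_phase \<zeta> l (s - l) N) *
       (Gamma (s + l) * remainder_integral N s l (half_cot \<zeta>)) +
      exp (- (\<i> * gamma_phase \<zeta> l (s - l) N)) *
        (Gamma (s + l) * remainder_integral N s l (half_cot (- \<zeta>))))"

lemma ferrers_P_expansion_unit_strip: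
  assumes \<zeta>: "0 < \<zeta>" "\<zeta> < pi" and l: "0 < Re l" "Re l < 1" and s: "real N < Re s"
  shows "Gamma (s + l) *
      (of_real (sqrt (pi * sin \<zeta> / 2)) * ferrers_P (s - 1 / 2) (1 / 2 - l) (cos \<zeta>)) =
    (\<Sum>n<N. acoef n (l - 1 / 2) * Gamma (s - of_nat n) *
      (cos (gamma_phase \<zeta> l (s - l) n) / of_real (sin \<zeta> ^ n))) +
    ferrers_remainder N \<zeta> s l"
proof -
  define B where "B \<sigma> = Gamma (s + l) * remainder_integral N s l (half_cot (\<sigma> * \<zeta>))" for \<sigma>
  define E where "E \<sigma> n = exp (\<i> * of_real \<sigma> * gamma_phase \<zeta> l (s - l) n)" for \<sigma> n
  have S: "sin \<zeta> \<noteq> 0" using sin_gt_zero[OF \<zeta>] by simp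
  have edge: "E \<sigma> 0 * (rGamma l * Gamma (s + l) * edge_integral s l (half_cot (\<sigma> * \<zeta>))) =
      (\<Sum>n<N. acoef n (l - 1 / 2) * Gamma (s - of_nat n) * (E \<sigma> n / of_real (sin \<zeta>) ^ n)) +
      sin (of_real pi * l) / (of_real pi * (2 * of_real (sin \<zeta>)) ^ N) * (E \<sigma> N * B \<sigma>)"
    if "\<sigma> = 1 \<or> \<sigma> = - 1" for \<sigma>
    unfolding E_def B_def by (rule exp_gamma_phase_mult_edge_integral[OF S that l s])
  have "Gamma (s + l) *
        (of_real (sqrt (pi * sin \<zeta> / 2)) * ferrers_P (s - 1 / 2) (1 / 2 - l) (cos \<zeta>)) =
      (E 1 0 * (rGamma l * Gamma (s + l) * edge_integral s l (half_cot (1 * \<zeta>))) +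
       E (- 1) 0 * (rGamma l * Gamma (s + l) * edge_integral s l (half_cot (- 1 * \<zeta>)))) / 2"
    using l s by (subst ferrers_P_eq_edge_integrals[OF \<zeta>]) (auto simp: E_def algebra_simps)
  also have "\<dots> = (\<Sum>n<N. acoef n (l - 1 / 2) * Gamma (s - of_nat n) *
        ((E 1 n + E (- 1) n) / 2 / of_real (sin \<zeta>) ^ n)) +
      sin (of_real pi * l) / (2 * of_real pi * (2 * of_real (sin \<zeta>)) ^ N) *
        (E 1 N * B 1 + E (- 1) N * B (- 1))"
    by (subst (1 2) edge)
       (simp_all add: add_divide_distrib distrib_left sum.distrib sum_divide_distrib mult_ac)
  finally show ?thesis
    by (simp add: ferrers_remainder_def E_def B_def cos_exp_eq)
qed

lemma holomorphic_on_acoef [holomorphic_intros]: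
  "f holomorphic_on A \<Longrightarrow> (\<lambda>z. acoef n (f z)) holomorphic_on A"
  unfolding acoef_def by (intro holomorphic_intros) auto

lemma ferrers_P_expansion:
  assumes \<zeta>: "0 < \<zeta>" "\<zeta> < pi" and l: "- real N < Re l" "Re l < real N + 1" and s: "real N < Re s"
  shows "Gamma (s + l) *
      (of_real (sqrt (pi * sin \<zeta> / 2)) * ferrers_P (s - 1 / 2) (1 / 2 - l) (cos \<zeta>)) =
    (\<Sum>n<N. acoef n (l - 1 / 2) * Gamma (s - of_nat n) *
      (cos (gamma_phase \<zeta> l (s - l) n) / of_real (sin \<zeta> ^ n))) +
    ferrers_remainder N \<zeta> s l" (is "?L l = ?R l")
proof (rule analytic_continuation_vertical_strip[where f = ?L and g = ?R and c = 0 and d = 1])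
  let ?U = "vertical_strip (- real N) (real N + 1)"
  have S: "sin \<zeta> \<noteq> 0" using sin_gt_zero[OF \<zeta>] by simp
  have Gamma: "(\<lambda>l. Gamma (s + l)) holomorphic_on ?U"
  proof (rule holomorphic_Gamma')
    show "s + l \<notin> \<int>\<^sub>\<le>\<^sub>0" if "l \<in> ?U" for l
      using that s by (intro Re_pos_imp_notin_nonpos_Ints) auto
  qed (intro holomorphic_intros)
  show "?L holomorphic_on ?U"
    by (intro holomorphic_on_mult holomorphic_on_const Gamma holomorphic_on_ferrers_P_cos
        holomorphic_on_diff holomorphic_on_ident \<zeta>)
  have remainder: "(\<lambda>l. remainder_integral N s l (half_cot t)) holomorphic_on ?U" for t
    using s by (intro holomorphic_on_remainder_integral) auto
  have phase: "(\<lambda>l. gamma_phase \<zeta> l (s - l) n) holomorphic_on ?U" for n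
    unfolding gamma_phase_def by (intro holomorphic_intros)
  show "?R holomorphic_on ?U"
    unfolding ferrers_remainder_def using S
    by (intro holomorphic_on_add holomorphic_on_sum holomorphic_on_mult holomorphic_on_divide
        holomorphic_on_exp' holomorphic_on_sin' holomorphic_on_cos' holomorphic_on_minus
        holomorphic_on_acoef holomorphic_on_diff holomorphic_on_const holomorphic_on_ident
        Gamma remainder phase) auto
  show "?L (of_real x) = ?R (of_real x)" if "0 < x" "x < 1" for x
    using that by (intro ferrers_P_expansion_unit_strip \<zeta> s) auto
qed (use l in auto)

lemma norm_ferrers_remainder:
  assumes "0 < sin \<zeta>"
  shows "cmod (ferrers_remainder N \<zeta> s l) =
    cmod (sin (of_real pi * l)) / (2 * pi * (2 * sin \<zeta>) ^ N) *
    cmod (exp (\<i> * gamma_phase \<zeta> l (s - l) N) *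
        (Gamma (s + l) * remainder_integral N s l (half_cot \<zeta>)) +
      exp (- (\<i> * gamma_phase \<zeta> l (s - l) N)) *
        (Gamma (s + l) * remainder_integral N s l (half_cot (- \<zeta>))))"
  using assms unfolding ferrers_remainder_def by (simp add: norm_mult norm_divide norm_power)

lemma norm_ferrers_remainder_le_cosh:
  assumes "0 < sin \<zeta>" and l: "- real N < Re l" "Re l < real N + 1" and s: "real N < Re s"
  shows "cmod (ferrers_remainder N \<zeta> s l) \<le> cmod (sin (of_real pi * l)) * acoef_sin_ratio N (Re l) *
    Gamma (Re s - real N) * (cosh (Im (gamma_phase \<zeta> l (s - l) N)) / sin \<zeta> ^ N)"
proof -
  define \<gamma> where "\<gamma> = gamma_phase \<zeta> l (s - l) N"
  define b where "b = pi * 2 ^ N * acoef_sin_ratio N (Re l) * Gamma (Re s - real N)"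
  define B where "B t = Gamma (s + l) * remainder_integral N s l (half_cot t)" for t
  have B: "cmod (B t) \<le> b" for t
    unfolding B_def b_def using l s by (intro norm_remainder_integral_le) auto
  have "cmod (exp (\<i> * \<gamma>) * B \<zeta> + exp (- (\<i> * \<gamma>)) * B (- \<zeta>)) \<le> exp (- Im \<gamma>) * b + exp (Im \<gamma>) * b"
    by (intro norm_triangle_mono) (simp_all add: norm_mult B)
  also have "\<dots> = 2 * cosh (Im \<gamma>) * b" by (simp add: cosh_def algebra_simps)
  finally have "cmod (ferrers_remainder N \<zeta> s l) \<le>
      cmod (sin (of_real pi * l)) / (2 * pi * (2 * sin \<zeta>) ^ N) * (2 * cosh (Im \<gamma>) * b)"
    unfolding norm_ferrers_remainder[OF assms(1)] \<gamma>_def[symmetric] B_def[symmetric]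
    using assms(1) by (intro mult_left_mono) auto
  also have "\<dots> = cmod (sin (of_real pi * l)) * acoef_sin_ratio N (Re l) * Gamma (Re s - real N) *
      (cosh (Im \<gamma>) / sin \<zeta> ^ N)"
    using assms(1) by (simp add: b_def power_mult_distrib field_simps)
  finally show ?thesis unfolding \<gamma>_def .
qed

lemma norm_half_cot_diff_le:
  assumes "0 < sin \<zeta>"
  shows "cmod (half_cot \<zeta> - half_cot (- \<zeta>)) \<le> 1 / sin \<zeta>"
proof -
  have "half_cot \<zeta> - half_cot (- \<zeta>) = Complex 0 (cot \<zeta>)"
    by (simp add: half_cot_def complex_eq_iff)
  then have "cmod (half_cot \<zeta> - half_cot (- \<zeta>)) = \<bar>cos \<zeta>\<bar> / sin \<zeta>"
    using assms by (simp add: cmod_def cot_def)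
  then show ?thesis using assms by (simp add: divide_right_mono)
qed

lemma exp_ii_mult_add_exp_minus_ii_mult:
  "exp (\<i> * z) * u + exp (- (\<i> * z)) * v = cos z * (u + v) + \<i> * sin z * (u - v)"
  unfolding cos_exp_eq sin_exp_eq by (simp add: field_simps)

lemma norm_ferrers_remainder_le_cos_sin:
  assumes S: "0 < sin \<zeta>" and l: "- real N < Re l" "Re l < real N + 1" and s: "real N + 1 < Re s"
  shows "cmod (ferrers_remainder N \<zeta> s l) \<le>
    cmod (sin (of_real pi * l)) * acoef_sin_ratio N (Re l) * Gamma (Re s - real N) *
      (cmod (cos (gamma_phase \<zeta> l (s - l) N)) / sin \<zeta> ^ N) +
    cmod (sin (of_real pi * l)) * acoef_sin_ratio (Suc N) (Re l) * Gamma (Re s - real N - 1) *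
      (cmod (sin (gamma_phase \<zeta> l (s - l) N)) / sin \<zeta> ^ Suc N)"
proof -
  define \<gamma> where "\<gamma> = gamma_phase \<zeta> l (s - l) N"
  define b where "b = pi * 2 ^ N * acoef_sin_ratio N (Re l) * Gamma (Re s - real N)"
  define b' where "b' = pi * 2 ^ Suc N * acoef_sin_ratio (Suc N) (Re l) * Gamma (Re s - real N - 1)"
  define B where "B t = Gamma (s + l) * remainder_integral N s l (half_cot t)" for t
  have B: "cmod (B t) \<le> b" for t
    unfolding B_def b_def using l s by (intro norm_remainder_integral_le) auto
  have "0 \<le> b'"
    unfolding b'_def using l s
    by (intro mult_nonneg_nonneg less_imp_le[OF Gamma_real_pos] acoef_sin_ratio_nonneg) auto
  have "cmod (B \<zeta> - B (- \<zeta>)) \<le> cmod (half_cot \<zeta> - half_cot (- \<zeta>)) * b'"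
    unfolding B_def b'_def right_diff_distrib[symmetric]
    using l s by (intro norm_remainder_integral_diff_le) auto
  also have "\<dots> \<le> 1 / sin \<zeta> * b'"
    by (intro mult_right_mono norm_half_cot_diff_le S \<open>0 \<le> b'\<close>)
  finally have B_diff: "cmod (B \<zeta> - B (- \<zeta>)) \<le> 1 / sin \<zeta> * b'" .
  have "cmod (exp (\<i> * \<gamma>) * B \<zeta> + exp (- (\<i> * \<gamma>)) * B (- \<zeta>)) =
      cmod (cos \<gamma> * (B \<zeta> + B (- \<zeta>)) + \<i> * sin \<gamma> * (B \<zeta> - B (- \<zeta>)))"
    by (simp only: exp_ii_mult_add_exp_minus_ii_mult)
  also have "\<dots> \<le> cmod (cos \<gamma>) * (b + b) + cmod (sin \<gamma>) * (1 / sin \<zeta> * b')"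
    using mult_left_mono[OF norm_triangle_mono[OF B B] norm_ge_zero]
      mult_left_mono[OF B_diff norm_ge_zero]
    by (intro norm_triangle_mono) (simp_all only: norm_mult norm_ii mult_1)
  finally have "cmod (ferrers_remainder N \<zeta> s l) \<le>
      cmod (sin (of_real pi * l)) / (2 * pi * (2 * sin \<zeta>) ^ N) *
      (cmod (cos \<gamma>) * (b + b) + cmod (sin \<gamma>) * (1 / sin \<zeta> * b'))"
    unfolding norm_ferrers_remainder[OF S] \<gamma>_def[symmetric] B_def[symmetric]
    using S by (intro mult_left_mono) auto
  also have "\<dots> = cmod (sin (of_real pi * l)) * acoef_sin_ratio N (Re l) * Gamma (Re s - real N) *
      (cmod (cos \<gamma>) / sin \<zeta> ^ N) +
    cmod (sin (of_real pi * l)) * acoef_sin_ratio (Suc N) (Re l) * Gamma (Re s - real N - 1) *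
      (cmod (sin \<gamma>) / sin \<zeta> ^ Suc N)"
    using S by (simp add: b_def b'_def power_mult_distrib field_simps)
  finally show ?thesis unfolding \<gamma>_def .
qed

lemma gegenbauer_C_eq_ferrers_P:
  assumes "0 < \<zeta>" "\<zeta> < pi"
  shows "gegenbauer_C \<nu> l (cos \<zeta>) = 2 * rGamma l / of_real (2 * sin \<zeta>) powr l * (rGamma (\<nu> + 1) *
    (Gamma (\<nu> + l + l) * (of_real (sqrt (pi * sin \<zeta> / 2)) *
      ferrers_P (\<nu> + l - 1 / 2) (1 / 2 - l) (cos \<zeta>))))"
proof -
  have S: "0 < sin \<zeta>" using assms by (rule sin_gt_zero)
  then have sin: "sqrt (1 - (cos \<zeta>)\<^sup>2) = sin \<zeta>" by (simp add: sin_squared_eq[symmetric])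
  have factor: "of_real (sqrt pi) / of_real (2 * sin \<zeta>) powr (l - 1 / 2) =
      2 / of_real (2 * sin \<zeta>) powr l * complex_of_real (sqrt (pi * sin \<zeta> / 2))"
  proof -
    have "of_real (2 * sin \<zeta>) powr (1 / 2) = complex_of_real (sqrt (2 * sin \<zeta>))"
      using S powr_of_real[of "2 * sin \<zeta>" "1 / 2"] by (simp add: powr_half_sqrt)
    moreover have "sqrt pi * sqrt (2 * sin \<zeta>) = 2 * sqrt (pi * sin \<zeta> / 2)"
      by (simp add: real_sqrt_mult real_sqrt_divide field_simps)
    then have "complex_of_real (sqrt pi * sqrt (2 * sin \<zeta>)) = of_real (2 * sqrt (pi * sin \<zeta> / 2))"
      by (rule arg_cong)
    ultimately show ?thesis
      unfolding powr_diff of_real_mult[of "sqrt pi"] of_real_mult[of 2 "sqrt _"]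
      by (simp only: divide_divide_eq_right) simp
  qed
  have "gegenbauer_C \<nu> l (cos \<zeta>) = of_real (sqrt pi) / of_real (2 * sin \<zeta>) powr (l - 1 / 2) *
      (Gamma (\<nu> + l + l) * rGamma l * rGamma (\<nu> + 1) *
        ferrers_P (\<nu> + l - 1 / 2) (1 / 2 - l) (cos \<zeta>))"
    unfolding gegenbauer_C_def sin mult_2 add.assoc
    by (simp only: times_divide_eq_left times_divide_eq_right mult_ac)
  then show ?thesis
    unfolding factor by (simp only: times_divide_eq_left times_divide_eq_right mult_ac)
qed

definition gegenbauer_remainder :: "nat \<Rightarrow> real \<Rightarrow> complex \<Rightarrow> complex \<Rightarrow> complex" where
  "gegenbauer_remainder N \<zeta> l \<nu> = ferrers_remainder N \<zeta> (\<nu> + l) l / Gamma (\<nu> + 1)"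

lemma gegenbauer_C_expansion:
  assumes \<zeta>: "0 < \<zeta>" "\<zeta> < pi" and l: "- real N < Re l" "Re l < real N + 1"
    and s: "real N < Re (\<nu> + l)"
  shows "gegenbauer_C \<nu> l (cos \<zeta>) = 2 * rGamma l / of_real (2 * sin \<zeta>) powr l *
    ((\<Sum>n<N. acoef n (l - 1 / 2) * (Gamma (\<nu> + l - of_nat n) / Gamma (\<nu> + 1)) *
      (cos (gamma_phase \<zeta> l \<nu> n) / of_real (sin \<zeta> ^ n))) + gegenbauer_remainder N \<zeta> l \<nu>)"
  unfolding gegenbauer_C_eq_ferrers_P[OF \<zeta>] ferrers_P_expansion[OF \<zeta> l s] gegenbauer_remainder_def
    rGamma_inverse_Gamma
  by (simp add: distrib_left sum_distrib_left field_simps)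

lemma norm_gegenbauer_remainder_le_cosh:
  assumes S: "0 < sin \<zeta>" and l: "- real N < Re l" "Re l < real N + 1" and s: "real N < Re (\<nu> + l)"
  shows "cmod (gegenbauer_remainder N \<zeta> l \<nu>) \<le>
    cmod (sin (of_real pi * l)) * acoef_sin_ratio N (Re l) *
    (Gamma (Re \<nu> + Re l - real N) / cmod (Gamma (\<nu> + 1))) *
    (cosh (Im (gamma_phase \<zeta> l \<nu> N)) / sin \<zeta> ^ N)"
  using divide_right_mono[OF norm_ferrers_remainder_le_cosh[OF S l s]
    norm_ge_zero[of "Gamma (\<nu> + 1)"]]
  by (simp add: gegenbauer_remainder_def norm_divide mult_ac)

lemma norm_gegenbauer_remainder_le_cos_sin:
  assumes S: "0 < sin \<zeta>" and l: "- real N < Re l" "Re l < real N + 1"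
    and s: "real N + 1 < Re (\<nu> + l)"
  shows "cmod (gegenbauer_remainder N \<zeta> l \<nu>) \<le>
    cmod (sin (of_real pi * l)) * acoef_sin_ratio N (Re l) *
      (Gamma (Re \<nu> + Re l - real N) / cmod (Gamma (\<nu> + 1))) *
      (cmod (cos (gamma_phase \<zeta> l \<nu> N)) / sin \<zeta> ^ N) +
    cmod (sin (of_real pi * l)) * acoef_sin_ratio (Suc N) (Re l) *
      (Gamma (Re \<nu> + Re l - real N - 1) / cmod (Gamma (\<nu> + 1))) *
      (cmod (sin (gamma_phase \<zeta> l \<nu> N)) / sin \<zeta> ^ Suc N)"
  using divide_right_mono[OF norm_ferrers_remainder_le_cos_sin[OF S l s]
    norm_ge_zero[of "Gamma (\<nu> + 1)"]]
  by (simp add: gegenbauer_remainder_def norm_divide add_divide_distrib mult_ac)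

theorem corollary5p2:
  fixes \<zeta> :: real and N :: nat and l \<nu> :: complex
  assumes "0 < \<zeta>" and "\<zeta> < pi"
    and "\<bar>Re l - 1 / 2\<bar> < real N + 1 / 2"
    and "Re \<nu> > real N - Re l"
  shows "\<exists>R :: complex.
      gegenbauer_C \<nu> l (cos \<zeta>) =
        2 * rGamma l / of_real (2 * sin \<zeta>) powr l *
        ((\<Sum>n<N. acoef n (l - 1 / 2) * (Gamma (\<nu> + l - of_nat n) / Gamma (\<nu> + 1)) *
                 (cos (gamma_phase \<zeta> l \<nu> n) / of_real (sin \<zeta> ^ n))) + R) \<and>
      norm R \<le>
        norm (sin (of_real pi * l)) * acoef_sin_ratio N (Re l) *
        (Gamma (Re \<nu> + Re l - real N) / norm (Gamma (\<nu> + 1))) *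
        (cosh (Im (gamma_phase \<zeta> l \<nu> N)) / sin \<zeta> ^ N) \<and>
      (Re \<nu> > real N - Re l + 1 \<longrightarrow>
        norm R \<le>
          norm (sin (of_real pi * l)) * acoef_sin_ratio N (Re l) *
          (Gamma (Re \<nu> + Re l - real N) / norm (Gamma (\<nu> + 1))) *
          (norm (cos (gamma_phase \<zeta> l \<nu> N)) / sin \<zeta> ^ N)
          + norm (sin (of_real pi * l)) * acoef_sin_ratio (Suc N) (Re l) *
          (Gamma (Re \<nu> + Re l - real N - 1) / norm (Gamma (\<nu> + 1))) *
          (norm (sin (gamma_phase \<zeta> l \<nu> N)) / sin \<zeta> ^ Suc N))"
proof -
  have S: "0 < sin \<zeta>" using assms(1,2) by (rule sin_gt_zero)
  have l: "- real N < Re l" "Re l < real N + 1" using assms(3) by (auto simp: abs_less_iff)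
  show ?thesis
    using assms(1,2,4) S l
    by (intro exI[of _ "gegenbauer_remainder N \<zeta> l \<nu>"] conjI impI gegenbauer_C_expansion
        norm_gegenbauer_remainder_le_cosh norm_gegenbauer_remainder_le_cos_sin) simp_all
qed

end
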